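(* Let $X: M^m \to \mathbb{R}^{m+n}_n$ be a spacelike entire self-shrinking graph. Assume that the origin $o$ of $\mathbb{R}^{m+n}_n$ belongs to $M^m$ and that $M^m$ is not a linear subspace of $\mathbb{R}^{m+n}_n$. Then the mean curvature vector $H$ of $M^m$ satisfies $$\limsup_{R\to\infty}\frac{R^2}{\log\left(\int_{D_R}\|H\|^4e^{-\frac{z}{4}}\right)}\leq4\sqrt{m}.$$
   Context: $\mathbb{R}^{m+n}_n$ is the linear space $\mathbb{R}^{m+n}$ with the indefinite inner product $\langle a,b\rangle=\sum_{i=1}^m a_ib_i-\sum_{\alpha=m+1}^{m+n}a_\alpha b_\alpha$; for a vector $a$, $|a|^2:=\langle a,a\rangle$ and $\|a\|:=\sqrt{|\langle a,a\rangle|}$. An $m$-dimensional submanifold $M^m$ (smooth, with position vector $X$) is spacelike if the induced metric is Riemannian. It is an entire graph if $M^m=\{(x,u(x)) : x\in\mathbb{R}^m\}$ for a smooth map $u=(u^1,\dots,u^n):\mathbb{R}^m\to\mathbb{R}^n$. The second fundamental form is $B_{UW}=(\overline{\nabla}_UW)^N$, where $\overline\nabla$ is the flat connection and $(\cdot)^N$ is the orthogonal projection onto the normal bundle, and $H=\sum_{i=1}^m B_{e_ie_i}$ for a local orthonormal frame $\{e_i\}$ of $TM^m$ is the mean curvature vector. $M^m$ is a self-shrinker (self-shrinking) if $H=-\frac12X^N$. The function $z$ is $z=|X|^2=\langle X,X\rangle$, and $D_R=M^m\cap\{p\in\mathbb{R}^{m+n}_n: z(p)\le R^2\}$. Integrals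 over subsets of $M^m$ are with respect to the Riemannian volume of the induced metric. *)

theory Defs
  imports "HOL-Analysis.Analysis"
begin

text \<open>
  The ambient space is modelled by pairs: \<open>(real^'m) \<times> (real^'n)\<close>, with the first factor
  carrying the positive and the second the negative part of the inner product.  A submanifold
  with a global chart is given by its position map \<open>X\<close> from \<open>real^'m\<close>; the tangent space at
  \<open>X x\<close> is identified with \<open>real^'m\<close> through the differential of \<open>X\<close> at \<open>x\<close>, and functions and
  subsets of the submanifold are pulled back to \<open>real^'m\<close> (\<open>X\<close> is injective for a graph).
\<close>

definition pinner :: "(real^'m) \<times> (real^'n) \<Rightarrow> (real^'m) \<times> (real^'n) \<Rightarrow> real" where
  "pinner a b = fst a \<bullet> fst b - snd a \<bullet> snd b"

definition pnorm :: "(real^'m) \<times> (real^'n) \<Rightarrow> real" where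
  "pnorm a = sqrt \<bar>pinner a a\<bar>"

primrec C_times :: "nat \<Rightarrow> ('a::euclidean_space \<Rightarrow> 'b::real_normed_vector) \<Rightarrow> bool" where
  "C_times 0 f \<longleftrightarrow> continuous_on UNIV f"
| "C_times (Suc k) f \<longleftrightarrow>
     (\<forall>x. f differentiable (at x)) \<and> (\<forall>b\<in>Basis. C_times k (\<lambda>x. frechet_derivative f (at x) b))"

definition smooth_map :: "('a::euclidean_space \<Rightarrow> 'b::real_normed_vector) \<Rightarrow> bool" where
  "smooth_map f \<longleftrightarrow> (\<forall>k. C_times k f)"

definition graph_map :: "(real^'m \<Rightarrow> real^'n) \<Rightarrow> real^'m \<Rightarrow> (real^'m) \<times> (real^'n)" where
  "graph_map u x = (x, u x)"

abbreviation differential ::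
  "(real^'m \<Rightarrow> (real^'m) \<times> (real^'n)) \<Rightarrow> real^'m \<Rightarrow> real^'m \<Rightarrow> (real^'m) \<times> (real^'n)" where
  "differential X x \<equiv> frechet_derivative X (at x)"

definition induced_metric ::
  "(real^'m \<Rightarrow> (real^'m) \<times> (real^'n)) \<Rightarrow> real^'m \<Rightarrow> real^'m \<Rightarrow> real^'m \<Rightarrow> real" where
  "induced_metric X x v w = pinner (differential X x v) (differential X x w)"

definition spacelike :: "(real^'m \<Rightarrow> (real^'m) \<times> (real^'n)) \<Rightarrow> bool" where
  "spacelike X \<longleftrightarrow> (\<forall>x v. v \<noteq> 0 \<longrightarrow> induced_metric X x v v > 0)"

definition tangent_space ::
  "(real^'m \<Rightarrow> (real^'m) \<times> (real^'n)) \<Rightarrow> real^'m \<Rightarrow> ((real^'m) \<times> (real^'n)) set" where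
  "tangent_space X x = range (differential X x)"

definition normal_space ::
  "(real^'m \<Rightarrow> (real^'m) \<times> (real^'n)) \<Rightarrow> real^'m \<Rightarrow> ((real^'m) \<times> (real^'n)) set" where
  "normal_space X x = {\<nu>. \<forall>t\<in>tangent_space X x. pinner \<nu> t = 0}"

text \<open>For spacelike \<open>X\<close> the ambient space is the direct sum of the tangent and the normal space,
  so the description below determines a unique vector.\<close>

definition normal_proj ::
  "(real^'m \<Rightarrow> (real^'m) \<times> (real^'n)) \<Rightarrow> real^'m \<Rightarrow> (real^'m) \<times> (real^'n) \<Rightarrow> (real^'m) \<times> (real^'n)"
where
  "normal_proj X x a = (THE \<nu>. \<nu> \<in> normal_space X x \<and> a - \<nu> \<in> tangent_space X x)"

text \<open>\<open>U\<close> and \<open>W\<close> are vector fields on the submanifold in the global chart; the corresponding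
  ambient field along \<open>X\<close> is \<open>y \<mapsto> differential X y (W y)\<close>.\<close>

definition second_fund_form ::
  "(real^'m \<Rightarrow> (real^'m) \<times> (real^'n)) \<Rightarrow> (real^'m \<Rightarrow> real^'m) \<Rightarrow> (real^'m \<Rightarrow> real^'m)
     \<Rightarrow> real^'m \<Rightarrow> (real^'m) \<times> (real^'n)" where
  "second_fund_form X U W x =
     normal_proj X x (frechet_derivative (\<lambda>y. differential X y (W y)) (at x) (U x))"

definition orthonormal_basis_at ::
  "(real^'m \<Rightarrow> (real^'m) \<times> (real^'n)) \<Rightarrow> real^'m \<Rightarrow> ('m \<Rightarrow> real^'m) \<Rightarrow> bool" where
  "orthonormal_basis_at X x e \<longleftrightarrow>
     (\<forall>i j. induced_metric X x (e i) (e j) = (if i = j then 1 else 0))"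

text \<open>The second fundamental form is tensorial: its value at \<open>x\<close> depends only on the values of the
  two fields at \<open>x\<close>.  Hence an orthonormal basis of the tangent space at \<open>x\<close>, extended by fields
  with constant coordinates, gives the same sum as a local orthonormal frame, and the sum does
  not depend on the basis chosen.\<close>

definition mean_curvature ::
  "(real^'m \<Rightarrow> (real^'m) \<times> (real^'n)) \<Rightarrow> real^'m \<Rightarrow> (real^'m) \<times> (real^'n)" where
  "mean_curvature X x =
     (let e = (SOME e. orthonormal_basis_at X x e)
      in \<Sum>i\<in>UNIV. second_fund_form X (\<lambda>_. e i) (\<lambda>_. e i) x)"

definition self_shrinker :: "(real^'m \<Rightarrow> (real^'m) \<times> (real^'n)) \<Rightarrow> bool" where
  "self_shrinker X \<longleftrightarrow> (\<forall>x. mean_curvature X x = - (1/2) *\<^sub>R normal_proj X x (X x))"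

definition zfun :: "(real^'m \<Rightarrow> (real^'m) \<times> (real^'n)) \<Rightarrow> real^'m \<Rightarrow> real" where
  "zfun X x = pinner (X x) (X x)"

definition sublevel :: "(real^'m \<Rightarrow> (real^'m) \<times> (real^'n)) \<Rightarrow> real \<Rightarrow> (real^'m) set" where
  "sublevel X R = {x. zfun X x \<le> R\<^sup>2}"

definition volume_measure :: "(real^'m \<Rightarrow> (real^'m) \<times> (real^'n)) \<Rightarrow> (real^'m) measure" where
  "volume_measure X = density lborel
     (\<lambda>x. ennreal (sqrt (det (\<chi> i j. induced_metric X x (axis i 1) (axis j 1)))))"

end

theory Submission
  imports Defs
begin

text \<open>
  Write \<open>g = I - Du\<^sup>T Du\<close> for the induced metric in the graph coordinates.  On a self-shrinker the
  drift Laplacian takes the form \<open>L f = g\<^sup>i\<^sup>j \<partial>\<^sub>i\<partial>\<^sub>j f - x \<cdot> \<nabla> f / 2\<close>; it is symmetric with respect to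
  \<open>rho dx\<close>, where \<open>rho = sqrt (det g) exp (- z / 4)\<close>.  Let \<open>q = 4 \<parallel>H\<parallel>\<^sup>2\<close>.  Then \<open>L z = 2 m - z\<close>,
  \<open>|\<nabla>z|\<^sup>2 = 4 (z + q)\<close>, and a Bochner computation gives, for every real \<open>\<tau>\<close>,
  \<open>L q + 2 \<tau> \<langle>\<nabla>z, \<nabla>q\<rangle> \<ge> q + q\<^sup>2 / (2 m) - 8 \<tau>\<^sup>2 (z + q) q\<close>.

  Since the origin lies on the graph, \<open>z\<close> is nonnegative and proper, and testing the equation for \<open>z\<close>
  shows that the weighted volume is finite.  Testing the inequality for \<open>q\<close> with a cutoff that
  decays like \<open>exp (- a z)\<close>, \<open>a = 1 / (7 sqrt m)\<close>, absorbs the error terms into \<open>q + q\<^sup>2 / (2 m)\<close>,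
  up to the weighted volume of the far region.  If \<open>q\<^sup>2\<close> had integral at most
  \<open>16 exp (R\<^sup>2 / (4 sqrt m))\<close> over \<open>D\<^sub>R\<close> for arbitrarily large \<open>R\<close>, the boundary terms would vanish because
  \<open>1 / (4 sqrt m) < 2 a\<close>, so \<open>q = 0\<close>.  Then \<open>X\<^sup>N = 0\<close>, \<open>u\<close> is homogeneous of degree one, hence linear.
\<close>

section \<open>Smooth maps and partial derivatives\<close>

text \<open>The gradient of \<open>z\<close> has a length that itself contains \<open>q\<close>, so
  every cutoff in \<open>z\<close> creates an error quadratic in \<open>q\<close>, and
  \<open>q\<close> is not known to be bounded. Only the Bochner term
  \<open>q\<^sup>2 / (2 m)\<close> can pay for it, which limits the logarithmic rate
  \<open>a\<close> of the cutoff. Relative to the squared cutoff the error is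
  \<open>8 a\<^sup>2 q\<^sup>2\<close>; keeping half of the good terms in reserve requires
  \<open>8 a\<^sup>2 < 1 / (4 m)\<close>, that is \<open>a < 1 / (4 sqrt (2 m))\<close>. Beating
  growth \<open>exp (z / (4 sqrt m))\<close> by the squared cutoff requires
  \<open>a > 1 / (8 sqrt m)\<close>. The value \<open>1 / (7 sqrt m)\<close> lies in this window
  with room for lower-order corrections. The mixed error \<open>z q\<close> needs a different
  device: below a threshold \<open>T / 2\<close> the cutoff is so flat that \<open>q\<close> absorbs
  it, beyond it Young's inequality trades it for weighted volume. The outer radius tends to infinity
  before \<open>T\<close> does. The parameter \<tau> is free so that it can be chosen point by point
  as the ratio of the derivative of the cutoff to the cutoff.\<close>

definition pderiv_at :: "'m \<Rightarrow> (real^'m \<Rightarrow> 'b::real_normed_vector) \<Rightarrow> real^'m \<Rightarrow> 'b"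
  where "pderiv_at i f x = frechet_derivative f (at x) (axis i 1)"

lemma smooth_map_differentiable: "smooth_map f \<Longrightarrow> f differentiable (at x)"
  unfolding smooth_map_def by (metis C_times.simps(2))

lemma C_times_continuous_on:
  "C_times k f \<Longrightarrow> continuous_on UNIV f"
  by (cases k) (auto intro!: continuous_at_imp_continuous_on differentiable_imp_continuous_within)

lemma smooth_map_continuous_on: "smooth_map f \<Longrightarrow> continuous_on S f"
  unfolding smooth_map_def using C_times_continuous_on continuous_on_subset by blast

lemma smooth_map_pderiv_at:
  fixes f :: "real^'m \<Rightarrow> 'b::real_normed_vector"
  assumes "smooth_map f" shows "smooth_map (pderiv_at i f)"
proof -
  have "pderiv_at i f = (\<lambda>x. frechet_derivative f (at x) (axis i 1))"
    by (simp add: pderiv_at_def fun_eq_iff)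
  moreover have "axis i (1::real) \<in> Basis" by simp
  ultimately show ?thesis
    using assms unfolding smooth_map_def by (metis C_times.simps(2))
qed

lemma C_times_Suc_pderiv_at:
  fixes f :: "real^'m \<Rightarrow> 'b::real_normed_vector"
  shows "C_times (Suc k) f \<longleftrightarrow> (\<forall>x. f differentiable (at x)) \<and> (\<forall>i. C_times k (pderiv_at i f))"
proof -
  have eq: "pderiv_at i f = (\<lambda>x. frechet_derivative f (at x) (axis i 1))" for i
    by (simp add: pderiv_at_def fun_eq_iff)
  show ?thesis
    unfolding C_times.simps eq Basis_vec_def by auto
qed

lemma pderiv_at_eqI: "(f has_derivative f') (at x) \<Longrightarrow> pderiv_at i f x = f' (axis i 1)"
  unfolding pderiv_at_def by (metis frechet_derivative_at)

lemma has_derivative_pderiv_at: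
  fixes f :: "real^'m \<Rightarrow> 'b::real_normed_vector"
  assumes "f differentiable (at x)"
  shows "(f has_derivative (\<lambda>v. \<Sum>i\<in>UNIV. v $ i *\<^sub>R pderiv_at i f x)) (at x)"
proof -
  let ?D = "frechet_derivative f (at x)"
  have d: "(f has_derivative ?D) (at x)" using assms frechet_derivative_works by blast
  have lin: "linear ?D" using d has_derivative_linear by blast
  have "?D v = (\<Sum>i\<in>UNIV. v $ i *\<^sub>R pderiv_at i f x)" for v
  proof -
    have "v = (\<Sum>i\<in>UNIV. v $ i *\<^sub>R axis i (1::real))"
      by (simp add: basis_expansion flip: scalar_mult_eq_scaleR)
    then have "?D v = ?D (\<Sum>i\<in>UNIV. v $ i *\<^sub>R axis i 1)" by simp
    also have "\<dots> = (\<Sum>i\<in>UNIV. v $ i *\<^sub>R ?D (axis i 1))"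
      using lin by (simp add: linear_sum linear_cmul)
    finally show ?thesis by (simp add: pderiv_at_def)
  qed
  then have "?D = (\<lambda>v. \<Sum>i\<in>UNIV. v $ i *\<^sub>R pderiv_at i f x)" by blast
  then show ?thesis using d by simp
qed

lemma pderiv_at_const [simp]: "pderiv_at i (\<lambda>x. c) = (\<lambda>x. 0)"
  by (simp add: pderiv_at_def fun_eq_iff)

lemma pderiv_at_coord: "pderiv_at i (\<lambda>x. x $ k) = (\<lambda>x. if i = k then 1 else 0)"
proof
  fix x :: "real^'a"
  have "((\<lambda>x::real^'a. x $ k) has_derivative (\<lambda>v. v $ k)) (at x)"
    by (rule bounded_linear.has_derivative[OF bounded_linear_vec_nth has_derivative_ident])
  from pderiv_at_eqI[OF this, of i]
  show "pderiv_at i (\<lambda>x. x $ k) x = (if i = k then 1 else 0)"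
    by (auto simp: axis_def)
qed

lemma pderiv_at_add:
  assumes "f differentiable (at x)" "g differentiable (at x)"
  shows "pderiv_at i (\<lambda>x. f x + g x) x = pderiv_at i f x + pderiv_at i g x"
  using pderiv_at_eqI[OF has_derivative_add[OF assms(1)[unfolded frechet_derivative_works] assms(2)[unfolded frechet_derivative_works]], of i]
  by (simp add: pderiv_at_def)

lemma pderiv_at_diff:
  assumes "f differentiable (at x)" "g differentiable (at x)"
  shows "pderiv_at i (\<lambda>x. f x - g x) x = pderiv_at i f x - pderiv_at i g x"
  using pderiv_at_eqI[OF has_derivative_diff[OF assms(1)[unfolded frechet_derivative_works] assms(2)[unfolded frechet_derivative_works]], of i]
  by (simp add: pderiv_at_def)

lemma pderiv_at_sum:
  assumes "\<And>k. k \<in> I \<Longrightarrow> f k differentiable (at x)"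
  shows "pderiv_at i (\<lambda>x. \<Sum>k\<in>I. f k x) x = (\<Sum>k\<in>I. pderiv_at i (f k) x)"
proof -
  have "((\<lambda>x. \<Sum>k\<in>I. f k x) has_derivative (\<lambda>v. \<Sum>k\<in>I. frechet_derivative (f k) (at x) v)) (at x)"
    using assms by (intro has_derivative_sum) (auto simp: frechet_derivative_works[symmetric])
  then show ?thesis by (simp add: pderiv_at_eqI) (simp add: pderiv_at_def)
qed

lemma pderiv_at_bilinear:
  assumes "bounded_bilinear prd" "f differentiable (at x)" "g differentiable (at x)"
  shows "pderiv_at i (\<lambda>x. prd (f x) (g x)) x = prd (f x) (pderiv_at i g x) + prd (pderiv_at i f x) (g x)"
proof -
  have "((\<lambda>x. prd (f x) (g x)) has_derivative
      (\<lambda>h. prd (f x) (frechet_derivative g (at x) h) + prd (frechet_derivative f (at x) h) (g x))) (at x)"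
    using assms by (intro bounded_bilinear.FDERIV) (auto simp: frechet_derivative_works[symmetric])
  then show ?thesis by (simp add: pderiv_at_eqI) (simp add: pderiv_at_def)
qed

lemmas pderiv_at_mult = pderiv_at_bilinear[OF bounded_bilinear_mult]
lemmas pderiv_at_scaleR = pderiv_at_bilinear[OF bounded_bilinear_scaleR]
lemmas pderiv_at_inner = pderiv_at_bilinear[OF bounded_bilinear_inner]

lemma pderiv_at_compose_real:
  fixes h :: "real \<Rightarrow> real"
  assumes "f differentiable (at x)" "(h has_real_derivative h') (at (f x))"
  shows "pderiv_at i (\<lambda>x. h (f x)) x = h' * pderiv_at i f x"
    and "(\<lambda>x. h (f x)) differentiable (at x)"
proof -
  have f: "(f has_derivative frechet_derivative f (at x)) (at x)"
    using assms frechet_derivative_works by blast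
  have h: "(h has_derivative (*) h') (at (f x))"
    using assms(2) by (simp add: has_field_derivative_def)
  have "((\<lambda>x. h (f x)) has_derivative (\<lambda>v. h' * frechet_derivative f (at x) v)) (at x)"
    using has_derivative_compose[OF f h] .
  from pderiv_at_eqI[OF this, of i] this
  show "pderiv_at i (\<lambda>x. h (f x)) x = h' * pderiv_at i f x"
    and "(\<lambda>x. h (f x)) differentiable (at x)"
    by (auto simp: differentiable_def pderiv_at_def)
qed

section \<open>Closure of smooth maps under algebra and elementary functions\<close>

lemma C_times_Suc_imp:
  fixes f :: "real^'m \<Rightarrow> 'b::real_normed_vector"
  shows "C_times (Suc k) f \<Longrightarrow> C_times k f"
proof (induction k arbitrary: f)
  case 0 then show ?case using C_times_continuous_on C_times.simps(1) by blast
next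
  case (Suc k)
  then show ?case by (subst C_times_Suc_pderiv_at) (metis C_times_Suc_pderiv_at)
qed

lemma C_times_const: "C_times k (\<lambda>x::real^'m. c)"
  by (induction k arbitrary: c) (auto simp: C_times_Suc_pderiv_at simp del: C_times.simps(2))

lemma C_times_add:
  fixes f g :: "real^'m \<Rightarrow> 'b::real_normed_vector"
  shows "C_times k f \<Longrightarrow> C_times k g \<Longrightarrow> C_times k (\<lambda>x. f x + g x)"
proof (induction k arbitrary: f g)
  case 0 then show ?case by (auto intro: continuous_on_add)
next
  case (Suc k)
  then have d: "\<And>x. f differentiable (at x)" "\<And>x. g differentiable (at x)" by auto
  have "pderiv_at i (\<lambda>x. f x + g x) = (\<lambda>x. pderiv_at i f x + pderiv_at i g x)" for i
    using pderiv_at_add d by blast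
  then show ?case using Suc d
    by (simp add: C_times_Suc_pderiv_at del: C_times.simps(2))
qed

text \<open>In the product rule one factor stays undifferentiated and is used at one order less, by
  \<open>C_times_Suc_imp\<close>. An arbitrary bounded bilinear product covers multiplication,
  scaling and inner products at once.\<close>

lemma C_times_bilinear:
  fixes f :: "real^'m \<Rightarrow> 'b::real_normed_vector" and g :: "real^'m \<Rightarrow> 'c::real_normed_vector"
  assumes "bounded_bilinear prd"
  shows "C_times k f \<Longrightarrow> C_times k g \<Longrightarrow> C_times k (\<lambda>x. prd (f x) (g x))"
proof (induction k arbitrary: f g)
  case 0 then show ?case using bounded_bilinear.continuous_on[OF assms] by auto
next
  case (Suc k)
  then have d: "\<And>x. f differentiable (at x)" "\<And>x. g differentiable (at x)" by auto
  have dp: "(\<lambda>x. prd (f x) (g x)) differentiable (at x)" for x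
    using bounded_bilinear.FDERIV[OF assms] d unfolding differentiable_def by blast
  have e: "pderiv_at i (\<lambda>x. prd (f x) (g x)) =
      (\<lambda>x. prd (f x) (pderiv_at i g x) + prd (pderiv_at i f x) (g x))" for i
    using pderiv_at_bilinear[OF assms] d by blast
  have "C_times k (\<lambda>x. prd (f x) (pderiv_at i g x) + prd (pderiv_at i f x) (g x))" for i
    using Suc.prems C_times_Suc_imp[OF Suc.prems(1)] C_times_Suc_imp[OF Suc.prems(2)]
    by (intro C_times_add Suc.IH) (auto simp: C_times_Suc_pderiv_at simp del: C_times.simps(2))
  then show ?case using dp by (simp add: C_times_Suc_pderiv_at e del: C_times.simps(2))
qed

lemma smooth_map_const : "smooth_map (\<lambda>x::real^'m. c)"
  by (simp add: smooth_map_def C_times_const)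

lemma smooth_map_add:
  fixes f g :: "real^'m \<Rightarrow> 'b::real_normed_vector"
  shows "smooth_map f \<Longrightarrow> smooth_map g \<Longrightarrow> smooth_map (\<lambda>x. f x + g x)"
  by (simp add: smooth_map_def C_times_add)

lemma smooth_map_bilinear:
  fixes f :: "real^'m \<Rightarrow> 'b::real_normed_vector" and g :: "real^'m \<Rightarrow> 'c::real_normed_vector"
  assumes "bounded_bilinear prd" "smooth_map f" "smooth_map g"
  shows "smooth_map (\<lambda>x. prd (f x) (g x))"
  using assms by (simp add: smooth_map_def C_times_bilinear)

lemmas smooth_map_mult = smooth_map_bilinear[OF bounded_bilinear_mult]
lemmas smooth_map_scaleR = smooth_map_bilinear[OF bounded_bilinear_scaleR]
lemmas smooth_map_inner = smooth_map_bilinear[OF bounded_bilinear_inner]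

lemma smooth_map_minus:
  fixes f :: "real^'m \<Rightarrow> 'b::real_normed_vector"
  assumes "smooth_map f" shows "smooth_map (\<lambda>x. - f x)"
  using smooth_map_scaleR[OF smooth_map_const assms, of "-1"] by simp

lemma smooth_map_diff:
  fixes f g :: "real^'m \<Rightarrow> 'b::real_normed_vector"
  assumes "smooth_map f" "smooth_map g" shows "smooth_map (\<lambda>x. f x - g x)"
  using smooth_map_add[OF assms(1) smooth_map_minus[OF assms(2)]] by simp

lemma smooth_map_sum:
  fixes f :: "'i \<Rightarrow> real^'m \<Rightarrow> 'b::real_normed_vector"
  shows "(\<And>k. k \<in> I \<Longrightarrow> smooth_map (f k)) \<Longrightarrow> smooth_map (\<lambda>x. \<Sum>k\<in>I. f k x)"
  by (induction I rule: infinite_finite_induct) (simp_all add: smooth_map_const smooth_map_add)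

lemma smooth_map_prod:
  fixes f :: "'i \<Rightarrow> real^'m \<Rightarrow> real"
  shows "(\<And>k. k \<in> I \<Longrightarrow> smooth_map (f k)) \<Longrightarrow> smooth_map (\<lambda>x. \<Prod>k\<in>I. f k x)"
  by (induction I rule: infinite_finite_induct) (simp_all add: smooth_map_const smooth_map_mult)

lemma smooth_map_coord: "smooth_map (\<lambda>x::real^'m. x $ k)"
proof -
  have "C_times j (\<lambda>x::real^'m. x $ k)" for j
  proof (cases j)
    case 0 then show ?thesis by (auto intro!: continuous_intros)
  next
    case (Suc j')
    have "(\<lambda>x::real^'m. x $ k) differentiable (at x)" for x
      using bounded_linear.has_derivative[OF bounded_linear_vec_nth has_derivative_ident] unfolding differentiable_def by blast
    then show ?thesis
      by (simp add: Suc C_times_Suc_pderiv_at pderiv_at_coord C_times_const del: C_times.simps(2))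
  qed
  then show ?thesis by (simp add: smooth_map_def)
qed

lemma smooth_map_ident: "smooth_map (\<lambda>x::real^'m. x)"
proof -
  have "smooth_map (\<lambda>x::real^'m. \<Sum>i\<in>UNIV. x $ i *\<^sub>R axis i (1::real))"
    by (intro smooth_map_sum smooth_map_scaleR smooth_map_coord smooth_map_const)
  moreover have "(\<lambda>x::real^'m. \<Sum>i\<in>UNIV. x $ i *\<^sub>R axis i (1::real)) = (\<lambda>x. x)"
    by (simp add: basis_expansion flip: scalar_mult_eq_scaleR)
  ultimately show ?thesis by simp
qed

lemma smooth_map_det:
  fixes f :: "real^'m \<Rightarrow> real^'k^'k"
  assumes "\<And>i j. smooth_map (\<lambda>x. f x $ i $ j)"
  shows "smooth_map (\<lambda>x. det (f x))"
  unfolding det_def using assms by (intro smooth_map_sum smooth_map_mult smooth_map_prod smooth_map_const)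

lemma smooth_map_exp:
  fixes f :: "real^'m \<Rightarrow> real"
  assumes "smooth_map f" shows "smooth_map (\<lambda>x. exp (f x))"
proof -
  have d: "f differentiable (at x)" for x using assms smooth_map_differentiable by blast
  have e: "pderiv_at i (\<lambda>x. exp (f x)) = (\<lambda>x. exp (f x) * pderiv_at i f x)"
    "(\<lambda>x. exp (f x)) differentiable (at x)" for i x
    using pderiv_at_compose_real[OF d DERIV_exp] by auto
  have "C_times k (\<lambda>x. exp (f x))" for k
  proof (induction k)
    case 0 then show ?case using smooth_map_continuous_on[OF assms] by (auto intro: continuous_on_exp)
  next
    case (Suc k)
    have "C_times k (pderiv_at i f)" for i
      using smooth_map_pderiv_at[OF assms] by (simp add: smooth_map_def)
    then show ?case using Suc
      by (auto simp: C_times_Suc_pderiv_at e simp del: C_times.simps(2)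
        intro!: C_times_bilinear[OF bounded_bilinear_mult])
  qed
  then show ?thesis by (simp add: smooth_map_def)
qed

lemma smooth_map_inverse:
  fixes f :: "real^'m \<Rightarrow> real"
  assumes "smooth_map f" "\<And>x. f x \<noteq> 0" shows "smooth_map (\<lambda>x. inverse (f x))"
proof -
  have d: "f differentiable (at x)" for x using assms smooth_map_differentiable by blast
  have e: "pderiv_at i (\<lambda>x. inverse (f x)) = (\<lambda>x. - (inverse (f x) * inverse (f x)) * pderiv_at i f x)"
    "(\<lambda>x. inverse (f x)) differentiable (at x)" for i x
    using pderiv_at_compose_real[OF d DERIV_inverse[OF assms(2)]]
    by (auto simp: power2_eq_square)
  have "C_times k (\<lambda>x. inverse (f x))" for k
  proof (induction k)
    case 0 then show ?case using smooth_map_continuous_on[OF assms(1)] assms(2)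
      by (auto intro: continuous_on_inverse)
  next
    case (Suc k)
    have "C_times k (pderiv_at i f)" for i
      using smooth_map_pderiv_at[OF assms(1)] by (simp add: smooth_map_def)
    then have "C_times k (\<lambda>x. (- 1) * ((inverse (f x) * inverse (f x)) * pderiv_at i f x))" for i
      using Suc by (intro C_times_bilinear[OF bounded_bilinear_mult] C_times_const)
    then show ?case
      by (simp add: C_times_Suc_pderiv_at e algebra_simps del: C_times.simps(2))
  qed
  then show ?thesis by (simp add: smooth_map_def)
qed

lemma smooth_map_sqrt:
  fixes f :: "real^'m \<Rightarrow> real"
  assumes "smooth_map f" "\<And>x. f x > 0" shows "smooth_map (\<lambda>x. sqrt (f x))"
proof -
  have d: "f differentiable (at x)" for x using assms smooth_map_differentiable by blast
  \<comment> \<open>The derivative is written as a product in which \<open>sqrt (f x)\<close> occurs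
    as a factor next to \<open>inverse (f x)\<close>, which is already smooth; the induction
    hypothesis then applies to \<open>sqrt\<close> itself.\<close>
  have e: "pderiv_at i (\<lambda>x. sqrt (f x)) = (\<lambda>x. inverse (f x) * (sqrt (f x) * ((1/2) * pderiv_at i f x)))"
    "(\<lambda>x. sqrt (f x)) differentiable (at x)" for i x
  proof -
    have s: "inverse (sqrt (f x)) = inverse (f x) * sqrt (f x)" for x
      using assms(2)[of x] by (simp add: field_simps)
    show "pderiv_at i (\<lambda>x. sqrt (f x)) = (\<lambda>x. inverse (f x) * (sqrt (f x) * ((1/2) * pderiv_at i f x)))"
      using pderiv_at_compose_real(1)[OF d DERIV_real_sqrt[OF assms(2)]]
      by (auto simp: s)
    show "(\<lambda>x. sqrt (f x)) differentiable (at x)"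
      using pderiv_at_compose_real(2)[OF d DERIV_real_sqrt[OF assms(2)]] .
  qed
  have inv: "C_times k (\<lambda>x. inverse (f x))" for k
    using smooth_map_inverse[OF assms(1)] assms(2) by (simp add: less_imp_neq[THEN not_sym] smooth_map_def)
  have "C_times k (\<lambda>x. sqrt (f x))" for k
  proof (induction k)
    case 0 then show ?case using smooth_map_continuous_on[OF assms(1)]
      by (auto intro: continuous_on_real_sqrt)
  next
    case (Suc k)
    have "C_times k (pderiv_at i f)" for i
      using smooth_map_pderiv_at[OF assms(1)] by (simp add: smooth_map_def)
    then have "C_times k (\<lambda>x. inverse (f x) * (sqrt (f x) * ((1/2) * pderiv_at i f x)))" for i
      using Suc inv by (intro C_times_bilinear[OF bounded_bilinear_mult] C_times_const)
    then show ?case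
      using e(2) by (simp only: C_times_Suc_pderiv_at e(1)) simp
  qed
  then show ?thesis by (simp add: smooth_map_def)
qed

section \<open>Equality of mixed partial derivatives\<close>

lemma has_real_derivative_along_axis:
  fixes f :: "real^'m \<Rightarrow> real"
  assumes "\<And>x. f differentiable (at x)"
  shows "((\<lambda>s. f (p + s *\<^sub>R axis i 1)) has_real_derivative pderiv_at i f (p + s *\<^sub>R axis i 1)) (at s)"
proof -
  have l: "((\<lambda>s. p + s *\<^sub>R axis i 1) has_derivative (\<lambda>h. h *\<^sub>R axis i (1::real))) (at s)"
    by (auto intro!: derivative_eq_intros)
  have "((\<lambda>s. f (p + s *\<^sub>R axis i 1)) has_derivative
      (\<lambda>h. frechet_derivative f (at (p + s *\<^sub>R axis i 1)) (h *\<^sub>R axis i 1))) (at s)"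
    using has_derivative_compose[OF l] assms frechet_derivative_works by blast
  moreover have "frechet_derivative f (at (p + s *\<^sub>R axis i 1)) (h *\<^sub>R axis i 1)
      = pderiv_at i f (p + s *\<^sub>R axis i 1) * h" for h
    using linear_frechet_derivative[OF assms] by (simp add: linear_cmul pderiv_at_def)
  ultimately show ?thesis by (simp add: has_field_derivative_def)
qed

text \<open>The mean value theorem is used once in each direction. The left-hand side of the
  equation is symmetric in \<open>i\<close> and \<open>j\<close>, so comparing the two orders of
  application forces the mixed derivatives to agree in the limit.\<close>

lemma second_difference_mvt:
  fixes f :: "real^'m \<Rightarrow> real"
  assumes f: "\<And>x. f differentiable (at x)" and fi: "\<And>x. pderiv_at i f differentiable (at x)" and "h > 0"
  obtains s t where "0 < s" "s < h" "0 < t" "t < h"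
    "f (x + h *\<^sub>R axis i 1 + h *\<^sub>R axis j 1) - f (x + h *\<^sub>R axis i 1) - f (x + h *\<^sub>R axis j 1) + f x
      = h * h * pderiv_at j (pderiv_at i f) (x + s *\<^sub>R axis i 1 + t *\<^sub>R axis j 1)"
proof -
  let ?a = "axis i (1::real)" and ?b = "axis j (1::real)"
  let ?g = "\<lambda>s. f (x + h *\<^sub>R ?b + s *\<^sub>R ?a) - f (x + s *\<^sub>R ?a)"
  have "DERIV ?g s :> pderiv_at i f (x + h *\<^sub>R ?b + s *\<^sub>R ?a) - pderiv_at i f (x + s *\<^sub>R ?a)" for s
    by (intro DERIV_diff has_real_derivative_along_axis f)
  from MVT2[OF \<open>h > 0\<close>, of ?g, OF this] obtain s where s: "0 < s" "s < h"
    and g: "?g h - ?g 0 = h * (pderiv_at i f (x + h *\<^sub>R ?b + s *\<^sub>R ?a) - pderiv_at i f (x + s *\<^sub>R ?a))"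
    by auto
  have "DERIV (\<lambda>t. pderiv_at i f (x + s *\<^sub>R ?a + t *\<^sub>R ?b)) t :>
      pderiv_at j (pderiv_at i f) (x + s *\<^sub>R ?a + t *\<^sub>R ?b)" for t
    by (intro has_real_derivative_along_axis fi)
  from MVT2[OF \<open>h > 0\<close>, of "\<lambda>t. pderiv_at i f (x + s *\<^sub>R ?a + t *\<^sub>R ?b)", OF this]
  obtain t where t: "0 < t" "t < h"
    and g': "pderiv_at i f (x + s *\<^sub>R ?a + h *\<^sub>R ?b) - pderiv_at i f (x + s *\<^sub>R ?a)
      = h * pderiv_at j (pderiv_at i f) (x + s *\<^sub>R ?a + t *\<^sub>R ?b)"
    by auto
  show thesis
  proof (rule that[OF s t])
    show "f (x + h *\<^sub>R ?a + h *\<^sub>R ?b) - f (x + h *\<^sub>R ?a) - f (x + h *\<^sub>R ?b) + f x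
      = h * h * pderiv_at j (pderiv_at i f) (x + s *\<^sub>R ?a + t *\<^sub>R ?b)"
      using g g' by (simp add: algebra_simps)
  qed
qed

lemma pderiv_at_commute_real:
  fixes f :: "real^'m \<Rightarrow> real"
  assumes "smooth_map f"
  shows "pderiv_at i (pderiv_at j f) x = pderiv_at j (pderiv_at i f) x"
proof (rule ccontr)
  let ?F = "pderiv_at i (pderiv_at j f)" and ?G = "pderiv_at j (pderiv_at i f)"
  assume "?F x \<noteq> ?G x"
  define e where "e = \<bar>?F x - ?G x\<bar> / 2"
  have "e > 0" using \<open>?F x \<noteq> ?G x\<close> by (simp add: e_def)
  have sm: "smooth_map ?F" "smooth_map ?G"
    by (rule smooth_map_pderiv_at[OF smooth_map_pderiv_at[OF assms]])+
  have "isCont ?F x" "isCont ?G x"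
    by (rule differentiable_imp_continuous_within, rule smooth_map_differentiable, rule sm)+
  then obtain d1 d2 where d: "d1 > 0" "\<And>y. dist y x < d1 \<Longrightarrow> dist (?F y) (?F x) < e"
    "d2 > 0" "\<And>y. dist y x < d2 \<Longrightarrow> dist (?G y) (?G x) < e"
    using \<open>e > 0\<close> unfolding continuous_at_eps_delta by metis
  \<comment> \<open>Each of the two offsets is shorter than \<open>h\<close>, so their sum stays
    within both radii of continuity.\<close>
  define h where "h = min d1 d2 / 2"
  have "h > 0" using d by (simp add: h_def)
  have near: "dist (x + s *\<^sub>R axis k 1 + t *\<^sub>R axis l 1) x < d1"
    "dist (x + s *\<^sub>R axis k 1 + t *\<^sub>R axis l 1) x < d2"
    if "0 < s" "s < h" "0 < t" "t < h" for s t k l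
  proof -
    have "dist (x + s *\<^sub>R axis k 1 + t *\<^sub>R axis l 1) x = norm (s *\<^sub>R axis k (1::real) + t *\<^sub>R axis l 1)"
      by (simp add: dist_norm algebra_simps)
    also have "\<dots> \<le> norm (s *\<^sub>R axis k (1::real) :: real^'m) + norm (t *\<^sub>R axis l (1::real) :: real^'m)"
      by (rule norm_triangle_ineq)
    also have "\<dots> < 2 * h" using that by (simp add: norm_axis_1)
    finally show "dist (x + s *\<^sub>R axis k 1 + t *\<^sub>R axis l 1) x < d1"
      "dist (x + s *\<^sub>R axis k 1 + t *\<^sub>R axis l 1) x < d2"
      by (auto simp: h_def min_def split: if_splits)
  qed
  have diff: "f differentiable (at y)" "pderiv_at k f differentiable (at y)" for y k
    using smooth_map_differentiable[OF assms]
      smooth_map_differentiable[OF smooth_map_pderiv_at[OF assms]] by auto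
  obtain s t where st: "0 < s" "s < h" "0 < t" "t < h"
    "f (x + h *\<^sub>R axis i 1 + h *\<^sub>R axis j 1) - f (x + h *\<^sub>R axis i 1) - f (x + h *\<^sub>R axis j 1) + f x
      = h * h * ?G (x + s *\<^sub>R axis i 1 + t *\<^sub>R axis j 1)"
    by (rule second_difference_mvt[OF diff(1) diff(2) \<open>h > 0\<close>])
  obtain s' t' where st': "0 < s'" "s' < h" "0 < t'" "t' < h"
    "f (x + h *\<^sub>R axis j 1 + h *\<^sub>R axis i 1) - f (x + h *\<^sub>R axis j 1) - f (x + h *\<^sub>R axis i 1) + f x
      = h * h * ?F (x + s' *\<^sub>R axis j 1 + t' *\<^sub>R axis i 1)"
    by (rule second_difference_mvt[OF diff(1) diff(2) \<open>h > 0\<close>])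
  have "h * h * ?G (x + s *\<^sub>R axis i 1 + t *\<^sub>R axis j 1) = h * h * ?F (x + s' *\<^sub>R axis j 1 + t' *\<^sub>R axis i 1)"
    unfolding st(5)[symmetric] st'(5)[symmetric] by (simp add: algebra_simps)
  then have eq: "?G (x + s *\<^sub>R axis i 1 + t *\<^sub>R axis j 1) = ?F (x + s' *\<^sub>R axis j 1 + t' *\<^sub>R axis i 1)"
    using \<open>h > 0\<close> by simp
  have "dist (?G (x + s *\<^sub>R axis i 1 + t *\<^sub>R axis j 1)) (?G x) < e"
    using d(4) near(2)[OF st(1-4)] by blast
  moreover have "dist (?F (x + s' *\<^sub>R axis j 1 + t' *\<^sub>R axis i 1)) (?F x) < e"
    using d(2) near(1)[OF st'(1-4)] by blast
  ultimately show False unfolding eq e_def dist_real_def by (simp add: abs_if split: if_splits)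
qed

lemma smooth_map_inner_const:
  fixes f :: "real^'m \<Rightarrow> 'b::real_inner"
  shows "smooth_map f \<Longrightarrow> smooth_map (\<lambda>x. f x \<bullet> c)"
  by (intro smooth_map_inner smooth_map_const)

lemma pderiv_at_inner_const:
  fixes f :: "real^'m \<Rightarrow> 'b::real_inner"
  assumes "f differentiable (at x)"
  shows "pderiv_at i (\<lambda>x. f x \<bullet> c) x = pderiv_at i f x \<bullet> c"
  using pderiv_at_inner[OF assms differentiable_const, of i c] by simp

lemma pderiv_at_commute:
  fixes f :: "real^'m \<Rightarrow> 'b::real_inner"
  assumes "smooth_map f"
  shows "pderiv_at i (pderiv_at j f) x = pderiv_at j (pderiv_at i f) x"
proof -
  have d: "f differentiable (at x)" "pderiv_at k f differentiable (at x)" for x k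
    using smooth_map_differentiable[OF assms]
      smooth_map_differentiable[OF smooth_map_pderiv_at[OF assms]] by auto
  have e: "pderiv_at k (\<lambda>x. f x \<bullet> c) = (\<lambda>x. pderiv_at k f x \<bullet> c)" for k c
    using pderiv_at_inner_const d by blast
  have "pderiv_at i (pderiv_at j f) x \<bullet> c = pderiv_at j (pderiv_at i f) x \<bullet> c" for c
    using pderiv_at_commute_real[OF smooth_map_inner_const[OF assms, of c], of i j x]
    by (simp add: e pderiv_at_inner_const d)
  then show ?thesis by (metis vector_eq_rdot)
qed

text \<open>Jacobi's formula. The product rule in the Leibniz expansion yields one determinant for
  each row, with that row differentiated. As \<open>B\<close> inverts \<open>M x\<close>, the
  differentiated row is a combination of the rows of \<open>M x\<close>, and only its coefficient at
  the replaced row survives in the determinant.\<close>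

lemma pderiv_at_det:
  fixes M :: "real^'m \<Rightarrow> real^'k^'k"
  assumes d: "\<And>i j. (\<lambda>x. M x $ i $ j) differentiable (at x)" and B: "B ** M x = mat 1"
  shows "pderiv_at l (\<lambda>x. det (M x)) x =
    det (M x) * (\<Sum>i\<in>UNIV. \<Sum>j\<in>UNIV. pderiv_at l (\<lambda>x. M x $ i $ j) x * B $ j $ i)"
proof -
  let ?P = "{p. p permutes (UNIV :: 'k set)}"
  let ?d = "\<lambda>i j. frechet_derivative (\<lambda>x. M x $ i $ j) (at x)"
  let ?D = "\<lambda>i j. pderiv_at l (\<lambda>x. M x $ i $ j) x"
  have "((\<lambda>x. det (M x)) has_derivative (\<lambda>v. \<Sum>p\<in>?P. of_int (sign p) *
      (\<Sum>i\<in>UNIV. ?d i (p i) v * (\<Prod>j\<in>UNIV - {i}. M x $ j $ p j)))) (at x)"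
    unfolding det_def
    by (intro has_derivative_sum has_derivative_mult_right has_derivative_prod)
      (use d in \<open>simp add: frechet_derivative_works[symmetric]\<close>)
  then have "pderiv_at l (\<lambda>x. det (M x)) x = (\<Sum>p\<in>?P. of_int (sign p) *
      (\<Sum>i\<in>UNIV. ?D i (p i) * (\<Prod>j\<in>UNIV - {i}. M x $ j $ p j)))"
    by (simp add: pderiv_at_eqI) (simp add: pderiv_at_def)
  also have "\<dots> = (\<Sum>i\<in>UNIV. \<Sum>p\<in>?P. of_int (sign p) * (?D i (p i) * (\<Prod>j\<in>UNIV - {i}. M x $ j $ p j)))"
    by (simp add: sum_distrib_left) (rule sum.swap)
  also have "\<dots> = (\<Sum>i\<in>UNIV. det (M x) * (\<Sum>j\<in>UNIV. ?D i j * B $ j $ i))"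
  proof (rule sum.cong[OF refl])
    fix i :: 'k
    define v where "v = (\<chi> k. \<Sum>j\<in>UNIV. ?D i j * B $ j $ k)"
    have row: "(\<Sum>k\<in>UNIV. v $ k *s row k (M x)) = (\<chi> j. ?D i j)"
    proof (simp add: vec_eq_iff, rule allI)
      fix j'
      have "(\<Sum>k\<in>UNIV. v $ k * row k (M x) $ j') = (\<Sum>k\<in>UNIV. \<Sum>j\<in>UNIV. ?D i j * B $ j $ k * M x $ k $ j')"
        by (simp add: v_def row_def sum_distrib_right)
      also have "\<dots> = (\<Sum>j\<in>UNIV. ?D i j * (\<Sum>k\<in>UNIV. B $ j $ k * M x $ k $ j'))"
        by (subst sum.swap) (simp add: sum_distrib_left mult.assoc)
      also have "\<dots> = (\<Sum>j\<in>UNIV. ?D i j * (B ** M x) $ j $ j')"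
        by (simp add: matrix_matrix_mult_def)
      also have "\<dots> = ?D i j'" by (simp add: B mat_def if_distrib cong: if_cong)
      finally show "(\<Sum>k\<in>UNIV. v $ k * row k (M x) $ j') = ?D i j'" .
    qed
    have pr: "(\<Prod>r\<in>UNIV. (\<chi> r. if r = i then (\<chi> j. ?D i j) else row r (M x)) $ r $ p r)
        = ?D i (p i) * (\<Prod>j\<in>UNIV - {i}. M x $ j $ p j)" for p
      by (subst prod.remove[of UNIV i]) (auto simp: row_def intro!: prod.cong)
    have "(\<Sum>p\<in>?P. of_int (sign p) * (?D i (p i) * (\<Prod>j\<in>UNIV - {i}. M x $ j $ p j)))
        = det (\<chi> r. if r = i then (\<chi> j. ?D i j) else row r (M x))"
      unfolding det_def by (simp only: pr)
    also have "\<dots> = v $ i * det (M x)"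
      using cramer_lemma_transpose[of i v "M x"] by (simp only: row)
    finally show "(\<Sum>p\<in>?P. of_int (sign p) * (?D i (p i) * (\<Prod>j\<in>UNIV - {i}. M x $ j $ p j)))
        = det (M x) * (\<Sum>j\<in>UNIV. ?D i j * B $ j $ i)"
      by (simp add: v_def mult.commute)
  qed
  finally show ?thesis by (simp add: sum_distrib_left)
qed

section \<open>The divergence theorem for compact support\<close>

lemma integrable_continuous_compact_support:
  fixes f :: "'a::euclidean_space \<Rightarrow> real"
  assumes "continuous_on UNIV f" "\<And>x. x \<notin> cball 0 r \<Longrightarrow> f x = 0"
  shows "integrable lborel f"
proof -
  have "integrable lborel (\<lambda>x. indicator (cball 0 r) x *\<^sub>R f x)"
    using assms(1) continuous_on_subset by (intro borel_integrable_compact) auto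
  moreover have "(\<lambda>x. indicator (cball 0 r) x *\<^sub>R f x) = f"
    using assms(2) by (auto simp: indicator_def fun_eq_iff)
  ultimately show ?thesis by simp
qed

text \<open>Lebesgue measure is translation invariant, so each difference quotient has integral
  zero. The mean value theorem bounds the quotients uniformly, and dominated convergence passes to
  the derivative.\<close>

lemma integral_pderiv_at_eq_0:
  fixes f :: "real^'m \<Rightarrow> real"
  assumes d: "\<And>x. f differentiable (at x)" and c: "continuous_on UNIV (pderiv_at i f)"
    and supp: "\<And>x. x \<notin> cball 0 r \<Longrightarrow> f x = 0"
  shows "integrable lborel (pderiv_at i f)" "(\<integral>x. pderiv_at i f x \<partial>lborel) = 0"
proof -
  let ?a = "axis i (1::real) :: real^'m"
  have supp': "pderiv_at i f x = 0" if "x \<notin> cball 0 r" for x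
  proof -
    have "((\<lambda>x. 0) has_derivative (\<lambda>_. 0)) (at x)" by simp
    then have "(f has_derivative (\<lambda>_. 0)) (at x)"
      by (rule has_derivative_transform_within_open[of _ _ _ _ "- cball 0 r"])
        (use that supp in auto)
    then show ?thesis by (simp add: pderiv_at_eqI)
  qed
  show int: "integrable lborel (pderiv_at i f)"
    using integrable_continuous_compact_support[OF c supp'] .
  have cf: "continuous_on UNIV f"
    by (intro continuous_at_imp_continuous_on ballI differentiable_imp_continuous_within d)
  have intf: "integrable lborel f"
    using integrable_continuous_compact_support[OF cf supp] .
  have shift: "integrable lborel (\<lambda>x. f (x + v))" "(\<integral>x. f (x + v) \<partial>lborel) = (\<integral>x. f x \<partial>lborel)" for v
  proof -
    have m: "f \<in> borel_measurable borel" using cf borel_measurable_continuous_onI by blast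
    have "integrable (distr lborel borel ((+) v)) f" using intf by (simp add: lborel_distr_plus)
    then show "integrable lborel (\<lambda>x. f (x + v))"
      by (subst (asm) integrable_distr_eq) (use m in \<open>auto simp: add.commute\<close>)
    have "(\<integral>x. f x \<partial>lborel) = (\<integral>x. f x \<partial>(distr lborel borel ((+) v)))" by (simp add: lborel_distr_plus)
    also have "\<dots> = (\<integral>x. f (v + x) \<partial>lborel)" using m by (intro integral_distr) auto
    finally show "(\<integral>x. f (x + v) \<partial>lborel) = (\<integral>x. f x \<partial>lborel)" by (simp add: add.commute)
  qed
  obtain C where C: "\<And>x. x \<in> cball 0 r \<Longrightarrow> norm (pderiv_at i f x) \<le> C" "C \<ge> 0"
  proof -
    have "bounded (pderiv_at i f ` cball 0 r)"
      by (intro compact_imp_bounded compact_continuous_image continuous_on_subset[OF c]) auto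
    then obtain C where "\<forall>y\<in>pderiv_at i f ` cball 0 r. norm y \<le> C" unfolding bounded_iff by blast
    then show thesis by (intro that[of "max C 0"]) (auto intro: max.coboundedI1)
  qed
  have Call: "\<bar>pderiv_at i f x\<bar> \<le> C" for x
    using C supp'[of x] by (cases "x \<in> cball 0 r") auto
  define s where "s n x = (f (x + inverse (real (Suc n)) *\<^sub>R ?a) - f x) * real (Suc n)" for n x
  have lim: "(\<lambda>n. s n x) \<longlonglongrightarrow> pderiv_at i f x" for x
  proof -
    have "DERIV (\<lambda>s. f (x + s *\<^sub>R ?a)) 0 :> pderiv_at i f (x + 0 *\<^sub>R ?a)"
      by (rule has_real_derivative_along_axis[OF d])
    then have "((\<lambda>h. (f (x + h *\<^sub>R ?a) - f x) / h) \<longlongrightarrow> pderiv_at i f x) (at 0)"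
      by (simp add: DERIV_def)
    moreover have "filterlim (\<lambda>n. inverse (real (Suc n))) (at 0) sequentially"
      using LIMSEQ_inverse_real_of_nat by (simp add: filterlim_at)
    ultimately have "(\<lambda>n. (f (x + inverse (real (Suc n)) *\<^sub>R ?a) - f x) / inverse (real (Suc n)))
        \<longlonglongrightarrow> pderiv_at i f x" by (rule filterlim_compose)
    then show ?thesis by (simp add: s_def divide_inverse)
  qed
  \<comment> \<open>A translation by \<open>inverse (real (Suc n))\<close> moves points by at most
    1, hence the ball larger by 1.\<close>
  have bnd: "norm (s n x) \<le> indicator (cball 0 (\<bar>r\<bar> + 1)) x * C" for n x
  proof (cases "x \<in> cball 0 (\<bar>r\<bar> + 1)")
    case True
    have pos: "0 < inverse (real (Suc n))" by simp
    have "DERIV (\<lambda>s. f (x + s *\<^sub>R ?a)) t :> pderiv_at i f (x + t *\<^sub>R ?a)" for t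
      by (rule has_real_derivative_along_axis[OF d])
    from MVT2[OF pos, of "\<lambda>s. f (x + s *\<^sub>R ?a)", OF this]
    obtain t where "f (x + inverse (real (Suc n)) *\<^sub>R ?a) - f (x + 0 *\<^sub>R ?a)
      = inverse (real (Suc n)) * pderiv_at i f (x + t *\<^sub>R ?a)" by auto
    then have "s n x = pderiv_at i f (x + t *\<^sub>R ?a)" by (simp add: s_def)
    then show ?thesis using Call True by simp
  next
    case False
    then have n: "norm x > \<bar>r\<bar> + 1" by simp
    have "norm (inverse (real (Suc n)) *\<^sub>R ?a) \<le> 1" by (simp add: norm_axis_1 field_simps)
    then have "norm (x + inverse (real (Suc n)) *\<^sub>R ?a) > \<bar>r\<bar>"
      using n norm_triangle_ineq2[of x "- (inverse (real (Suc n)) *\<^sub>R ?a)"] by simp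
    then have "f (x + inverse (real (Suc n)) *\<^sub>R ?a) = 0" "f x = 0"
      using n by (auto intro!: supp)
    then show ?thesis using False by (simp add: s_def)
  qed
  have "(\<lambda>n. \<integral>x. s n x \<partial>lborel) \<longlonglongrightarrow> (\<integral>x. pderiv_at i f x \<partial>lborel)"
  proof (rule integral_dominated_convergence[where w = "\<lambda>x. indicator (cball 0 (\<bar>r\<bar> + 1)) x * C"])
    show "s n \<in> borel_measurable lborel" for n
      unfolding s_def using shift(1) intf by auto
    show "integrable lborel (\<lambda>x. indicator (cball 0 (\<bar>r\<bar> + 1)) x * C)"
      using borel_integrable_compact[of "cball 0 (\<bar>r\<bar> + 1)" "\<lambda>_. C"] by simp
  qed (use int lim bnd in auto)
  moreover have "(\<integral>x. s n x \<partial>lborel) = 0" for n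
    unfolding s_def using shift intf by simp
  ultimately have "(\<lambda>n. 0) \<longlonglongrightarrow> (\<integral>x. pderiv_at i f x \<partial>lborel)" by simp
  then show "(\<integral>x. pderiv_at i f x \<partial>lborel) = 0"
    by (simp add: LIMSEQ_const_iff)
qed

text \<open>Gram-Schmidt for \<open>Q\<close>: fewer vectors than the dimension do not span the
  space, and a vector outside their span, minus its \<open>Q\<close>-projection, can be normalised
  by positivity.\<close>

lemma orthonormal_basis_of_positive_form:
  fixes Q :: "real^'m \<Rightarrow> real^'m \<Rightarrow> real"
  assumes bil: "bilinear Q" and sym: "\<And>v w. Q v w = Q w v" and pos: "\<And>v. v \<noteq> 0 \<Longrightarrow> Q v v > 0"
  shows "\<exists>e::'m \<Rightarrow> real^'m. \<forall>i j. Q (e i) (e j) = (if i = j then 1 else 0)"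
proof -
  have lin: "linear (\<lambda>v. Q v w)" "linear (Q w)" for w using bil by (auto simp: bilinear_def)
  have "\<exists>S. finite S \<and> card S = n \<and> (\<forall>v\<in>S. \<forall>w\<in>S. Q v w = (if v = w then 1 else 0))"
    if "n \<le> CARD('m)" for n
    using that
  proof (induction n)
    case 0 show ?case by (intro exI[of _ "{}"]) simp
  next
    case (Suc n)
    then obtain S where S: "finite S" "card S = n"
      and on: "\<And>v w. v \<in> S \<Longrightarrow> w \<in> S \<Longrightarrow> Q v w = (if v = w then 1 else 0)"
      by auto
    have "dim S \<le> card S" using S by (intro dim_le_card') auto
    then have "span S \<noteq> UNIV" using Suc.prems S dim_span[of S] by (metis DIM_cart DIM_real Suc_n_not_le_n dim_UNIV le_trans mult.right_neutral)
    then obtain v where v: "v \<notin> span S" by blast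
    define w where "w = v - (\<Sum>s\<in>S. Q v s *\<^sub>R s)"
    have "(\<Sum>s\<in>S. Q v s *\<^sub>R s) \<in> span S"
      by (intro span_sum span_scale span_base) auto
    then have "w \<noteq> 0" using v by (auto simp: w_def)
    have ws: "Q w s = 0" if "s \<in> S" for s
    proof -
      have "Q w s = Q v s - (\<Sum>s'\<in>S. Q v s' * Q s' s)"
        by (simp add: w_def linear_diff[OF lin(1)] linear_sum[OF lin(1)] linear_cmul[OF lin(1)])
      also have "(\<Sum>s'\<in>S. Q v s' * Q s' s) = (\<Sum>s'\<in>S. if s' = s then Q v s' else 0)"
        using on that by (intro sum.cong) auto
      also have "\<dots> = Q v s" using that S by simp
      finally show ?thesis by simp
    qed
    define e where "e = w /\<^sub>R sqrt (Q w w)"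
    have wpos: "Q w w > 0" using pos \<open>w \<noteq> 0\<close> by simp
    have es: "Q e s = 0" if "s \<in> S" for s
      using ws[OF that] by (simp add: e_def linear_cmul[OF lin(1)])
    have ee: "Q e e = 1"
      unfolding e_def using wpos
      by (simp add: linear_cmul[OF lin(1)] linear_cmul[OF lin(2)] flip: mult.assoc)
        (simp add: field_simps)
    have "e \<notin> S" using es ee by force
    then show ?case
      using S on es ee sym
      by (intro exI[of _ "insert e S"]) (auto simp: card_insert_if)
  qed
  then obtain S where S: "finite S" "card S = CARD('m)"
    "\<forall>v\<in>S. \<forall>w\<in>S. Q v w = (if v = w then 1 else 0)" by blast
  obtain e where e: "bij_betw e (UNIV :: 'm set) S"
    using finite_same_card_bij[of "UNIV :: 'm set" S] S by auto
  have "Q (e i) (e j) = (if i = j then 1 else 0)" for i j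
    using S(3) e by (auto simp: bij_betw_def inj_on_def)
  then show ?thesis by blast
qed

section \<open>A Bochner inequality at a point\<close>

lemma sum_mult_eq_trace:
  fixes P Q :: "real^'m^'m"
  shows "(\<Sum>i\<in>UNIV. \<Sum>j\<in>UNIV. P $ i $ j * Q $ i $ j) = trace (P ** transpose Q)"
  by (simp add: trace_def matrix_matrix_mult_def transpose_def)

lemma matrix_sub_ldistrib: "(P :: real^'m^'k) ** (Q - R) = P ** Q - P ** R"
  and matrix_sub_rdistrib: "(Q - R) ** (P :: real^'m^'k) = Q ** P - R ** P"
  by (simp_all add: matrix_matrix_mult_def vec_eq_iff algebra_simps sum_subtractf)

lemma matrix_add_rdistrib: "(Q + R) ** (P :: real^'m^'k) = Q ** P + R ** P"
  by (simp add: matrix_matrix_mult_def vec_eq_iff algebra_simps sum.distrib)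

lemma trace_scaleR: "trace (c *\<^sub>R (P :: real^'m^'m)) = c * trace P"
  by (simp add: trace_def sum_distrib_left)

lemma trace_transpose [simp]: "trace (transpose P) = trace (P :: real^'m^'m)"
  by (simp add: trace_def transpose_def)

lemma sum_kronecker_mult:
  fixes f :: "'m::finite \<Rightarrow> real"
  shows "(\<Sum>j\<in>UNIV. f j * (if j = k then 1 else 0)) = f k"
    "(\<Sum>j\<in>UNIV. (if j = k then 1 else 0) * f j) = f k"
    "(\<Sum>j\<in>UNIV. f j * (if k = j then 1 else 0)) = f k"
    "(\<Sum>j\<in>UNIV. (if k = j then 1 else 0) * f j) = f k"
  by (simp_all add: if_distrib if_distribR cong: if_cong)

text \<open>The Bochner computation at a single point is linear algebra, so derivatives enter as
  plain vectors: \<open>u k\<close> and \<open>U i j\<close> are the first and second derivatives of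
  the graph map, \<open>Y\<close> and \<open>W\<close> those of \<open>y\<close> and of
  \<open>w = S y\<close>, and \<open>A\<close> is the inverse metric. The assumption
  \<open>W\<close> is the differentiated relation \<open>S y = w\<close>; \<open>tr\<close> is the
  shrinker equation paired with \<open>y\<close>.\<close>

locale pointwise_frame =
  fixes u :: "'m::finite \<Rightarrow> 'v::real_inner" and U :: "'m \<Rightarrow> 'm \<Rightarrow> 'v"
    and y :: 'v and Y W :: "'m \<Rightarrow> 'v" and A E :: "real^'m^'m"
    and S :: "'v \<Rightarrow> 'v" and G b :: "real^'m^'m" and p :: "'m \<Rightarrow> real" and q :: real
  assumes S_def: "S v = v - (\<Sum>k\<in>UNIV. (u k \<bullet> v) *\<^sub>R u k)"
    and G_def: "G = (\<chi> i j. (if i = j then 1 else 0) - u i \<bullet> u j)"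
    and b_def: "b = (\<chi> i j. y \<bullet> U i j)"
    and p_def: "p k = y \<bullet> u k"
    and q_def: "q = y \<bullet> S y"
    and Usym: "U i j = U j i"
    and AG: "A ** G = mat 1"
    and AE: "A = E ** transpose E"
    and Spos: "v \<bullet> S v \<ge> 0"
    and W: "W a = S (Y a) - (\<Sum>j\<in>UNIV. p j *\<^sub>R U j a) - (\<Sum>j\<in>UNIV. b $ j $ a *\<^sub>R u j)"
    and tr: "trace (A ** b) = q / 2"
begin

lemma GA: "G ** A = mat 1"
  using AG matrix_left_right_inverse by blast

lemma sym: "transpose A = A" "transpose b = b" "transpose G = G"
  by (simp add: AE matrix_transpose_mul transpose_transpose)
    (auto simp: b_def G_def vec_eq_iff transpose_def Usym inner_commute)

lemma A_sym: "A $ i $ j = A $ j $ i" and b_sym: "b $ i $ j = b $ j $ i"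
  using sym(1,2) by (auto simp: transpose_def vec_eq_iff)

lemma S_lin: "S (v + w) = S v + S w" "S (v - w) = S v - S w" "S (c *\<^sub>R v) = c *\<^sub>R S v"
  "S (\<Sum>i\<in>I. f i) = (\<Sum>i\<in>I. S (f i))"
proof -
  show a: "S (v + w) = S v + S w" for v w
    by (simp add: S_def algebra_simps inner_add_right scaleR_add_left sum.distrib)
  show c: "S (c *\<^sub>R v) = c *\<^sub>R S v" for c v
    by (simp add: S_def algebra_simps scaleR_sum_right)
  show "S (v - w) = S v - S w"
    using a[of v "- 1 *\<^sub>R w"] c[of "-1" w] by simp
  show "S (\<Sum>i\<in>I. f i) = (\<Sum>i\<in>I. S (f i))"
    by (induction I rule: infinite_finite_induct) (use a c[of 0 0] in auto)
qed

lemma S_selfadj: "v \<bullet> S w = w \<bullet> S v"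
  by (simp add: S_def inner_diff_right inner_sum_right inner_commute mult.commute)

lemma S_u: "S (u k) = (\<Sum>c\<in>UNIV. G $ c $ k *\<^sub>R u c)"
proof -
  have "(\<Sum>c\<in>UNIV. G $ c $ k *\<^sub>R u c)
      = (\<Sum>c\<in>UNIV. (if c = k then u c else 0)) - (\<Sum>c\<in>UNIV. (u c \<bullet> u k) *\<^sub>R u c)"
    unfolding sum_subtractf[symmetric] G_def
    by (intro sum.cong) (auto simp: scaleR_left_diff_distrib)
  then show ?thesis by (simp add: S_def)
qed

text \<open>The inner product on one-forms with values in the normal bundle: \<open>A\<close>
  measures the covector part, and \<open>S\<close> is minus the normal metric when a normal vector
  is represented by its second component.\<close>

definition form :: "('m \<Rightarrow> 'v) \<Rightarrow> ('m \<Rightarrow> 'v) \<Rightarrow> real" where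
  "form \<xi> \<phi> = (\<Sum>i\<in>UNIV. \<Sum>j\<in>UNIV. A $ i $ j * (\<xi> i \<bullet> S (\<phi> j)))"

text \<open>In the frame given by the columns of \<open>E\<close> the form becomes a sum of values
  \<open>v \<bullet> S v\<close>.\<close>

lemma form_nonneg: "form \<xi> \<xi> \<ge> 0"
proof -
  have "form \<xi> \<xi> = (\<Sum>i\<in>UNIV. \<Sum>j\<in>UNIV. \<Sum>k\<in>UNIV. (E $ i $ k *\<^sub>R \<xi> i) \<bullet> S (E $ j $ k *\<^sub>R \<xi> j))"
  proof -
    have "A $ i $ j = (\<Sum>k\<in>UNIV. E $ i $ k * E $ j $ k)" for i j
      by (simp add: AE matrix_matrix_mult_def transpose_def)
    then show ?thesis
      by (simp add: form_def S_lin sum_distrib_left mult_ac)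
  qed
  also have "\<dots> = (\<Sum>i\<in>UNIV. \<Sum>k\<in>UNIV. \<Sum>j\<in>UNIV. (E $ i $ k *\<^sub>R \<xi> i) \<bullet> S (E $ j $ k *\<^sub>R \<xi> j))"
    by (rule sum.cong[OF refl]) (rule sum.swap)
  also have "\<dots> = (\<Sum>k\<in>UNIV. \<Sum>i\<in>UNIV. \<Sum>j\<in>UNIV. (E $ i $ k *\<^sub>R \<xi> i) \<bullet> S (E $ j $ k *\<^sub>R \<xi> j))"
    by (rule sum.swap)
  also have "\<dots> = (\<Sum>k\<in>UNIV. (\<Sum>i\<in>UNIV. E $ i $ k *\<^sub>R \<xi> i) \<bullet> S (\<Sum>j\<in>UNIV. E $ j $ k *\<^sub>R \<xi> j))"
    unfolding inner_sum_left unfolding S_lin(4) inner_sum_right ..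
  also have "\<dots> \<ge> 0" by (intro sum_nonneg Spos)
  finally show ?thesis .
qed

lemma form_sym: "form \<xi> \<phi> = form \<phi> \<xi>"
proof -
  have "A $ i $ j * (\<xi> i \<bullet> S (\<phi> j)) = A $ j $ i * (\<phi> j \<bullet> S (\<xi> i))" for i j
    using A_sym[of i j] S_selfadj[of "\<xi> i"] by simp
  then show ?thesis
    unfolding form_def by (subst sum.swap) simp
qed

lemma form_add: "form (\<lambda>i. \<xi> i + \<phi> i) \<psi> = form \<xi> \<psi> + form \<phi> \<psi>"
  by (simp add: form_def inner_add_left algebra_simps sum.distrib)

text \<open>\<open>\<eta> i\<close> represents the covariant derivative, in the normal bundle, of
  the normal field represented by \<open>y\<close>. Projecting the plain derivative to the normal
  bundle amounts to subtracting from \<open>Y i\<close> the solution \<open>\<theta> i\<close> of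
  the equation in \<open>S_theta\<close>.\<close>

definition \<theta> where "\<theta> i = (\<Sum>k\<in>UNIV. (A ** b) $ k $ i *\<^sub>R u k)"
definition \<eta> where "\<eta> i = Y i - \<theta> i"
definition Ym :: "real^'m^'m" where "Ym = (\<chi> i c. Y i \<bullet> u c)"
text \<open>In \<open>L q\<close> the derivatives of the inverse metric, summed with all their
  coefficients, assemble into this matrix. \<open>M_eq\<close> expresses it through
  \<open>G\<close>, which cancels a factor \<open>A\<close> in the traces.\<close>

definition M :: "real^'m^'m" where "M = (\<chi> a c. W a \<bullet> u c + (\<Sum>k\<in>UNIV. p k * (U k a \<bullet> u c)))"

lemma S_theta: "S (\<theta> j) = (\<Sum>c\<in>UNIV. b $ c $ j *\<^sub>R u c)"
proof -
  have "S (\<theta> j) = (\<Sum>k\<in>UNIV. \<Sum>c\<in>UNIV. ((A ** b) $ k $ j * G $ c $ k) *\<^sub>R u c)"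
    by (simp add: \<theta>_def S_lin S_u scaleR_sum_right)
  also have "\<dots> = (\<Sum>c\<in>UNIV. (\<Sum>k\<in>UNIV. G $ c $ k * (A ** b) $ k $ j) *\<^sub>R u c)"
    by (subst sum.swap) (simp add: scaleR_sum_left mult.commute)
  also have "\<dots> = (\<Sum>c\<in>UNIV. (G ** (A ** b)) $ c $ j *\<^sub>R u c)"
    by (simp add: matrix_matrix_mult_def)
  finally show ?thesis by (simp add: matrix_mul_assoc GA matrix_mul_lid)
qed

lemma form_Y_theta: "form Y \<theta> = trace (A ** Ym ** b)"
proof -
  have "form Y \<theta> = (\<Sum>i\<in>UNIV. \<Sum>j\<in>UNIV. A $ i $ j * (Ym ** b) $ i $ j)"
    by (simp add: form_def S_theta inner_sum_right Ym_def matrix_matrix_mult_def mult.commute)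
  also have "\<dots> = trace (A ** transpose (Ym ** b))" by (rule sum_mult_eq_trace)
  also have "\<dots> = trace (transpose (A ** transpose (Ym ** b)))" by simp
  also have "transpose (A ** transpose (Ym ** b)) = (Ym ** b) ** A"
    by (simp add: matrix_transpose_mul transpose_transpose sym)
  also have "trace \<dots> = trace (A ** Ym ** b)"
    by (subst trace_mul_sym) (simp add: matrix_mul_assoc)
  finally show ?thesis .
qed

lemma form_theta_theta: "form \<theta> \<theta> = trace (A ** b ** A ** b) - trace (A ** b ** b)"
proof -
  have uu: "u k \<bullet> u c = (mat 1 - G) $ k $ c" for k c by (simp add: G_def mat_def)
  have "\<theta> i \<bullet> S (\<theta> j) = (transpose (A ** b) ** (mat 1 - G) ** b) $ i $ j" for i j
  proof -
    have "\<theta> i \<bullet> S (\<theta> j) = (\<Sum>c\<in>UNIV. \<Sum>k\<in>UNIV. (A ** b) $ k $ i * ((mat 1 - G) $ k $ c) * b $ c $ j)"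
      unfolding \<theta>_def[of i] S_theta
      by (simp add: inner_sum_right inner_sum_left uu mult.commute mult.left_commute sum_distrib_left)
    also have "\<dots> = (transpose (A ** b) ** (mat 1 - G) ** b) $ i $ j"
      by (simp add: matrix_matrix_mult_def transpose_def sum_distrib_right)
    finally show ?thesis .
  qed
  moreover have "transpose (A ** b) ** (mat 1 - G) ** b = b ** A ** b - b ** b"
    by (simp add: matrix_transpose_mul sym matrix_sub_ldistrib matrix_sub_rdistrib matrix_mul_rid
        matrix_mul_assoc[symmetric] AG)
  ultimately have "form \<theta> \<theta> = trace (A ** transpose (b ** A ** b - b ** b))"
    unfolding form_def sum_mult_eq_trace[symmetric] by simp
  moreover have "transpose (b ** A ** b - b ** b) = b ** A ** b - b ** b"
  proof -
    have "transpose (P - Q) = transpose P - transpose Q" for P Q :: "real^'m^'m"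
      by (simp add: transpose_def vec_eq_iff)
    then show ?thesis by (simp add: matrix_transpose_mul sym matrix_mul_assoc)
  qed
  ultimately show ?thesis
    by (simp add: matrix_sub_ldistrib trace_sub matrix_mul_assoc)
qed

lemma form_eta_eta:
  "form \<eta> \<eta> = form Y Y - 2 * trace (A ** Ym ** b) + trace (A ** b ** A ** b) - trace (A ** b ** b)"
proof -
  have "form \<eta> \<eta> = form Y Y - form Y \<theta> - form \<theta> Y + form \<theta> \<theta>"
    by (simp add: form_def \<eta>_def S_lin inner_diff_left inner_diff_right algebra_simps
        sum.distrib sum_subtractf)
  then show ?thesis by (simp add: form_sym[of \<theta> Y] form_Y_theta form_theta_theta)
qed

lemma M_eq: "M = (Ym + b) ** G - b"
proof -
  have "M $ a $ c = ((Ym + b) ** G - b) $ a $ c" for a c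
  proof -
    have uu: "u j \<bullet> u c = (if j = c then 1 else 0) - G $ j $ c" for j by (simp add: G_def)
    have "W a \<bullet> u c = Y a \<bullet> S (u c) - (\<Sum>j\<in>UNIV. p j * (U j a \<bullet> u c)) - (\<Sum>j\<in>UNIV. b $ j $ a * (u j \<bullet> u c))"
      unfolding W by (simp add: inner_diff_left inner_sum_left inner_commute[of "S (Y a)"] S_selfadj[of "u c"])
    moreover have "Y a \<bullet> S (u c) = (Ym ** G) $ a $ c"
      by (simp add: S_u inner_sum_right Ym_def matrix_matrix_mult_def mult.commute)
    moreover have "(\<Sum>j\<in>UNIV. b $ j $ a * (u j \<bullet> u c)) = b $ a $ c - (b ** G) $ a $ c"
    proof -
      show ?thesis unfolding uu b_sym[of _ a]
        by (simp add: right_diff_distrib sum_subtractf sum_kronecker_mult matrix_matrix_mult_def)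
    qed
    ultimately show ?thesis by (simp add: M_def matrix_add_rdistrib)
  qed
  then show ?thesis by (simp add: vec_eq_iff)
qed

lemma trace_AMAb:
  "trace (A ** M ** A ** b) = trace (A ** Ym ** b) + trace (A ** b ** b) - trace (A ** b ** A ** b)"
proof -
  have "A ** M ** A ** b = A ** (Ym + b) ** (G ** A) ** b - A ** b ** A ** b"
    by (simp add: M_eq matrix_sub_ldistrib matrix_sub_rdistrib matrix_mul_assoc)
  then show ?thesis
    by (simp add: GA matrix_mul_rid matrix_add_ldistrib matrix_add_rdistrib trace_add trace_sub)
qed

text \<open>Cauchy-Schwarz for the trace: \<open>c\<close> is the part of \<open>b\<close> that is
  trace-free for the metric \<open>G\<close>, and \<open>trace (A ** c ** (A ** c))\<close> is a sum
  of squares because \<open>A\<close> factors through \<open>E\<close>. Twice this bound is the term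
  \<open>q\<^sup>2 / (2 m)\<close> of the Bochner inequality.\<close>

lemma trace_square_bound: "trace (A ** b ** A ** b) \<ge> q\<^sup>2 / (4 * real CARD('m))"
proof -
  define l where "l = trace (A ** b) / real CARD('m)"
  define c where "c = b - l *\<^sub>R G"
  have m: "real CARD('m) > 0" by simp
  have cs: "transpose c = c" using sym by (simp add: c_def transpose_def vec_eq_iff)
  have Ac: "A ** c = A ** b - l *\<^sub>R mat 1"
    by (simp add: c_def matrix_sub_ldistrib matrix_scalar_ac AG flip: scalar_matrix_assoc)
  have "trace (A ** c ** (A ** c)) = trace (A ** b ** A ** b) - 2 * l * trace (A ** b) + l\<^sup>2 * real CARD('m)"
  proof -
    have "(P - l *\<^sub>R mat 1) ** (P - l *\<^sub>R mat 1) = P ** P - l *\<^sub>R P - l *\<^sub>R P + (l * l) *\<^sub>R mat 1"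
      for P :: "real^'m^'m"
      by (simp add: matrix_sub_ldistrib matrix_sub_rdistrib matrix_scalar_ac
          scaleR_right_diff_distrib flip: scalar_matrix_assoc)
    then show ?thesis
      unfolding Ac by (simp only: trace_sub trace_add trace_scaleR trace_I)
        (simp add: matrix_mul_assoc power2_eq_square)
  qed
  moreover have "trace (A ** c ** (A ** c)) \<ge> 0"
  proof -
    let ?D = "transpose E ** c ** E"
    have "trace (A ** c ** (A ** c)) = trace (E ** (transpose E ** c ** E ** transpose E ** c))"
      by (simp add: AE matrix_mul_assoc)
    also have "\<dots> = trace (transpose E ** c ** E ** transpose E ** c ** E)"
      by (rule trace_mul_sym)
    also have "\<dots> = trace (?D ** transpose ?D)"
      by (simp add: matrix_transpose_mul cs transpose_transpose matrix_mul_assoc)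
    also have "\<dots> = (\<Sum>i\<in>UNIV. \<Sum>j\<in>UNIV. ?D $ i $ j * ?D $ i $ j)"
      by (rule sum_mult_eq_trace[symmetric])
    also have "\<dots> \<ge> 0" by (intro sum_nonneg) simp
    finally show ?thesis .
  qed
  moreover have "2 * l * trace (A ** b) - l\<^sup>2 * real CARD('m) = q\<^sup>2 / (4 * real CARD('m))"
    using m by (simp add: l_def tr power2_eq_square field_simps)
  ultimately show ?thesis by linarith
qed

text \<open>Eliminating \<open>M\<close> leaves
  \<open>Lq = q + 2 trace (A b A b) + 2 form \<eta> \<eta>\<close>. Since \<open>dq i\<close> is
  \<open>2 y \<bullet> S (\<eta> i)\<close>, the gradient term equals
  \<open>4 form \<zeta> \<eta>\<close> with \<open>\<zeta> i = \<tau> z' i y\<close>, and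
  nonnegativity of \<open>form\<close> at \<open>\<eta> + \<zeta>\<close> completes the square. In
  this way no division by \<open>q\<close> occurs.\<close>

lemma Bochner_inequality:
  fixes z' :: "'m \<Rightarrow> real"
  assumes Lq: "Lq = q - 4 * trace (A ** M ** A ** b) + 2 * trace (A ** b ** b) + 2 * form Y Y"
    and dq: "\<And>i. dq i = 2 * (y \<bullet> S (Y i)) - 2 * (\<Sum>j\<in>UNIV. p j * b $ i $ j)"
  shows "Lq + 2 * \<tau> * (\<Sum>i\<in>UNIV. \<Sum>j\<in>UNIV. A $ i $ j * (z' i * dq j))
    \<ge> q + q\<^sup>2 / (2 * real CARD('m)) - 2 * \<tau>\<^sup>2 * q * (\<Sum>i\<in>UNIV. \<Sum>j\<in>UNIV. A $ i $ j * (z' i * z' j))"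
proof -
  have dq': "dq i = 2 * (y \<bullet> S (\<eta> i))" for i
  proof -
    have "y \<bullet> S (\<theta> i) = (\<Sum>j\<in>UNIV. p j * b $ i $ j)"
      unfolding S_theta inner_sum_right p_def b_sym[of i] by (simp add: mult.commute)
    then show ?thesis by (simp add: dq \<eta>_def S_lin(2) inner_diff_right)
  qed
  define \<zeta> where "\<zeta> i = (\<tau> * z' i) *\<^sub>R y" for i
  have f1: "form \<zeta> \<eta> = \<tau> / 2 * (\<Sum>i\<in>UNIV. \<Sum>j\<in>UNIV. A $ i $ j * (z' i * dq j))"
    by (simp add: form_def \<zeta>_def dq' sum_distrib_left mult_ac)
  have f2: "form \<zeta> \<zeta> = \<tau>\<^sup>2 * q * (\<Sum>i\<in>UNIV. \<Sum>j\<in>UNIV. A $ i $ j * (z' i * z' j))"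
    by (simp add: form_def \<zeta>_def S_lin(3) q_def sum_distrib_left mult_ac power2_eq_square)
  have "form (\<lambda>i. \<eta> i + \<zeta> i) (\<lambda>i. \<eta> i + \<zeta> i) = form \<eta> \<eta> + 2 * form \<zeta> \<eta> + form \<zeta> \<zeta>"
    unfolding form_add form_sym[of _ "\<lambda>i. \<eta> i + \<zeta> i"] by (simp add: form_sym[of \<eta> \<zeta>])
  then have "form \<eta> \<eta> + 2 * form \<zeta> \<eta> + form \<zeta> \<zeta> \<ge> 0"
    by (metis form_nonneg)
  moreover have "Lq = q + 2 * trace (A ** b ** A ** b) + 2 * form \<eta> \<eta>"
    unfolding Lq form_eta_eta trace_AMAb by simp
  ultimately show ?thesis using trace_square_bound f1 f2 by (simp add: algebra_simps)
qed

end

section \<open>Spacelike graphs\<close>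

lemma inner_lambda_left: "(\<chi> k. f k) \<bullet> (v :: real^'m) = (\<Sum>k\<in>UNIV. f k * v $ k)"
  by (simp add: inner_vec_def)

locale spacelike_graph =
  fixes u :: "real^'m \<Rightarrow> real^'n"
  assumes smooth_u: "smooth_map u" and spacelike_u: "spacelike (graph_map u)"
begin

abbreviation D :: "'m \<Rightarrow> real^'m \<Rightarrow> real^'n" where "D i \<equiv> pderiv_at i u"
abbreviation D2 :: "'m \<Rightarrow> 'm \<Rightarrow> real^'m \<Rightarrow> real^'n" where "D2 i j \<equiv> pderiv_at i (D j)"

definition du :: "real^'m \<Rightarrow> real^'m \<Rightarrow> real^'n" where
  "du x v = (\<Sum>i\<in>UNIV. v $ i *\<^sub>R D i x)"

definition G :: "real^'m \<Rightarrow> real^'m^'m" where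
  "G x = (\<chi> i j. (if i = j then 1 else 0) - D i x \<bullet> D j x)"

definition A :: "real^'m \<Rightarrow> real^'m^'m" where "A x = matrix_inv (G x)"

text \<open>The operator \<open>I - Du Du\<^sup>T\<close> on the fibre; by
  \<open>pinner_normal_vector\<close> it gives minus the inner product of the normal space.\<close>

definition S :: "real^'m \<Rightarrow> real^'n \<Rightarrow> real^'n" where
  "S x v = v - (\<Sum>k\<in>UNIV. (D k x \<bullet> v) *\<^sub>R D k x)"

text \<open>Woodbury's formula: the inverse of \<open>I - Du Du\<^sup>T\<close> in terms of the
  inverse \<open>A\<close> of \<open>I - Du\<^sup>T Du\<close>.\<close>

definition Sinv :: "real^'m \<Rightarrow> real^'n \<Rightarrow> real^'n" where
  "Sinv x c = c + (\<Sum>i\<in>UNIV. \<Sum>j\<in>UNIV. (A x $ i $ j * (D j x \<bullet> c)) *\<^sub>R D i x)"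

text \<open>The normal space is itself a graph, over the fibre; \<open>y\<close> is the coordinate
  of a normal vector.\<close>

definition normal_vector :: "real^'m \<Rightarrow> real^'n \<Rightarrow> (real^'m) \<times> (real^'n)" where
  "normal_vector x y = ((\<chi> k. D k x \<bullet> y), y)"

lemma smooth_D: "smooth_map (D i)" "smooth_map (D2 i j)"
  by (intro smooth_map_pderiv_at smooth_u)+

lemma D2_commute: "D2 i j x = D2 j i x"
  by (rule pderiv_at_commute[OF smooth_u])

lemma linear_du: "linear (du x)"
  by (rule linearI) (simp_all add: du_def algebra_simps sum.distrib scaleR_sum_right)

lemma has_derivative_u: "(u has_derivative du x) (at x)"
  using has_derivative_pderiv_at[OF smooth_map_differentiable[OF smooth_u]] by (simp add: du_def[abs_def])

lemma differential_graph: "differential (graph_map u) x v = (v, du x v)"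
proof -
  have "(graph_map u has_derivative (\<lambda>v. (v, du x v))) (at x)"
    unfolding graph_map_def by (intro has_derivative_Pair has_derivative_ident has_derivative_u)
  then show ?thesis by (metis frechet_derivative_at)
qed

lemma induced_metric_graph: "induced_metric (graph_map u) x v w = v \<bullet> w - du x v \<bullet> du x w"
  by (simp add: induced_metric_def differential_graph pinner_def)

lemma du_axis: "du x (axis i 1) = D i x"
  by (simp add: du_def axis_def if_distribR if_distrib cong: if_cong)

lemma induced_metric_axis: "induced_metric (graph_map u) x (axis i 1) (axis j 1) = G x $ i $ j"
  by (simp add: induced_metric_graph du_axis G_def inner_axis_axis)

lemma norm_du_less: "v \<noteq> 0 \<Longrightarrow> norm (du x v) < norm v"
  using spacelike_u unfolding spacelike_def induced_metric_graph
  by (metis diff_gt_0_iff_gt dot_norm norm_lt)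

lemma bilinear_induced_metric: "bilinear (induced_metric (graph_map u) x)"
  unfolding bilinear_def induced_metric_graph
  by (auto intro!: linearI simp: inner_add_left inner_add_right linear_add[OF linear_du]
      linear_cmul[OF linear_du] algebra_simps)

lemma ex_orthonormal_basis: "\<exists>e. orthonormal_basis_at (graph_map u) x e"
  unfolding orthonormal_basis_at_def
  by (rule orthonormal_basis_of_positive_form[OF bilinear_induced_metric])
    (use spacelike_u in \<open>auto simp: spacelike_def induced_metric_graph inner_commute\<close>)

text \<open>The columns of \<open>E\<close> are the basis vectors, so orthonormality reads
  \<open>E\<^sup>T G E = I\<close>, which determines the inverse of \<open>G\<close>. The basis is
  arbitrary because the one in \<open>mean_curvature\<close> comes from a choice operator.\<close>

lemma orthonormal_basis_factor:
  assumes "orthonormal_basis_at (graph_map u) x e"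
  defines "E \<equiv> (\<chi> i k. e k $ i)"
  shows "A x = E ** transpose E" "A x ** G x = mat 1" "G x ** A x = mat 1" "det (G x) > 0"
proof -
  have "(transpose E ** G x ** E) $ k $ l = induced_metric (graph_map u) x (e k) (e l)" for k l
  proof -
    have "(transpose E ** G x ** E) $ k $ l = (\<Sum>j\<in>UNIV. \<Sum>i\<in>UNIV. e k $ i * G x $ i $ j * e l $ j)"
      by (simp add: matrix_matrix_mult_def transpose_def E_def sum_distrib_right)
    also have "\<dots> = (\<Sum>j\<in>UNIV. \<Sum>i\<in>UNIV. e k $ i * (if i = j then 1 else 0) * e l $ j)
      - (\<Sum>j\<in>UNIV. \<Sum>i\<in>UNIV. e k $ i * (D i x \<bullet> D j x) * e l $ j)"
      by (simp add: G_def algebra_simps sum_subtractf)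
    also have "(\<Sum>j\<in>UNIV. \<Sum>i\<in>UNIV. e k $ i * (if i = j then 1 else 0) * e l $ j) = e k \<bullet> e l"
      by (simp add: sum_distrib_right[symmetric] sum_kronecker_mult inner_vec_def)
    also have "(\<Sum>j\<in>UNIV. \<Sum>i\<in>UNIV. e k $ i * (D i x \<bullet> D j x) * e l $ j) = du x (e k) \<bullet> du x (e l)"
      unfolding du_def inner_sum_right inner_sum_left by (simp add: mult_ac)
    finally show ?thesis by (simp add: induced_metric_graph)
  qed
  then have EGE: "transpose E ** G x ** E = mat 1"
    using assms(1) by (simp add: orthonormal_basis_at_def vec_eq_iff mat_def)
  then have "E ** (transpose E ** G x) = mat 1"
    using matrix_left_right_inverse by blast
  then have l: "(E ** transpose E) ** G x = mat 1" by (simp add: matrix_mul_assoc)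
  then have r: "G x ** (E ** transpose E) = mat 1"
    using matrix_left_right_inverse by blast
  have inv: "G x ** A x = mat 1 \<and> A x ** G x = mat 1"
    unfolding A_def matrix_inv_def by (rule someI_ex) (use l r in blast)
  show "A x ** G x = mat 1" "G x ** A x = mat 1" using inv by auto
  have "A x = A x ** (G x ** (E ** transpose E))" by (simp add: r matrix_mul_rid)
  then show "A x = E ** transpose E" using inv by (simp add: matrix_mul_assoc matrix_mul_lid)
  have "det E * det (G x) * det E = 1"
    using arg_cong[OF EGE, of det] by (simp add: det_mul det_transpose det_I)
  then have "det (G x) * (det E)\<^sup>2 = 1" by (simp add: power2_eq_square mult_ac)
  then have "0 < det (G x) * (det E)\<^sup>2" by simp
  then show "det (G x) > 0" by (simp add: zero_less_mult_iff)
qed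

lemma AG: "A x ** G x = mat 1" and GA: "G x ** A x = mat 1" and det_G_pos: "det (G x) > 0"
  using orthonormal_basis_factor(2-4) ex_orthonormal_basis by blast+

lemma G_sym: "G x $ i $ j = G x $ j $ i"
  by (simp add: G_def inner_commute)

lemma A_factor: "\<exists>E :: real^'m^'m. A x = E ** transpose E"
  using orthonormal_basis_factor(1) ex_orthonormal_basis by blast

lemma transpose_A: "transpose (A x) = A x"
  using A_factor[of x] by (auto simp: matrix_transpose_mul transpose_transpose)

lemma A_sym: "A x $ i $ j = A x $ j $ i"
  using transpose_A[of x] by (auto simp: transpose_def vec_eq_iff)

lemma sum_A_G: "(\<Sum>k\<in>UNIV. A x $ i $ k * G x $ k $ j) = (if i = j then 1 else 0)"
  and sum_G_A: "(\<Sum>k\<in>UNIV. G x $ i $ k * A x $ k $ j) = (if i = j then 1 else 0)"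
  using AG[of x] GA[of x] by (simp_all add: matrix_matrix_mult_def mat_def vec_eq_iff)

lemma linear_S: "linear (S x)"
  by (rule linearI) (simp_all add: S_def inner_add_right algebra_simps sum.distrib scaleR_sum_right)

lemma linear_Sinv: "linear (Sinv x)"
  by (rule linearI) (simp_all add: Sinv_def inner_add_right algebra_simps sum.distrib scaleR_sum_right)

lemma S_D: "S x (D k x) = (\<Sum>c\<in>UNIV. G x $ c $ k *\<^sub>R D c x)"
proof -
  have "(\<Sum>c\<in>UNIV. G x $ c $ k *\<^sub>R D c x)
      = (\<Sum>c\<in>UNIV. (if c = k then D c x else 0)) - (\<Sum>c\<in>UNIV. (D c x \<bullet> D k x) *\<^sub>R D c x)"
    unfolding sum_subtractf[symmetric] G_def
    by (intro sum.cong) (auto simp: scaleR_left_diff_distrib)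
  then show ?thesis by (simp add: S_def)
qed

lemma S_Sinv: "S x (Sinv x c) = c"
proof -
  have "S x (Sinv x c) = S x c + (\<Sum>i\<in>UNIV. \<Sum>j\<in>UNIV. (A x $ i $ j * (D j x \<bullet> c)) *\<^sub>R S x (D i x))"
    by (simp add: Sinv_def linear_add[OF linear_S] linear_sum[OF linear_S] linear_cmul[OF linear_S])
  also have "(\<Sum>i\<in>UNIV. \<Sum>j\<in>UNIV. (A x $ i $ j * (D j x \<bullet> c)) *\<^sub>R S x (D i x))
      = (\<Sum>i\<in>UNIV. \<Sum>j\<in>UNIV. \<Sum>k\<in>UNIV. (G x $ k $ i * A x $ i $ j * (D j x \<bullet> c)) *\<^sub>R D k x)"
    by (simp add: S_D scaleR_sum_right mult_ac)
  also have "\<dots> = (\<Sum>k\<in>UNIV. \<Sum>j\<in>UNIV. \<Sum>i\<in>UNIV. (G x $ k $ i * A x $ i $ j * (D j x \<bullet> c)) *\<^sub>R D k x)"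
    by (subst sum.swap, subst (2) sum.swap, subst sum.swap) (rule refl)
  also have "\<dots> = (\<Sum>k\<in>UNIV. (\<Sum>j\<in>UNIV. (\<Sum>i\<in>UNIV. G x $ k $ i * A x $ i $ j) * (D j x \<bullet> c)) *\<^sub>R D k x)"
    by (simp add: scaleR_sum_left sum_distrib_right)
  also have "\<dots> = (\<Sum>k\<in>UNIV. (D k x \<bullet> c) *\<^sub>R D k x)"
    by (simp add: sum_G_A sum_kronecker_mult)
  finally show ?thesis by (simp add: S_def)
qed

lemma inner_S: "v \<bullet> S x v = (norm v)\<^sup>2 - (\<Sum>k\<in>UNIV. (D k x \<bullet> v)\<^sup>2)"
  unfolding power2_norm_eq_inner
  by (simp add: S_def inner_diff_right inner_sum_right power2_eq_square inner_commute)

text \<open>\<open>Du\<close> and its transpose have the same norm. Concretely, for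
  \<open>a = Du\<^sup>T v\<close> the squared norm of \<open>a\<close> is
  \<open>v \<bullet> du x a\<close>, which Cauchy-Schwarz and the strict contraction
  \<open>norm_du_less\<close> place below \<open>norm v * norm a\<close>.\<close>

lemma S_pos: assumes "v \<noteq> 0" shows "v \<bullet> S x v > 0"
proof -
  define a where "a = (\<chi> k. D k x \<bullet> v)"
  have na: "(norm a)\<^sup>2 = (\<Sum>k\<in>UNIV. (D k x \<bullet> v)\<^sup>2)"
    unfolding power2_norm_eq_inner a_def inner_lambda_left by (simp add: power2_eq_square)
  have "norm a < norm v"
  proof (cases "a = 0")
    case False
    have "(norm a)\<^sup>2 = v \<bullet> du x a"
      unfolding na by (simp add: du_def inner_sum_right a_def power2_eq_square inner_commute)
    also have "\<dots> \<le> norm v * norm (du x a)" by (rule norm_cauchy_schwarz)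
    also have "\<dots> < norm v * norm a" using norm_du_less[OF False] assms by simp
    finally show ?thesis using False by (simp add: power2_eq_square)
  qed (use assms in simp)
  then have "(norm a)\<^sup>2 < (norm v)\<^sup>2" by (simp add: power_strict_mono)
  then show ?thesis using na by (simp add: inner_S)
qed

lemma S_nonneg: "v \<bullet> S x v \<ge> 0"
  using S_pos[of v x] by (cases "v = 0") auto

section \<open>Normal projection and mean curvature of a graph\<close>

lemma inner_normal_tangent: "pinner (normal_vector x y) (v, du x v) = 0"
  unfolding normal_vector_def pinner_def fst_conv snd_conv inner_lambda_left du_def
  by (simp add: inner_sum_right inner_commute mult.commute)

lemma pinner_normal_vector: "pinner (normal_vector x y) (normal_vector x y) = - (y \<bullet> S x y)"
  unfolding normal_vector_def pinner_def inner_S fst_conv snd_conv inner_lambda_left power2_norm_eq_inner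
  by (simp add: power2_eq_square)

lemma linear_normal_vector: "linear (normal_vector x)"
  by (rule linearI) (simp_all add: normal_vector_def vec_eq_iff inner_add_right)

text \<open>Subtracting \<open>normal_vector x y\<close> from \<open>(a, c)\<close> leaves a tangent
  vector once \<open>S x y = c - du x a\<close>, and \<open>Sinv\<close> solves this. Two candidates
  differ by a vector that is tangent and normal, so its induced length is zero and positivity of the
  metric makes it vanish.\<close>

lemma normal_proj_graph: "normal_proj (graph_map u) x (a, c) = normal_vector x (Sinv x (c - du x a))"
proof -
  have tangent: "tangent_space (graph_map u) x = range (\<lambda>v. (v, du x v))"
    by (simp add: tangent_space_def differential_graph)
  define y where "y = Sinv x (c - du x a)"
  have S_y: "S x y = c - du x a" by (simp add: y_def S_Sinv)
  define p where "p = (\<chi> k. D k x \<bullet> y)"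
  have dp: "du x p = (\<Sum>k\<in>UNIV. (D k x \<bullet> y) *\<^sub>R D k x)" by (simp add: du_def p_def)
  have "(a, c) - normal_vector x y = (a - p, du x (a - p))"
    using S_y by (simp add: normal_vector_def p_def[symmetric] linear_diff[OF linear_du] dp S_def algebra_simps)
  then have ex: "normal_vector x y \<in> normal_space (graph_map u) x
      \<and> (a, c) - normal_vector x y \<in> tangent_space (graph_map u) x"
    by (auto simp: normal_space_def tangent inner_normal_tangent)
  show ?thesis unfolding normal_proj_def y_def[symmetric]
  proof (rule the_equality, rule ex)
    fix \<nu> assume \<nu>: "\<nu> \<in> normal_space (graph_map u) x \<and> (a, c) - \<nu> \<in> tangent_space (graph_map u) x"
    then obtain v where v: "(a, c) - \<nu> = (v, du x v)" by (auto simp: tangent)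
    obtain v' where v': "(a, c) - normal_vector x y = (v', du x v')" using ex by (auto simp: tangent)
    have "normal_vector x y - \<nu> = ((a, c) - \<nu>) - ((a, c) - normal_vector x y)" by simp
    also have "\<dots> = (v - v', du x (v - v'))"
      unfolding v v' by (simp add: linear_diff[OF linear_du])
    finally have e: "normal_vector x y - \<nu> = (v - v', du x (v - v'))" .
    have "pinner (normal_vector x y - \<nu>) (v - v', du x (v - v')) = 0"
    proof -
      have "pinner \<nu> (v - v', du x (v - v')) = 0" using \<nu> by (auto simp: normal_space_def tangent)
      then show ?thesis using inner_normal_tangent[of x y "v - v'"]
        by (simp add: pinner_def inner_diff_left)
    qed
    then have "induced_metric (graph_map u) x (v - v') (v - v') = 0"
      unfolding e by (simp add: induced_metric_def differential_graph)
    moreover have "v - v' \<noteq> 0 \<Longrightarrow> induced_metric (graph_map u) x (v - v') (v - v') > 0"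
      using spacelike_u unfolding spacelike_def by blast
    ultimately have "v - v' = 0" by fastforce
    then have "normal_vector x y - \<nu> = 0" using e by (simp add: linear_0[OF linear_du] zero_prod_def)
    then show "\<nu> = normal_vector x y" by simp
  qed
qed

definition tension :: "real^'m \<Rightarrow> real^'n" where
  "tension x = (\<Sum>i\<in>UNIV. \<Sum>j\<in>UNIV. A x $ i $ j *\<^sub>R D2 i j x)"

text \<open>\<open>(0, w x)\<close> is a tangent vector minus the position vector, so it has the
  same normal part as \<open>- X\<close>. The equation \<open>w = 0\<close> is Euler's relation for
  homogeneity of degree one.\<close>

definition w :: "real^'m \<Rightarrow> real^'n" where
  "w x = (\<Sum>k\<in>UNIV. x $ k *\<^sub>R D k x) - u x"

lemma second_fund_form_graph:
  "second_fund_form (graph_map u) (\<lambda>_. e) (\<lambda>_. e) x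
    = normal_vector x (Sinv x (\<Sum>i\<in>UNIV. \<Sum>j\<in>UNIV. (e $ i * e $ j) *\<^sub>R D2 i j x))"
proof -
  have h: "(D j has_derivative (\<lambda>v. \<Sum>i\<in>UNIV. v $ i *\<^sub>R D2 i j x)) (at x)" for j
    by (rule has_derivative_pderiv_at[OF smooth_map_differentiable[OF smooth_D(1)]])
  have "((\<lambda>y. (e, du y e)) has_derivative
      (\<lambda>v. (0, \<Sum>j\<in>UNIV. e $ j *\<^sub>R (\<Sum>i\<in>UNIV. v $ i *\<^sub>R D2 i j x)))) (at x)"
    unfolding du_def
    by (rule has_derivative_Pair[OF has_derivative_const])
      (rule has_derivative_sum, rule has_derivative_scaleR_right, rule h)
  from frechet_derivative_at[OF this]
  have "frechet_derivative (\<lambda>y. (e, du y e)) (at x) e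
      = (0, \<Sum>j\<in>UNIV. e $ j *\<^sub>R (\<Sum>i\<in>UNIV. e $ i *\<^sub>R D2 i j x))"
    by (simp add: fun_eq_iff)
  also have "(\<Sum>j\<in>UNIV. e $ j *\<^sub>R (\<Sum>i\<in>UNIV. e $ i *\<^sub>R D2 i j x))
      = (\<Sum>j\<in>UNIV. \<Sum>i\<in>UNIV. (e $ i * e $ j) *\<^sub>R D2 i j x)"
    by (simp add: scaleR_sum_right mult.commute)
  also have "\<dots> = (\<Sum>i\<in>UNIV. \<Sum>j\<in>UNIV. (e $ i * e $ j) *\<^sub>R D2 i j x)"
    by (rule sum.swap)
  finally show ?thesis
    unfolding second_fund_form_def differential_graph
    by (simp add: normal_proj_graph linear_0[OF linear_du])
qed

lemma mean_curvature_graph: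
  "mean_curvature (graph_map u) x = normal_vector x (Sinv x (tension x))"
proof -
  define e where "e = (SOME e. orthonormal_basis_at (graph_map u) x e)"
  have "orthonormal_basis_at (graph_map u) x e"
    unfolding e_def using ex_orthonormal_basis by (rule someI_ex)
  from orthonormal_basis_factor(1)[OF this]
  have Ae: "A x $ i $ j = (\<Sum>k\<in>UNIV. e k $ i * e k $ j)" for i j
    by (simp add: matrix_matrix_mult_def transpose_def)
  have "(\<Sum>k\<in>UNIV. \<Sum>i\<in>UNIV. \<Sum>j\<in>UNIV. (e k $ i * e k $ j) *\<^sub>R D2 i j x)
      = (\<Sum>i\<in>UNIV. \<Sum>k\<in>UNIV. \<Sum>j\<in>UNIV. (e k $ i * e k $ j) *\<^sub>R D2 i j x)"
    by (rule sum.swap)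
  also have "\<dots> = (\<Sum>i\<in>UNIV. \<Sum>j\<in>UNIV. \<Sum>k\<in>UNIV. (e k $ i * e k $ j) *\<^sub>R D2 i j x)"
    by (rule sum.cong[OF refl]) (rule sum.swap)
  also have "\<dots> = tension x" by (simp add: tension_def Ae scaleR_sum_left)
  finally have t: "(\<Sum>k\<in>UNIV. \<Sum>i\<in>UNIV. \<Sum>j\<in>UNIV. (e k $ i * e k $ j) *\<^sub>R D2 i j x) = tension x" .
  have "mean_curvature (graph_map u) x
      = (\<Sum>k\<in>UNIV. second_fund_form (graph_map u) (\<lambda>_. e k) (\<lambda>_. e k) x)"
    by (simp add: mean_curvature_def e_def Let_def)
  also have "\<dots> = normal_vector x (Sinv x (tension x))"
    by (simp only: second_fund_form_graph linear_sum[OF linear_normal_vector, symmetric]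
        linear_sum[OF linear_Sinv, symmetric] t)
  finally show ?thesis .
qed

text \<open>The normal projection of a vertical vector \<open>(0, c)\<close> determines
  \<open>c\<close>, because \<open>S\<close> undoes \<open>Sinv\<close>. Hence the equation between
  normal vectors is equivalent to a quasilinear elliptic system for \<open>u\<close>.\<close>

lemma self_shrinker_graph_iff:
  "self_shrinker (graph_map u) \<longleftrightarrow> (\<forall>x. tension x = (1/2) *\<^sub>R w x)"
proof -
  have "(mean_curvature (graph_map u) x = - (1/2) *\<^sub>R normal_proj (graph_map u) x (graph_map u x))
      \<longleftrightarrow> tension x = (1/2) *\<^sub>R w x" for x
  proof -
    have "- (1/2) *\<^sub>R normal_proj (graph_map u) x (graph_map u x)
        = normal_vector x (Sinv x ((1/2) *\<^sub>R w x))"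
    proof -
      have "u x - du x x = - w x" by (simp add: w_def du_def)
      then show ?thesis
        unfolding graph_map_def normal_proj_graph[unfolded graph_map_def]
        by (simp add: linear_cmul[OF linear_Sinv] linear_cmul[OF linear_normal_vector]
            linear_neg[OF linear_Sinv] linear_neg[OF linear_normal_vector])
    qed
    moreover have "normal_vector x (Sinv x c) = normal_vector x (Sinv x d) \<longleftrightarrow> c = d" for c d
      using S_Sinv[of x] by (metis normal_vector_def prod.inject)
    ultimately show ?thesis by (simp add: mean_curvature_graph)
  qed
  then show ?thesis by (simp add: self_shrinker_def)
qed

end

section \<open>The self-shrinker equation\<close>

lemmas smooth_map_intros = smooth_map_add smooth_map_diff smooth_map_mult smooth_map_scaleR
  smooth_map_inner smooth_map_sum smooth_map_const smooth_map_coord smooth_map_ident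

lemma sum_kronecker_scaleR:
  fixes f :: "'m::finite \<Rightarrow> 'b::real_vector"
  shows "(\<Sum>k\<in>UNIV. (if i = k then 1 else 0) *\<^sub>R f k) = f i"
proof -
  have "(\<Sum>k\<in>UNIV. (if i = k then 1 else 0) *\<^sub>R f k) = (\<Sum>k\<in>UNIV. if i = k then f k else 0)"
    by (intro sum.cong) auto
  then show ?thesis by simp
qed

lemma smooth_pderiv_add:
  fixes f g :: "real^'m \<Rightarrow> 'b::real_inner"
  assumes "smooth_map f" "smooth_map g"
  shows "pderiv_at i (\<lambda>x. f x + g x) = (\<lambda>x. pderiv_at i f x + pderiv_at i g x)"
  using assms[THEN smooth_map_differentiable] by (simp add: fun_eq_iff pderiv_at_add)

lemma smooth_pderiv_diff:
  fixes f g :: "real^'m \<Rightarrow> 'b::real_inner"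
  assumes "smooth_map f" "smooth_map g"
  shows "pderiv_at i (\<lambda>x. f x - g x) = (\<lambda>x. pderiv_at i f x - pderiv_at i g x)"
  using assms[THEN smooth_map_differentiable] by (simp add: fun_eq_iff pderiv_at_diff)

lemma smooth_pderiv_inner:
  fixes f g :: "real^'m \<Rightarrow> 'b::real_inner"
  assumes "smooth_map f" "smooth_map g"
  shows "pderiv_at i (\<lambda>x. f x \<bullet> g x) = (\<lambda>x. f x \<bullet> pderiv_at i g x + pderiv_at i f x \<bullet> g x)"
  using assms[THEN smooth_map_differentiable] by (simp add: fun_eq_iff pderiv_at_inner)

lemma smooth_pderiv_scaleR:
  fixes g :: "real^'m \<Rightarrow> 'b::real_inner"
  assumes "smooth_map f" "smooth_map g"
  shows "pderiv_at i (\<lambda>x. f x *\<^sub>R g x) = (\<lambda>x. f x *\<^sub>R pderiv_at i g x + pderiv_at i f x *\<^sub>R g x)"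
  using assms[THEN smooth_map_differentiable] by (simp add: fun_eq_iff pderiv_at_scaleR)

lemma smooth_pderiv_mult:
  fixes f g :: "real^'m \<Rightarrow> real"
  assumes "smooth_map f" "smooth_map g"
  shows "pderiv_at i (\<lambda>x. f x * g x) = (\<lambda>x. f x * pderiv_at i g x + pderiv_at i f x * g x)"
  using assms[THEN smooth_map_differentiable] by (simp add: fun_eq_iff pderiv_at_mult)

lemma smooth_pderiv_sum:
  fixes f :: "'i \<Rightarrow> real^'m \<Rightarrow> 'b::real_inner"
  assumes "\<And>j. smooth_map (f j)"
  shows "pderiv_at i (\<lambda>x. \<Sum>j\<in>I. f j x) = (\<lambda>x. \<Sum>j\<in>I. pderiv_at i (f j) x)"
  using assms[THEN smooth_map_differentiable] by (simp add: fun_eq_iff pderiv_at_sum)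

locale shrinker_graph = spacelike_graph u for u :: "real^'m \<Rightarrow> real^'n" +
  assumes shrinker: "tension x = (1/2) *\<^sub>R w x"
begin

text \<open>The second component of the normal vector \<open>- X\<^sup>N\<close>, found by solving
  \<open>S y = w\<close>.\<close>

definition y :: "real^'m \<Rightarrow> real^'n" where "y x = Sinv x (w x)"
definition q :: "real^'m \<Rightarrow> real" where "q x = y x \<bullet> w x"
definition z :: "real^'m \<Rightarrow> real" where "z x = x \<bullet> x - u x \<bullet> u x"
definition rho :: "real^'m \<Rightarrow> real" where "rho x = sqrt (det (G x)) * exp (- (1/4) * z x)"

text \<open>The drift Laplacian sends every coordinate function of the ambient space to
  \<open>- 1/2\<close> times itself, by the shrinker equation; for the first \<open>m\<close>
  coordinates this fixes the first-order term in the graph chart. Values in an inner product space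
  are allowed because \<open>L\<close> is also applied to \<open>w\<close> and to the derivatives
  \<open>D k\<close>.\<close>

definition L :: "(real^'m \<Rightarrow> 'b::real_inner) \<Rightarrow> real^'m \<Rightarrow> 'b" where
  "L f x = (\<Sum>i\<in>UNIV. \<Sum>j\<in>UNIV. A x $ i $ j *\<^sub>R pderiv_at i (pderiv_at j f) x)
    - (1/2) *\<^sub>R (\<Sum>k\<in>UNIV. x $ k *\<^sub>R pderiv_at k f x)"

definition grad_inner :: "(real^'m \<Rightarrow> real) \<Rightarrow> (real^'m \<Rightarrow> real) \<Rightarrow> real^'m \<Rightarrow> real" where
  "grad_inner f g x = (\<Sum>i\<in>UNIV. \<Sum>j\<in>UNIV. A x $ i $ j * (pderiv_at i f x * pderiv_at j g x))"

definition N :: "'m \<Rightarrow> real^'m \<Rightarrow> real^'m^'m" where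
  "N k x = (\<chi> a b. D2 k a x \<bullet> D b x)"

lemma smooth_G: "smooth_map (\<lambda>x. G x $ i $ j)"
  unfolding G_def vec_lambda_beta by (intro smooth_map_intros smooth_D)

text \<open>By Cramer's rule each entry is a polynomial in the entries of \<open>G\<close> divided
  by the nonvanishing determinant.\<close>

lemma smooth_A: "smooth_map (\<lambda>x. A x $ i $ j)"
proof -
  have "A x $ i $ j = det (\<chi> a b. if b = i then axis j 1 $ a else G x $ a $ b) * inverse (det (G x))" for x
  proof -
    have "G x *v column j (A x) = axis j 1"
      using sum_G_A[of x _ j] by (auto simp: vec_eq_iff matrix_vector_mult_def column_def axis_def)
    then have "column j (A x) = (\<chi> k. det (\<chi> a b. if b = k then axis j 1 $ a else G x $ a $ b) / det (G x))"
      using det_G_pos[of x] by (subst (asm) cramer) auto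
    then have "column j (A x) $ i = det (\<chi> a b. if b = i then axis j 1 $ a else G x $ a $ b) / det (G x)"
      by simp
    then show ?thesis by (simp add: column_def divide_inverse)
  qed
  moreover have "smooth_map (\<lambda>x. det (\<chi> a b. if b = i then axis j 1 $ a else G x $ a $ b) * inverse (det (G x)))"
  proof (intro smooth_map_mult smooth_map_inverse smooth_map_det)
    show "smooth_map (\<lambda>x. (\<chi> a b. if b = i then axis j 1 $ a else G x $ a $ b) $ a $ b)" for a b
      by (cases "b = i") (auto intro: smooth_map_const smooth_G)
    show "det (G x) \<noteq> 0" for x using det_G_pos[of x] by simp
  qed (rule smooth_G)
  ultimately show ?thesis by presburger
qed

lemma smooth_w: "smooth_map w"
  unfolding w_def[abs_def] by (intro smooth_map_intros smooth_D smooth_u)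

lemma smooth_y: "smooth_map y"
  unfolding y_def[abs_def] Sinv_def by (intro smooth_map_intros smooth_D smooth_w smooth_A)

lemma smooth_q: "smooth_map q"
  unfolding q_def[abs_def] by (intro smooth_map_intros smooth_y smooth_w)

lemma smooth_z: "smooth_map z"
  unfolding z_def[abs_def] by (intro smooth_map_intros smooth_u)

lemma smooth_rho: "smooth_map rho"
  unfolding rho_def[abs_def]
  by (intro smooth_map_mult smooth_map_sqrt smooth_map_det smooth_map_exp smooth_map_const
      smooth_G smooth_z det_G_pos)

lemma rho_pos: "rho x > 0"
  using det_G_pos[of x] by (simp add: rho_def)

lemma S_y: "S x (y x) = w x"
  by (simp add: y_def S_Sinv)

lemma q_eq: "q x = y x \<bullet> S x (y x)"
  by (simp add: q_def S_y)

lemma q_nonneg: "q x \<ge> 0"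
  unfolding q_eq by (rule S_nonneg)

lemma w_eq_0: "q x = 0 \<Longrightarrow> w x = 0"
  using S_pos[of "y x" x] S_y[of x] linear_0[OF linear_S] unfolding q_eq by fastforce

lemma pderiv_G: "pderiv_at k (\<lambda>x. G x $ i $ j) = (\<lambda>x. - (N k x $ i $ j + N k x $ j $ i))"
proof -
  have "pderiv_at k (\<lambda>x. G x $ i $ j) = pderiv_at k (\<lambda>x. (if i = j then 1 else 0) - D i x \<bullet> D j x)"
    by (simp only: G_def vec_lambda_beta)
  also have "\<dots> = (\<lambda>x. 0 - (D i x \<bullet> D2 k j x + D2 k i x \<bullet> D j x))"
    by (simp only: smooth_pderiv_diff smooth_map_const smooth_map_inner smooth_D smooth_pderiv_inner
        pderiv_at_const)
  also have "\<dots> = (\<lambda>x. - (N k x $ i $ j + N k x $ j $ i))"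
    by (simp add: N_def inner_commute algebra_simps)
  finally show ?thesis .
qed

text \<open>Differentiate \<open>A G = I\<close>, where the derivative of \<open>G\<close> is minus
  the symmetrisation of \<open>N k\<close>, and multiply by \<open>A\<close> from the right.\<close>

lemma pderiv_A: "pderiv_at k (\<lambda>x. A x $ i $ j) x = (A x ** (N k x + transpose (N k x)) ** A x) $ i $ j"
proof -
  define A' where "A' = (\<chi> i j. pderiv_at k (\<lambda>x. A x $ i $ j) x)"
  have "(A' ** G x) $ i $ l = (A x ** (N k x + transpose (N k x))) $ i $ l" for i l
  proof -
    have "0 = pderiv_at k (\<lambda>x. if i = l then 1 else 0 :: real) x" by simp
    also have "\<dots> = pderiv_at k (\<lambda>x. \<Sum>j\<in>UNIV. A x $ i $ j * G x $ j $ l) x"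
      by (simp add: sum_A_G)
    also have "\<dots> = (\<Sum>j\<in>UNIV. A x $ i $ j * pderiv_at k (\<lambda>x. G x $ j $ l) x + A' $ i $ j * G x $ j $ l)"
      by (simp add: smooth_pderiv_sum smooth_map_mult smooth_A smooth_G smooth_pderiv_mult A'_def)
    also have "\<dots> = (A' ** G x) $ i $ l - (A x ** (N k x + transpose (N k x))) $ i $ l"
      by (simp add: pderiv_G matrix_matrix_mult_def sum.distrib transpose_def algebra_simps
          sum_subtractf sum_negf)
    finally show ?thesis by simp
  qed
  then have "A' ** G x = A x ** (N k x + transpose (N k x))" by (simp add: vec_eq_iff)
  then have "A' ** G x ** A x = A x ** (N k x + transpose (N k x)) ** A x" by simp
  then have "A' = A x ** (N k x + transpose (N k x)) ** A x"
    by (simp add: matrix_mul_assoc[symmetric] GA matrix_mul_rid)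
  then show ?thesis by (metis (no_types, lifting) A'_def vec_lambda_beta)
qed

lemma pderiv_w: "pderiv_at i w = (\<lambda>x. \<Sum>k\<in>UNIV. x $ k *\<^sub>R D2 i k x)"
proof -
  have "pderiv_at i w = (\<lambda>x. (\<Sum>k\<in>UNIV. x $ k *\<^sub>R D2 i k x + (if i = k then 1 else 0) *\<^sub>R D k x) - D i x)"
    unfolding w_def[abs_def]
    by (simp add: smooth_pderiv_diff smooth_map_sum smooth_map_scaleR smooth_map_coord smooth_D smooth_u
        smooth_pderiv_sum smooth_pderiv_scaleR pderiv_at_coord)
  then show ?thesis by (simp add: sum.distrib sum_kronecker_scaleR)
qed

text \<open>This is the shrinker equation differentiated in direction \<open>k\<close>. The
  derivative of \<open>w / 2\<close> is exactly the drift term of \<open>L (D k)\<close>, so only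
  the derivative of the inverse metric remains.\<close>

lemma L_D: "L (D k) x = - (\<Sum>i\<in>UNIV. \<Sum>j\<in>UNIV. pderiv_at k (\<lambda>x. A x $ i $ j) x *\<^sub>R D2 i j x)"
proof -
  have "tension = (\<lambda>x. (1/2) *\<^sub>R w x)" using shrinker by blast
  then have "pderiv_at k tension x = (1/2) *\<^sub>R pderiv_at k w x"
    by (simp add: smooth_pderiv_scaleR smooth_map_const smooth_w)
  moreover have "pderiv_at k tension x = (\<Sum>i\<in>UNIV. \<Sum>j\<in>UNIV. A x $ i $ j *\<^sub>R pderiv_at k (D2 i j) x
      + pderiv_at k (\<lambda>x. A x $ i $ j) x *\<^sub>R D2 i j x)"
    unfolding tension_def[abs_def]
    by (simp add: smooth_map_sum smooth_map_scaleR smooth_A smooth_D smooth_pderiv_sum smooth_pderiv_scaleR)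
  moreover have "pderiv_at k (D2 i j) x = pderiv_at i (D2 j k) x" for i j
  proof -
    have "D2 k j = D2 j k" using D2_commute by blast
    then show ?thesis using pderiv_at_commute[OF smooth_D(1), of k i j x] by simp
  qed
  ultimately show ?thesis
    unfolding L_def by (simp add: pderiv_w sum.distrib D2_commute[of k] algebra_simps)
qed

text \<open>The second derivatives of \<open>x \<bullet> Du\<close> contain those of
  \<open>u\<close> twice, and \<open>- u\<close> removes one copy. The trace of the other copy is
  \<open>tension\<close>, equal to \<open>w / 2\<close>.\<close>

lemma L_w: "L w x = (1/2) *\<^sub>R w x + (\<Sum>k\<in>UNIV. x $ k *\<^sub>R L (D k) x)"
proof -
  have d2: "pderiv_at i (pderiv_at j w) x = D2 j i x + (\<Sum>k\<in>UNIV. x $ k *\<^sub>R pderiv_at i (D2 j k) x)" for i j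
    unfolding pderiv_w
    by (simp add: smooth_map_scaleR smooth_map_coord smooth_D smooth_pderiv_sum smooth_pderiv_scaleR
        pderiv_at_coord sum.distrib sum_kronecker_scaleR)
  have "(\<Sum>i\<in>UNIV. \<Sum>j\<in>UNIV. A x $ i $ j *\<^sub>R pderiv_at i (pderiv_at j w) x)
      = tension x + (\<Sum>i\<in>UNIV. \<Sum>j\<in>UNIV. \<Sum>k\<in>UNIV. x $ k *\<^sub>R A x $ i $ j *\<^sub>R pderiv_at i (D2 j k) x)"
    unfolding d2 tension_def
    by (simp add: D2_commute scaleR_right_distrib sum.distrib scaleR_sum_right mult.commute)
  also have "(\<Sum>i\<in>UNIV. \<Sum>j\<in>UNIV. \<Sum>k\<in>UNIV. x $ k *\<^sub>R A x $ i $ j *\<^sub>R pderiv_at i (D2 j k) x)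
      = (\<Sum>i\<in>UNIV. \<Sum>k\<in>UNIV. \<Sum>j\<in>UNIV. x $ k *\<^sub>R A x $ i $ j *\<^sub>R pderiv_at i (D2 j k) x)"
    by (rule sum.cong[OF refl]) (rule sum.swap)
  also have "\<dots> = (\<Sum>k\<in>UNIV. \<Sum>i\<in>UNIV. \<Sum>j\<in>UNIV. x $ k *\<^sub>R A x $ i $ j *\<^sub>R pderiv_at i (D2 j k) x)"
    by (rule sum.swap)
  also have "\<dots> = (\<Sum>k\<in>UNIV. x $ k *\<^sub>R (\<Sum>i\<in>UNIV. \<Sum>j\<in>UNIV. A x $ i $ j *\<^sub>R pderiv_at i (D2 j k) x))"
    by (simp add: scaleR_sum_right)
  finally have 1: "(\<Sum>i\<in>UNIV. \<Sum>j\<in>UNIV. A x $ i $ j *\<^sub>R pderiv_at i (pderiv_at j w) x) = (1/2) *\<^sub>R w x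
      + (\<Sum>k\<in>UNIV. x $ k *\<^sub>R (\<Sum>i\<in>UNIV. \<Sum>j\<in>UNIV. A x $ i $ j *\<^sub>R pderiv_at i (D2 j k) x))"
    by (simp add: shrinker)
  have 2: "(\<Sum>k\<in>UNIV. x $ k *\<^sub>R pderiv_at k w x) = (\<Sum>k\<in>UNIV. x $ k *\<^sub>R (\<Sum>l\<in>UNIV. x $ l *\<^sub>R D2 l k x))"
    by (simp add: pderiv_w D2_commute)
  have s2: "(\<Sum>k\<in>UNIV. x $ k *\<^sub>R (1/2) *\<^sub>R (\<Sum>l\<in>UNIV. x $ l *\<^sub>R D2 l k x))
      = (1/2) *\<^sub>R (\<Sum>k\<in>UNIV. x $ k *\<^sub>R (\<Sum>l\<in>UNIV. x $ l *\<^sub>R D2 l k x))"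
    by (simp only: scaleR_sum_right[of "1/2"] scaleR_left_commute)
  show ?thesis
    unfolding L_def[of w] 1 2 unfolding L_def scaleR_right_diff_distrib sum_subtractf s2
    by (rule add_diff_eq[symmetric])
qed

section \<open>Derivatives of \<open>q\<close> and the Bochner formula\<close>

definition p :: "'m \<Rightarrow> real^'m \<Rightarrow> real" where "p k x = y x \<bullet> D k x"
definition b :: "real^'m \<Rightarrow> real^'m^'m" where "b x = (\<chi> i j. y x \<bullet> D2 i j x)"

lemma pderiv_w_eq: "pderiv_at i w x = S x (pderiv_at i y x)
    - (\<Sum>k\<in>UNIV. p k x *\<^sub>R D2 i k x) - (\<Sum>k\<in>UNIV. b x $ i $ k *\<^sub>R D k x)"
proof -
  have "w = (\<lambda>x. y x - (\<Sum>k\<in>UNIV. (D k x \<bullet> y x) *\<^sub>R D k x))"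
    using S_y by (auto simp: S_def fun_eq_iff)
  then have "pderiv_at i w x = pderiv_at i (\<lambda>x. y x - (\<Sum>k\<in>UNIV. (D k x \<bullet> y x) *\<^sub>R D k x)) x"
    by simp
  also have "\<dots> = pderiv_at i y x - (\<Sum>k\<in>UNIV. (D k x \<bullet> y x) *\<^sub>R D2 i k x
      + (D k x \<bullet> pderiv_at i y x + D2 i k x \<bullet> y x) *\<^sub>R D k x)"
    by (simp add: smooth_pderiv_diff smooth_map_sum smooth_map_scaleR smooth_map_inner smooth_y smooth_D
        smooth_pderiv_sum smooth_pderiv_scaleR smooth_pderiv_inner)
  finally show ?thesis
    by (simp add: S_def p_def b_def scaleR_left_distrib sum.distrib inner_commute)
qed

lemma S_selfadj: "v \<bullet> S x v' = v' \<bullet> S x v"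
  by (simp add: S_def inner_diff_right inner_sum_right inner_commute mult.commute)

lemma b_sym: "b x $ i $ j = b x $ j $ i"
  by (simp add: b_def D2_commute)

text \<open>The two forms have different purposes. The first involves \<open>S\<close> applied to
  the derivative of \<open>y\<close> and is the one that completes the square. In the second
  \<open>y\<close> is undifferentiated, so differentiating again produces no second derivatives of
  \<open>y\<close>.\<close>

lemma pderiv_q: "pderiv_at i q x = 2 * (y x \<bullet> S x (pderiv_at i y x)) - 2 * (\<Sum>k\<in>UNIV. p k x * b x $ i $ k)"
  and pderiv_q': "pderiv_at i q x = 2 * (y x \<bullet> pderiv_at i w x) + 2 * (\<Sum>k\<in>UNIV. p k x * b x $ i $ k)"
proof -
  have "pderiv_at i q x = y x \<bullet> pderiv_at i w x + pderiv_at i y x \<bullet> w x"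
    unfolding q_def[abs_def] by (simp add: smooth_pderiv_inner smooth_y smooth_w)
  moreover have "pderiv_at i y x \<bullet> w x = y x \<bullet> S x (pderiv_at i y x)"
    unfolding S_y[symmetric] by (rule S_selfadj)
  moreover have "y x \<bullet> pderiv_at i w x = y x \<bullet> S x (pderiv_at i y x) - 2 * (\<Sum>k\<in>UNIV. p k x * b x $ i $ k)"
  proof -
    have "y x \<bullet> D2 i k x = b x $ i $ k" "y x \<bullet> D k x = p k x" for k by (simp_all add: b_def p_def)
    then show ?thesis
      by (simp add: pderiv_w_eq inner_diff_right inner_sum_right mult.commute)
  qed
  ultimately show "pderiv_at i q x = 2 * (y x \<bullet> S x (pderiv_at i y x)) - 2 * (\<Sum>k\<in>UNIV. p k x * b x $ i $ k)"
    and "pderiv_at i q x = 2 * (y x \<bullet> pderiv_at i w x) + 2 * (\<Sum>k\<in>UNIV. p k x * b x $ i $ k)"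
    by simp_all
qed

lemma pderiv2_q: "pderiv_at i (pderiv_at j q) x = 2 * (y x \<bullet> pderiv_at i (pderiv_at j w) x)
    + 2 * (\<Sum>k\<in>UNIV. p k x * (y x \<bullet> pderiv_at i (D2 j k) x))
    + 2 * (\<Sum>k\<in>UNIV. b x $ i $ k * b x $ j $ k)
    + 2 * (pderiv_at i y x \<bullet> S x (pderiv_at j y x))"
proof -
  have "pderiv_at j q = (\<lambda>x. 2 * (y x \<bullet> pderiv_at j w x) + 2 * (\<Sum>k\<in>UNIV. (y x \<bullet> D k x) * (y x \<bullet> D2 j k x)))"
    using pderiv_q'[of j] by (simp add: fun_eq_iff p_def b_def)
  then have "pderiv_at i (pderiv_at j q) x = pderiv_at i (\<lambda>x. 2 * (y x \<bullet> pderiv_at j w x)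
      + 2 * (\<Sum>k\<in>UNIV. (y x \<bullet> D k x) * (y x \<bullet> D2 j k x))) x" by simp
  also have "\<dots> = 2 * (y x \<bullet> pderiv_at i (pderiv_at j w) x + pderiv_at i y x \<bullet> pderiv_at j w x)
      + 2 * (\<Sum>k\<in>UNIV. (y x \<bullet> D k x) * (y x \<bullet> pderiv_at i (D2 j k) x + pderiv_at i y x \<bullet> D2 j k x)
        + (y x \<bullet> D2 i k x + pderiv_at i y x \<bullet> D k x) * (y x \<bullet> D2 j k x))"
    by (simp add: smooth_pderiv_add smooth_map_sum smooth_map_mult smooth_map_inner smooth_map_const
        smooth_y smooth_D smooth_w smooth_map_pderiv_at smooth_pderiv_sum smooth_pderiv_mult
        smooth_pderiv_inner)
  also have "\<dots> = 2 * (y x \<bullet> pderiv_at i (pderiv_at j w) x)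
      + 2 * (\<Sum>k\<in>UNIV. p k x * (y x \<bullet> pderiv_at i (D2 j k) x))
      + 2 * (\<Sum>k\<in>UNIV. b x $ i $ k * b x $ j $ k)
      + 2 * (pderiv_at i y x \<bullet> pderiv_at j w x + (\<Sum>k\<in>UNIV. p k x * (pderiv_at i y x \<bullet> D2 j k x))
        + (\<Sum>k\<in>UNIV. b x $ j $ k * (pderiv_at i y x \<bullet> D k x)))"
    by (simp add: p_def b_def sum.distrib algebra_simps)
  also have "pderiv_at i y x \<bullet> pderiv_at j w x + (\<Sum>k\<in>UNIV. p k x * (pderiv_at i y x \<bullet> D2 j k x))
        + (\<Sum>k\<in>UNIV. b x $ j $ k * (pderiv_at i y x \<bullet> D k x)) = pderiv_at i y x \<bullet> S x (pderiv_at j y x)"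
    by (simp add: pderiv_w_eq inner_diff_right inner_sum_right)
  finally show ?thesis .
qed

lemma trace_A_b: "trace (A x ** b x) = q x / 2"
proof -
  have "trace (A x ** b x) = trace (A x ** transpose (b x))"
    using b_sym[of x] by (simp add: transpose_def vec_eq_iff)
  also have "\<dots> = (\<Sum>i\<in>UNIV. \<Sum>j\<in>UNIV. A x $ i $ j * b x $ i $ j)"
    by (rule sum_mult_eq_trace[symmetric])
  also have "\<dots> = y x \<bullet> tension x"
    by (simp add: tension_def b_def inner_sum_right)
  finally show ?thesis by (simp add: shrinker q_def)
qed

definition M :: "real^'m \<Rightarrow> real^'m^'m" where
  "M x = (\<chi> a c. pderiv_at a w x \<bullet> D c x + (\<Sum>k\<in>UNIV. p k x * (D2 k a x \<bullet> D c x)))"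

text \<open>Both \<open>L w\<close> and the \<open>L (D k)\<close> reduce to derivatives of the
  inverse metric, with total coefficient \<open>x $ k + p k x\<close>. The sum of \<open>N k\<close>
  with these coefficients is \<open>M\<close>, because the derivative of \<open>w\<close> is linear
  in \<open>x\<close>. \<open>M\<close> and its transpose have the same trace here, whence the
  factor 2.\<close>

lemma L_q_aux: "y x \<bullet> L w x + (\<Sum>k\<in>UNIV. p k x * (y x \<bullet> L (D k) x))
    = q x / 2 - 2 * trace (A x ** M x ** A x ** b x)"
proof -
  have LD: "y x \<bullet> L (D k) x = - trace (A x ** (N k x + transpose (N k x)) ** A x ** b x)" for k
  proof -
    have "y x \<bullet> L (D k) x = - (\<Sum>i\<in>UNIV. \<Sum>j\<in>UNIV.
        (A x ** (N k x + transpose (N k x)) ** A x) $ i $ j * b x $ i $ j)"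
      by (simp add: L_D pderiv_A b_def inner_sum_right)
    also have "\<dots> = - trace (A x ** (N k x + transpose (N k x)) ** A x ** transpose (b x))"
      by (simp only: sum_mult_eq_trace)
    also have "transpose (b x) = b x"
      using b_sym[of x] by (simp add: transpose_def vec_eq_iff)
    finally show ?thesis .
  qed
  have scale: "c * trace (A x ** (P + transpose P) ** A x ** b x)
      = trace (A x ** (c *\<^sub>R P + transpose (c *\<^sub>R P)) ** A x ** b x)" for c P
  proof -
    have "c *\<^sub>R P + transpose (c *\<^sub>R P) = c *\<^sub>R (P + transpose P)"
      by (simp add: transpose_def vec_eq_iff algebra_simps)
    then show ?thesis by (simp add: matrix_scalar_ac trace_scaleR flip: scalar_matrix_assoc)
  qed
  have sum: "(\<Sum>k\<in>UNIV. trace (A x ** (P k + transpose (P k)) ** A x ** b x))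
      = trace (A x ** ((\<Sum>k\<in>UNIV. P k) + transpose (\<Sum>k\<in>UNIV. P k)) ** A x ** b x)" for P :: "'m \<Rightarrow> real^'m^'m"
  proof -
    have l: "linear (\<lambda>P. trace (A x ** (P + transpose P) ** A x ** b x))"
    proof (rule linearI)
      show "trace (A x ** (c *\<^sub>R P + transpose (c *\<^sub>R P)) ** A x ** b x)
        = c *\<^sub>R trace (A x ** (P + transpose P) ** A x ** b x)" for c P
        using scale[of c P] by simp
      fix P Q :: "real^'m^'m"
      have "(P + Q) + transpose (P + Q) = (P + transpose P) + (Q + transpose Q)"
        by (simp add: transpose_def vec_eq_iff)
      then show "trace (A x ** (P + Q + transpose (P + Q)) ** A x ** b x)
        = trace (A x ** (P + transpose P) ** A x ** b x) + trace (A x ** (Q + transpose Q) ** A x ** b x)"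
        by (simp only: matrix_add_ldistrib matrix_add_rdistrib trace_add)
    qed
    show ?thesis using linear_sum[OF l, of P UNIV] by simp
  qed
  have Msum: "(\<Sum>k\<in>UNIV. (x $ k + p k x) *\<^sub>R N k x) = M x"
    by (simp add: vec_eq_iff M_def N_def pderiv_w inner_sum_left D2_commute sum.distrib distrib_right)
  have "y x \<bullet> L w x + (\<Sum>k\<in>UNIV. p k x * (y x \<bullet> L (D k) x))
      = q x / 2 + (\<Sum>k\<in>UNIV. (x $ k + p k x) * (y x \<bullet> L (D k) x))"
    by (simp add: L_w q_def inner_add_right inner_sum_right sum.distrib distrib_right)
  also have "(\<Sum>k\<in>UNIV. (x $ k + p k x) * (y x \<bullet> L (D k) x))
      = - (\<Sum>k\<in>UNIV. (x $ k + p k x) * trace (A x ** (N k x + transpose (N k x)) ** A x ** b x))"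
    by (simp only: LD sum_negf mult_minus_right)
  also have "\<dots> = - trace (A x ** (M x + transpose (M x)) ** A x ** b x)"
    by (simp only: scale sum Msum)
  also have "trace (A x ** (M x + transpose (M x)) ** A x ** b x)
      = trace (A x ** M x ** A x ** b x) + trace (A x ** transpose (M x) ** A x ** b x)"
    by (simp only: matrix_add_ldistrib matrix_add_rdistrib trace_add)
  also have "trace (A x ** transpose (M x) ** A x ** b x)
      = trace (transpose (A x ** transpose (M x) ** A x ** b x))" by simp
  also have "transpose (A x ** transpose (M x) ** A x ** b x) = b x ** (A x ** M x ** A x)"
    using b_sym[of x]
    by (simp add: matrix_transpose_mul transpose_transpose transpose_A matrix_mul_assoc)
      (simp add: transpose_def vec_eq_iff)
  also have "trace \<dots> = trace (A x ** M x ** A x ** b x)"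
    by (rule trace_mul_sym)
  finally show ?thesis by simp
qed

lemma L_q: "L q x = q x - 4 * trace (A x ** M x ** A x ** b x) + 2 * trace (A x ** b x ** b x)
    + 2 * (\<Sum>i\<in>UNIV. \<Sum>j\<in>UNIV. A x $ i $ j * (pderiv_at i y x \<bullet> S x (pderiv_at j y x)))"
proof -
  have 1: "(\<Sum>i\<in>UNIV. \<Sum>j\<in>UNIV. A x $ i $ j * pderiv_at i (pderiv_at j q) x)
      = 2 * (y x \<bullet> (\<Sum>i\<in>UNIV. \<Sum>j\<in>UNIV. A x $ i $ j *\<^sub>R pderiv_at i (pderiv_at j w) x))
      + 2 * (\<Sum>k\<in>UNIV. p k x * (y x \<bullet> (\<Sum>i\<in>UNIV. \<Sum>j\<in>UNIV. A x $ i $ j *\<^sub>R pderiv_at i (D2 j k) x)))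
      + 2 * (\<Sum>i\<in>UNIV. \<Sum>j\<in>UNIV. A x $ i $ j * (\<Sum>k\<in>UNIV. b x $ i $ k * b x $ j $ k))
      + 2 * (\<Sum>i\<in>UNIV. \<Sum>j\<in>UNIV. A x $ i $ j * (pderiv_at i y x \<bullet> S x (pderiv_at j y x)))"
  proof -
    have "(\<Sum>k\<in>UNIV. p k x * (y x \<bullet> (\<Sum>i\<in>UNIV. \<Sum>j\<in>UNIV. A x $ i $ j *\<^sub>R pderiv_at i (D2 j k) x)))
        = (\<Sum>k\<in>UNIV. \<Sum>i\<in>UNIV. \<Sum>j\<in>UNIV. p k x * (A x $ i $ j * (y x \<bullet> pderiv_at i (D2 j k) x)))"
      by (simp add: inner_sum_right sum_distrib_left)
    also have "\<dots> = (\<Sum>i\<in>UNIV. \<Sum>k\<in>UNIV. \<Sum>j\<in>UNIV. p k x * (A x $ i $ j * (y x \<bullet> pderiv_at i (D2 j k) x)))"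
      by (rule sum.swap)
    also have "\<dots> = (\<Sum>i\<in>UNIV. \<Sum>j\<in>UNIV. \<Sum>k\<in>UNIV. p k x * (A x $ i $ j * (y x \<bullet> pderiv_at i (D2 j k) x)))"
      by (rule sum.cong[OF refl]) (rule sum.swap)
    also have "\<dots> = (\<Sum>i\<in>UNIV. \<Sum>j\<in>UNIV. A x $ i $ j * (\<Sum>k\<in>UNIV. p k x * (y x \<bullet> pderiv_at i (D2 j k) x)))"
      by (simp add: sum_distrib_left mult.left_commute)
    finally have e: "(\<Sum>k\<in>UNIV. p k x * (y x \<bullet> (\<Sum>i\<in>UNIV. \<Sum>j\<in>UNIV. A x $ i $ j *\<^sub>R pderiv_at i (D2 j k) x)))
        = (\<Sum>i\<in>UNIV. \<Sum>j\<in>UNIV. A x $ i $ j * (\<Sum>k\<in>UNIV. p k x * (y x \<bullet> pderiv_at i (D2 j k) x)))" .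
    have e': "y x \<bullet> (\<Sum>i\<in>UNIV. \<Sum>j\<in>UNIV. A x $ i $ j *\<^sub>R pderiv_at i (pderiv_at j w) x)
        = (\<Sum>i\<in>UNIV. \<Sum>j\<in>UNIV. A x $ i $ j * (y x \<bullet> pderiv_at i (pderiv_at j w) x))"
      by (simp add: inner_sum_right)
    show ?thesis
      unfolding e e' pderiv2_q distrib_left sum.distrib mult.left_commute[of _ 2] sum_distrib_left[of 2, symmetric]
      by (rule refl)
  qed
  have 2: "(\<Sum>k\<in>UNIV. x $ k * pderiv_at k q x) = 2 * (y x \<bullet> (\<Sum>k\<in>UNIV. x $ k *\<^sub>R pderiv_at k w x))
      + 2 * (\<Sum>k\<in>UNIV. p k x * (y x \<bullet> (\<Sum>l\<in>UNIV. x $ l *\<^sub>R D2 l k x)))"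
  proof -
    have "(\<Sum>k\<in>UNIV. p k x * (y x \<bullet> (\<Sum>l\<in>UNIV. x $ l *\<^sub>R D2 l k x)))
        = (\<Sum>k\<in>UNIV. \<Sum>l\<in>UNIV. x $ l * (p k x * b x $ l $ k))"
      by (simp add: inner_sum_right sum_distrib_left b_def mult_ac)
    also have "\<dots> = (\<Sum>l\<in>UNIV. x $ l * (\<Sum>k\<in>UNIV. p k x * b x $ l $ k))"
      by (subst sum.swap) (simp add: sum_distrib_left)
    finally show ?thesis
      by (simp add: pderiv_q' inner_sum_right distrib_left sum.distrib sum_distrib_left mult_ac)
  qed
  have 3: "(\<Sum>i\<in>UNIV. \<Sum>j\<in>UNIV. A x $ i $ j * (\<Sum>k\<in>UNIV. b x $ i $ k * b x $ j $ k)) = trace (A x ** b x ** b x)"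
  proof -
    have bb: "(\<Sum>k\<in>UNIV. b x $ i $ k * b x $ j $ k) = (b x ** b x) $ i $ j" for i j
      using b_sym[of x j] by (simp add: matrix_matrix_mult_def)
    have "transpose (b x ** b x) = b x ** b x"
      using b_sym[of x] by (simp add: matrix_transpose_mul) (simp add: transpose_def vec_eq_iff)
    then show ?thesis by (simp add: bb sum_mult_eq_trace matrix_mul_assoc)
  qed
  have "L q x = 2 * (y x \<bullet> L w x + (\<Sum>k\<in>UNIV. p k x * (y x \<bullet> L (D k) x))) + 2 * trace (A x ** b x ** b x)
      + 2 * (\<Sum>i\<in>UNIV. \<Sum>j\<in>UNIV. A x $ i $ j * (pderiv_at i y x \<bullet> S x (pderiv_at j y x)))"
  proof -
    have "y x \<bullet> L w x = y x \<bullet> (\<Sum>i\<in>UNIV. \<Sum>j\<in>UNIV. A x $ i $ j *\<^sub>R pderiv_at i (pderiv_at j w) x)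
        - (y x \<bullet> (\<Sum>k\<in>UNIV. x $ k *\<^sub>R pderiv_at k w x)) / 2"
      unfolding L_def by (simp add: inner_diff_right)
    moreover have "(\<Sum>k\<in>UNIV. p k x * (y x \<bullet> L (D k) x))
        = (\<Sum>k\<in>UNIV. p k x * (y x \<bullet> (\<Sum>i\<in>UNIV. \<Sum>j\<in>UNIV. A x $ i $ j *\<^sub>R pderiv_at i (D2 j k) x)))
        - (\<Sum>k\<in>UNIV. p k x * (y x \<bullet> (\<Sum>l\<in>UNIV. x $ l *\<^sub>R D2 l k x))) / 2"
      unfolding L_def sum_divide_distrib sum_subtractf[symmetric]
      by (rule sum.cong) (simp_all add: inner_diff_right algebra_simps)
    ultimately show ?thesis
      unfolding L_def[of q] real_scaleR_def 1 2 3 by (simp add: field_simps)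
  qed
  then show ?thesis unfolding L_q_aux by simp
qed

lemma L_q_ge:
  "L q x + 2 * \<tau> * grad_inner f q x
    \<ge> q x + (q x)\<^sup>2 / (2 * real CARD('m)) - 2 * \<tau>\<^sup>2 * q x * grad_inner f f x"
proof -
  obtain E :: "real^'m^'m" where E: "A x = E ** transpose E" using A_factor by blast
  interpret P: pointwise_frame "\<lambda>k. D k x" "\<lambda>i j. D2 i j x" "y x" "\<lambda>i. pderiv_at i y x"
    "\<lambda>i. pderiv_at i w x" "A x" E "S x" "G x" "b x" "\<lambda>k. p k x" "q x"
  proof
    show "pderiv_at a w x = S x (pderiv_at a y x) - (\<Sum>j\<in>UNIV. p j x *\<^sub>R D2 j a x)
        - (\<Sum>j\<in>UNIV. b x $ j $ a *\<^sub>R D j x)" for a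
      unfolding pderiv_w_eq by (simp add: D2_commute[of a] b_sym[of x a])
  qed (rule S_def G_def b_def p_def q_eq D2_commute AG E S_nonneg trace_A_b)+
  show ?thesis
    unfolding grad_inner_def
    by (rule P.Bochner_inequality)
      (simp_all add: L_q pderiv_q P.M_def M_def P.form_def)
qed

end

section \<open>The function \<open>z\<close> and the symmetry of \<open>L\<close> with respect to
  \<open>rho\<close>\<close>

context shrinker_graph
begin

lemma pderiv_z: "pderiv_at i z x = 2 * ((\<Sum>k\<in>UNIV. G x $ i $ k * x $ k) + w x \<bullet> D i x)"
proof -
  have xx: "pderiv_at i (\<lambda>x::real^'m. x) x = axis i 1" for x
    by (simp add: pderiv_at_def)
  have "pderiv_at i z x = 2 * (x $ i - u x \<bullet> D i x)"
    unfolding z_def[abs_def]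
    by (simp add: smooth_pderiv_diff smooth_map_inner smooth_map_ident smooth_u smooth_pderiv_inner xx
        inner_axis inner_axis' inner_commute)
  moreover have "(\<Sum>k\<in>UNIV. G x $ i $ k * x $ k) = x $ i - (\<Sum>k\<in>UNIV. x $ k *\<^sub>R D k x) \<bullet> D i x"
  proof -
    have "(\<Sum>k\<in>UNIV. G x $ i $ k * x $ k) = (\<Sum>k\<in>UNIV. (if i = k then 1 else 0) * x $ k)
        - (\<Sum>k\<in>UNIV. x $ k * (D k x \<bullet> D i x))"
      unfolding sum_subtractf[symmetric] G_def
      by (rule sum.cong) (simp_all add: algebra_simps inner_commute)
    then show ?thesis by (simp add: inner_sum_left sum_kronecker_mult)
  qed
  ultimately show ?thesis by (simp add: w_def inner_diff_left)
qed

lemma pderiv_z': "pderiv_at i z x = 2 * (x $ i - u x \<bullet> D i x)"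
proof -
  have "pderiv_at i (\<lambda>x::real^'m. x) x = axis i 1" for x
    by (simp add: pderiv_at_def)
  then show ?thesis
    unfolding z_def[abs_def]
    by (simp add: smooth_pderiv_diff smooth_map_inner smooth_map_ident smooth_u smooth_pderiv_inner
        inner_axis inner_axis' inner_commute)
qed

lemma sum_x_D: "(\<Sum>k\<in>UNIV. x $ k *\<^sub>R D k x) = w x + u x"
  by (simp add: w_def)

text \<open>The trace of \<open>A G\<close> gives \<open>m\<close>. The part with second derivatives
  of \<open>u\<close> becomes \<open>- u \<bullet> w\<close> by the shrinker equation and cancels
  against the same expression in the drift term.\<close>

lemma L_z: "L z x = 2 * real CARD('m) - z x"
proof -
  have pz: "pderiv_at j z = (\<lambda>x. 2 * (x $ j - u x \<bullet> D j x))" for j using pderiv_z' by blast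
  have z2: "pderiv_at i (pderiv_at j z) x = 2 * G x $ i $ j - 2 * (u x \<bullet> D2 i j x)" for i j
  proof -
    have "pderiv_at i (pderiv_at j z) x = 2 * ((if i = j then 1 else 0) - (u x \<bullet> D2 i j x + D i x \<bullet> D j x))"
      unfolding pz
      by (simp only: smooth_pderiv_mult smooth_map_const smooth_map_diff smooth_map_coord smooth_map_inner
        smooth_u smooth_D smooth_pderiv_diff pderiv_at_coord smooth_pderiv_inner) simp
    then show ?thesis by (simp add: G_def)
  qed
  have "(\<Sum>i\<in>UNIV. \<Sum>j\<in>UNIV. A x $ i $ j * pderiv_at i (pderiv_at j z) x)
      = 2 * (\<Sum>i\<in>UNIV. \<Sum>j\<in>UNIV. A x $ i $ j * G x $ j $ i) - 2 * (u x \<bullet> tension x)"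
    unfolding z2 tension_def
    by (simp add: right_diff_distrib sum_subtractf inner_sum_right sum_distrib_left mult.left_commute G_sym)
  also have "\<dots> = 2 * real CARD('m) - u x \<bullet> w x"
    by (simp add: sum_A_G shrinker)
  finally have 1: "(\<Sum>i\<in>UNIV. \<Sum>j\<in>UNIV. A x $ i $ j * pderiv_at i (pderiv_at j z) x)
      = 2 * real CARD('m) - u x \<bullet> w x" .
  have "(\<Sum>k\<in>UNIV. x $ k * pderiv_at k z x) = 2 * (x \<bullet> x - u x \<bullet> (\<Sum>k\<in>UNIV. x $ k *\<^sub>R D k x))"
    by (simp add: pderiv_z' inner_vec_def[of x] inner_sum_right sum_distrib_left sum_subtractf algebra_simps)
  also have "\<dots> = 2 * (z x - u x \<bullet> w x)"
    by (simp add: sum_x_D z_def inner_add_right)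
  finally show ?thesis unfolding L_def real_scaleR_def 1 by (simp add: field_simps)
qed

lemma A_pderiv_z:
  "(\<Sum>j\<in>UNIV. A x $ i $ j * pderiv_at j z x) = 2 * (x $ i + (\<Sum>j\<in>UNIV. A x $ i $ j * (w x \<bullet> D j x)))"
proof -
  have "(\<Sum>j\<in>UNIV. A x $ i $ j * (\<Sum>k\<in>UNIV. G x $ j $ k * x $ k))
      = (\<Sum>j\<in>UNIV. \<Sum>k\<in>UNIV. A x $ i $ j * G x $ j $ k * x $ k)"
    by (simp add: sum_distrib_left mult.assoc)
  also have "\<dots> = (\<Sum>k\<in>UNIV. (\<Sum>j\<in>UNIV. A x $ i $ j * G x $ j $ k) * x $ k)"
    by (subst sum.swap) (simp add: sum_distrib_right)
  also have "\<dots> = x $ i" by (simp add: sum_A_G sum_kronecker_mult)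
  finally show ?thesis
    by (simp add: pderiv_z distrib_left sum.distrib mult.left_commute flip: sum_distrib_left)
qed

text \<open>The gradient of \<open>z\<close> is \<open>2 X\<^sup>T\<close>. The normal bundle is
  negative definite, so \<open>X\<^sup>N\<close> has squared length \<open>- q\<close> and
  \<open>X\<^sup>T\<close> has squared length \<open>z + q\<close>.\<close>

lemma grad_z: "grad_inner z z x = 4 * (z x + q x)"
proof -
  have q: "q x = w x \<bullet> w x + (\<Sum>i\<in>UNIV. \<Sum>j\<in>UNIV. A x $ i $ j * (w x \<bullet> D i x) * (w x \<bullet> D j x))"
    unfolding q_def y_def Sinv_def inner_add_left inner_sum_left inner_scaleR_left
    by (simp add: inner_commute mult_ac)
  have "grad_inner z z x = (\<Sum>i\<in>UNIV. pderiv_at i z x * (\<Sum>j\<in>UNIV. A x $ i $ j * pderiv_at j z x))"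
    by (simp add: grad_inner_def sum_distrib_left mult_ac)
  also have "\<dots> = 2 * (\<Sum>i\<in>UNIV. pderiv_at i z x * x $ i)
      + 2 * (\<Sum>i\<in>UNIV. \<Sum>j\<in>UNIV. pderiv_at i z x * (A x $ i $ j * (w x \<bullet> D j x)))"
    unfolding A_pderiv_z by (simp add: distrib_left sum.distrib sum_distrib_left mult_ac)
  also have "(\<Sum>i\<in>UNIV. \<Sum>j\<in>UNIV. pderiv_at i z x * (A x $ i $ j * (w x \<bullet> D j x)))
      = (\<Sum>j\<in>UNIV. (\<Sum>i\<in>UNIV. A x $ j $ i * pderiv_at i z x) * (w x \<bullet> D j x))"
    by (subst sum.swap) (simp add: sum_distrib_left sum_distrib_right A_sym[of x] mult_ac)
  also have "\<dots> = 2 * (\<Sum>j\<in>UNIV. x $ j * (w x \<bullet> D j x))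
      + 2 * (\<Sum>i\<in>UNIV. \<Sum>j\<in>UNIV. A x $ i $ j * (w x \<bullet> D i x) * (w x \<bullet> D j x))"
    unfolding A_pderiv_z
    by (simp add: distrib_left distrib_right sum.distrib sum_distrib_left mult_ac)
  also have "(\<Sum>j\<in>UNIV. x $ j * (w x \<bullet> D j x)) = w x \<bullet> (w x + u x)"
    by (simp add: inner_sum_right flip: sum_x_D)
  also have "(\<Sum>i\<in>UNIV. pderiv_at i z x * x $ i) = 2 * (x \<bullet> x - u x \<bullet> (w x + u x))"
    unfolding sum_x_D[symmetric]
    by (simp add: pderiv_z' inner_vec_def[of x] inner_sum_right sum_distrib_left sum_subtractf algebra_simps)
  finally show ?thesis
    unfolding q by (simp add: z_def[of x] inner_add_right inner_commute algebra_simps)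
qed

lemma pderiv_rho:
  "pderiv_at k rho x = - rho x * ((\<Sum>i\<in>UNIV. \<Sum>j\<in>UNIV. A x $ i $ j * N k x $ i $ j) + pderiv_at k z x / 4)"
proof -
  have dd: "(\<lambda>x. det (G x)) differentiable (at x)" "z differentiable (at x)"
    by (intro smooth_map_differentiable smooth_map_det smooth_G smooth_z)+
  have "pderiv_at k (\<lambda>x. det (G x)) x
      = det (G x) * (\<Sum>i\<in>UNIV. \<Sum>j\<in>UNIV. pderiv_at k (\<lambda>x. G x $ i $ j) x * A x $ j $ i)"
    by (rule pderiv_at_det[OF smooth_map_differentiable[OF smooth_G] AG])
  also have "(\<Sum>i\<in>UNIV. \<Sum>j\<in>UNIV. pderiv_at k (\<lambda>x. G x $ i $ j) x * A x $ j $ i)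
      = - (\<Sum>i\<in>UNIV. \<Sum>j\<in>UNIV. A x $ i $ j * N k x $ i $ j) - (\<Sum>i\<in>UNIV. \<Sum>j\<in>UNIV. A x $ j $ i * N k x $ j $ i)"
    by (simp add: pderiv_G A_sym[of x] algebra_simps sum.distrib sum_subtractf sum_negf)
  also have "(\<Sum>i\<in>UNIV. \<Sum>j\<in>UNIV. A x $ j $ i * N k x $ j $ i) = (\<Sum>i\<in>UNIV. \<Sum>j\<in>UNIV. A x $ i $ j * N k x $ i $ j)"
    by (rule sum.swap)
  finally have det: "pderiv_at k (\<lambda>x. det (G x)) x
      = - (2 * det (G x) * (\<Sum>i\<in>UNIV. \<Sum>j\<in>UNIV. A x $ i $ j * N k x $ i $ j))" by simp
  have "pderiv_at k (\<lambda>x. sqrt (det (G x))) x = (inverse (sqrt (det (G x))) / 2) * pderiv_at k (\<lambda>x. det (G x)) x"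
    by (rule pderiv_at_compose_real(1)[OF dd(1) DERIV_real_sqrt[OF det_G_pos]])
  also have "\<dots> = - (sqrt (det (G x)) * (\<Sum>i\<in>UNIV. \<Sum>j\<in>UNIV. A x $ i $ j * N k x $ i $ j))"
  proof -
    have "inverse (sqrt (det (G x))) * det (G x) = sqrt (det (G x))"
      using det_G_pos[of x] by (metis inverse_eq_divide mult.commute order_less_imp_le real_div_sqrt times_divide_eq_right mult.right_neutral)
    then show ?thesis unfolding det by (simp add: algebra_simps)
  qed
  finally have s: "pderiv_at k (\<lambda>x. sqrt (det (G x))) x
      = - (sqrt (det (G x)) * (\<Sum>i\<in>UNIV. \<Sum>j\<in>UNIV. A x $ i $ j * N k x $ i $ j))" .
  have e: "pderiv_at k (\<lambda>x. exp (- (1/4) * z x)) x = - (exp (- (1/4) * z x) * (pderiv_at k z x / 4))"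
  proof -
    have "((\<lambda>t. exp (- (1/4) * t)) has_real_derivative exp (- (1/4) * z x) * (- (1/4))) (at (z x))"
      by (auto intro!: derivative_eq_intros)
    from pderiv_at_compose_real(1)[OF dd(2) this, of k] show ?thesis by (simp add: mult_ac)
  qed
  have sm: "smooth_map (\<lambda>x. sqrt (det (G x)))" "smooth_map (\<lambda>x. exp (- (1/4) * z x))"
    by (intro smooth_map_sqrt smooth_map_det smooth_G det_G_pos smooth_map_exp smooth_map_mult
        smooth_map_const smooth_z)+
  have "pderiv_at k rho x = sqrt (det (G x)) * pderiv_at k (\<lambda>x. exp (- (1/4) * z x)) x
      + pderiv_at k (\<lambda>x. sqrt (det (G x))) x * exp (- (1/4) * z x)"
    unfolding rho_def[abs_def] smooth_pderiv_mult[OF sm] by simp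
  then show ?thesis unfolding s e rho_def by (simp add: algebra_simps)
qed

text \<open>This identity makes \<open>L\<close> symmetric. One part of the derivative of
  \<open>A\<close> cancels the derivative of \<open>sqrt (det G)\<close>. The other contains
  \<open>tension\<close>, and by the shrinker equation it cancels all of the derivative of
  \<open>exp (- z / 4)\<close> except the drift.\<close>

lemma divergence_rho_A:
  "(\<Sum>i\<in>UNIV. pderiv_at i (\<lambda>x. rho x * A x $ i $ j) x) = - (1/2) * rho x * x $ j"
proof -
  have A': "pderiv_at i (\<lambda>x. A x $ i $ j) x = (\<Sum>c\<in>UNIV. \<Sum>a\<in>UNIV. A x $ i $ a * N i x $ a $ c * A x $ c $ j)
      + (\<Sum>c\<in>UNIV. \<Sum>a\<in>UNIV. A x $ i $ a * N i x $ c $ a * A x $ c $ j)" for i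
    by (simp add: pderiv_A matrix_matrix_mult_def transpose_def sum_distrib_right distrib_left
        distrib_right sum.distrib)
  have 1: "(\<Sum>i\<in>UNIV. \<Sum>c\<in>UNIV. \<Sum>a\<in>UNIV. A x $ i $ a * N i x $ a $ c * A x $ c $ j)
      = (\<Sum>c\<in>UNIV. A x $ c $ j * (tension x \<bullet> D c x))"
  proof -
    have "(\<Sum>i\<in>UNIV. \<Sum>c\<in>UNIV. \<Sum>a\<in>UNIV. A x $ i $ a * N i x $ a $ c * A x $ c $ j)
        = (\<Sum>c\<in>UNIV. \<Sum>i\<in>UNIV. \<Sum>a\<in>UNIV. A x $ i $ a * N i x $ a $ c * A x $ c $ j)"
      by (rule sum.swap)
    then show ?thesis
      by (simp add: tension_def inner_sum_left sum_distrib_left N_def mult_ac)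
  qed
  have 2: "(\<Sum>i\<in>UNIV. \<Sum>c\<in>UNIV. \<Sum>a\<in>UNIV. A x $ i $ a * N i x $ c $ a * A x $ c $ j)
      = (\<Sum>c\<in>UNIV. A x $ c $ j * (\<Sum>i\<in>UNIV. \<Sum>a\<in>UNIV. A x $ i $ a * N c x $ i $ a))"
  proof -
    have N: "N i x $ c $ a = N c x $ i $ a" for i c a by (simp add: N_def D2_commute)
    have "(\<Sum>i\<in>UNIV. \<Sum>c\<in>UNIV. \<Sum>a\<in>UNIV. A x $ i $ a * N i x $ c $ a * A x $ c $ j)
        = (\<Sum>c\<in>UNIV. \<Sum>i\<in>UNIV. \<Sum>a\<in>UNIV. A x $ i $ a * N i x $ c $ a * A x $ c $ j)"
      by (rule sum.swap)
    also have "\<dots> = (\<Sum>c\<in>UNIV. \<Sum>i\<in>UNIV. \<Sum>a\<in>UNIV. A x $ i $ a * N c x $ i $ a * A x $ c $ j)"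
      by (simp only: N)
    finally show ?thesis by (simp add: sum_distrib_left mult_ac)
  qed
  have "(\<Sum>i\<in>UNIV. pderiv_at i (\<lambda>x. rho x * A x $ i $ j) x)
      = (\<Sum>i\<in>UNIV. rho x * pderiv_at i (\<lambda>x. A x $ i $ j) x + pderiv_at i rho x * A x $ i $ j)"
    by (simp add: smooth_pderiv_mult smooth_rho smooth_A)
  also have "\<dots> = rho x * (\<Sum>i\<in>UNIV. pderiv_at i (\<lambda>x. A x $ i $ j) x)
      - rho x * (\<Sum>c\<in>UNIV. A x $ c $ j * (\<Sum>i\<in>UNIV. \<Sum>a\<in>UNIV. A x $ i $ a * N c x $ i $ a))
      - rho x * (\<Sum>c\<in>UNIV. A x $ c $ j * pderiv_at c z x) / 4"
    by (simp add: pderiv_rho sum.distrib sum_subtractf sum_negf algebra_simps sum_distrib_left sum_divide_distrib)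
  also have "(\<Sum>i\<in>UNIV. pderiv_at i (\<lambda>x. A x $ i $ j) x) = (\<Sum>c\<in>UNIV. A x $ c $ j * (tension x \<bullet> D c x))
      + (\<Sum>c\<in>UNIV. A x $ c $ j * (\<Sum>i\<in>UNIV. \<Sum>a\<in>UNIV. A x $ i $ a * N c x $ i $ a))"
    unfolding A' sum.distrib 1 2 ..
  also have "(\<Sum>c\<in>UNIV. A x $ c $ j * (tension x \<bullet> D c x)) = (\<Sum>c\<in>UNIV. A x $ j $ c * (w x \<bullet> D c x)) / 2"
    by (simp add: shrinker sum_divide_distrib A_sym[of x j])
  also have "(\<Sum>c\<in>UNIV. A x $ c $ j * pderiv_at c z x) = 2 * (x $ j + (\<Sum>c\<in>UNIV. A x $ j $ c * (w x \<bullet> D c x)))"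
    unfolding A_pderiv_z[symmetric] by (simp add: A_sym[of x j])
  finally show ?thesis by (simp add: field_simps)
qed

definition flux :: "(real^'m \<Rightarrow> real) \<Rightarrow> 'm \<Rightarrow> real^'m \<Rightarrow> real" where
  "flux f i x = (\<Sum>j\<in>UNIV. (rho x * A x $ i $ j) * pderiv_at j f x)"

lemma smooth_flux: "smooth_map f \<Longrightarrow> smooth_map (flux f i)"
  unfolding flux_def[abs_def]
  by (intro smooth_map_sum smooth_map_mult smooth_rho smooth_A smooth_map_pderiv_at)

lemma divergence_flux:
  assumes "smooth_map f"
  shows "(\<Sum>i\<in>UNIV. pderiv_at i (flux f i) x) = rho x * L f x"
proof -
  have "(\<Sum>i\<in>UNIV. pderiv_at i (flux f i) x)
      = (\<Sum>i\<in>UNIV. \<Sum>j\<in>UNIV. (rho x * A x $ i $ j) * pderiv_at i (pderiv_at j f) x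
        + pderiv_at i (\<lambda>x. rho x * A x $ i $ j) x * pderiv_at j f x)"
  proof (rule sum.cong[OF refl])
    fix i
    have sm: "smooth_map (\<lambda>x. rho x * A x $ i $ j)" "smooth_map (pderiv_at j f)" for j
      by (intro smooth_map_mult smooth_rho smooth_A smooth_map_pderiv_at assms)+
    show "pderiv_at i (flux f i) x = (\<Sum>j\<in>UNIV. (rho x * A x $ i $ j) * pderiv_at i (pderiv_at j f) x
        + pderiv_at i (\<lambda>x. rho x * A x $ i $ j) x * pderiv_at j f x)"
      unfolding flux_def[abs_def]
      by (simp only: smooth_pderiv_sum[OF smooth_map_mult[OF sm]] smooth_pderiv_mult[OF sm])
  qed
  also have "\<dots> = (\<Sum>i\<in>UNIV. \<Sum>j\<in>UNIV. (rho x * A x $ i $ j) * pderiv_at i (pderiv_at j f) x)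
      + (\<Sum>j\<in>UNIV. (\<Sum>i\<in>UNIV. pderiv_at i (\<lambda>x. rho x * A x $ i $ j) x) * pderiv_at j f x)"
    unfolding sum.distrib sum_distrib_right
    by (subst (3) sum.swap) (rule refl)
  also have "\<dots> = rho x * L f x"
    unfolding divergence_rho_A
    by (simp add: L_def right_diff_distrib sum_distrib_left sum_negf mult_ac)
  finally show ?thesis .
qed

lemma sum_pderiv_z_flux: "(\<Sum>i\<in>UNIV. pderiv_at i z x * flux f i x) = rho x * grad_inner z f x"
  by (simp add: flux_def grad_inner_def sum_distrib_left mult_ac)

end

section \<open>Integration over sublevel sets\<close>

text \<open>Squared positive parts are continuously differentiable, as a cutoff must be for one
  integration by parts.\<close>

lemma has_real_derivative_pos_part_square:
  "((\<lambda>s::real. (max 0 s)\<^sup>2) has_real_derivative 2 * max 0 s) (at s)"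
proof -
  consider "s > 0" | "s < 0" | "s = 0" by linarith
  then show ?thesis
  proof cases
    case 1
    have "((\<lambda>s::real. s\<^sup>2) has_real_derivative 2 * max 0 s) (at s)"
      using 1 by (auto intro!: derivative_eq_intros)
    then show ?thesis
      by (rule has_field_derivative_transform_within_open[of _ _ _ "{0<..}"]) (use 1 in auto)
  next
    case 2
    have "((\<lambda>s::real. 0) has_real_derivative 2 * max 0 s) (at s)"
      using 2 by simp
    then show ?thesis
      by (rule has_field_derivative_transform_within_open[of _ _ _ "{..<0}"]) (use 2 in auto)
  next
    case 3
    have "((\<lambda>h::real. (max 0 h)\<^sup>2 / h) \<longlongrightarrow> 0) (at 0)"
    proof (rule Lim_null_comparison[OF always_eventually])
      show "\<forall>h::real. norm ((max 0 h)\<^sup>2 / h) \<le> \<bar>h\<bar>"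
        by (auto simp: max_def power2_eq_square)
      show "((\<lambda>h::real. \<bar>h\<bar>) \<longlongrightarrow> 0) (at 0)"
        by (rule tendsto_rabs_zero) (rule tendsto_ident_at)
    qed
    then show ?thesis using 3 by (simp add: DERIV_def)
  qed
qed

locale shrinker_graph_origin = shrinker_graph u for u :: "real^'m \<Rightarrow> real^'n" +
  assumes u_0: "u 0 = 0"
begin

lemma norm_u_diff_le: "norm (u v - u v') \<le> norm (v - v')"
proof -
  have "onorm (du x) \<le> 1" for x
  proof (rule onorm_le)
    show "norm (du x v) \<le> 1 * norm v" for v
      using norm_du_less[of v x] linear_0[OF linear_du[of x]] by (cases "v = 0") auto
  qed
  then have "norm (u v - u v') \<le> 1 * norm (v - v')"
    by (intro differentiable_bound[where S = UNIV and f' = du])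
      (auto intro: has_derivative_u)
  then show ?thesis by simp
qed

lemma norm_u_le: "norm (u x) \<le> norm x"
  using norm_u_diff_le[of x 0] by (simp add: u_0)

text \<open>The Lipschitz bound alone gives only \<le>. Strictness comes from the mean value theorem
  for \<open>e \<bullet> u\<close> on the segment from the origin: at the intermediate point
  \<open>du\<close> contracts strictly.\<close>

lemma norm_u_less_1:
  assumes "norm x = 1" shows "norm (u x) < 1"
proof (cases "u x = 0")
  case False
  define e where "e = sgn (u x)"
  have e: "norm e = 1" "e \<bullet> u x = norm (u x)"
    using False by (auto simp: e_def norm_sgn sgn_div_norm power2_norm_eq_inner[symmetric] power2_eq_square)
  have "((\<lambda>s. e \<bullet> u (s *\<^sub>R x)) has_real_derivative e \<bullet> du (s *\<^sub>R x) x) (at s)" for s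
  proof -
    have "((\<lambda>s. s *\<^sub>R x) has_derivative (\<lambda>h. h *\<^sub>R x)) (at s)"
      by (auto intro!: derivative_eq_intros)
    from has_derivative_compose[OF this has_derivative_u]
    have "((\<lambda>s. e \<bullet> u (s *\<^sub>R x)) has_derivative (\<lambda>h. e \<bullet> du (s *\<^sub>R x) (h *\<^sub>R x))) (at s)"
      by (rule has_derivative_inner_right)
    moreover have "(\<lambda>h. e \<bullet> du (s *\<^sub>R x) (h *\<^sub>R x)) = (*) (e \<bullet> du (s *\<^sub>R x) x)"
      by (rule ext) (simp add: linear_cmul[OF linear_du] mult.commute)
    ultimately show ?thesis by (simp add: has_field_derivative_def)
  qed
  from MVT2[OF zero_less_one, of "\<lambda>s. e \<bullet> u (s *\<^sub>R x)", OF this]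
  obtain s where "e \<bullet> u x = e \<bullet> du (s *\<^sub>R x) x" by (auto simp: u_0)
  then have "norm (u x) = e \<bullet> du (s *\<^sub>R x) x" using e by simp
  also have "\<dots> \<le> norm (du (s *\<^sub>R x) x)" using norm_cauchy_schwarz[of e "du (s *\<^sub>R x) x"] e by simp
  also have "\<dots> < norm x" using assms by (intro norm_du_less) auto
  finally show ?thesis using assms by simp
qed simp

lemma z_eq: "z x = (norm x - norm (u x)) * (norm x + norm (u x))"
  by (simp add: z_def power2_norm_eq_inner[symmetric] power2_eq_square algebra_simps)

lemma z_nonneg: "z x \<ge> 0"
  unfolding z_eq using norm_u_le by (intro mult_nonneg_nonneg) auto

text \<open>Along rays from the origin \<open>norm x - norm (u x)\<close> is nondecreasing and it is positive on the
  unit sphere, so \<open>z\<close> is proper although the induced metric may be incomplete.\<close>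

lemma z_linear_growth: "\<exists>d>0. \<forall>x. norm x \<ge> 1 \<longrightarrow> d * norm x \<le> z x"
proof -
  have "continuous_on (sphere (0::real^'m) 1) (\<lambda>x. norm (u x))"
    using smooth_map_continuous_on[OF smooth_u] by (rule continuous_on_norm)
  moreover have "axis undefined (1::real) \<in> sphere (0::real^'m) 1" by simp
  then have "sphere (0::real^'m) 1 \<noteq> {}" by blast
  ultimately obtain x0 where x0: "x0 \<in> sphere (0::real^'m) 1"
      "\<And>x. x \<in> sphere 0 1 \<Longrightarrow> norm (u x) \<le> norm (u x0)"
    using continuous_attains_sup[OF compact_sphere, of "0::real^'m" 1 "\<lambda>x. norm (u x)"] by blast
  define d where "d = 1 - norm (u x0)"
  have "d > 0" using norm_u_less_1[of x0] x0 by (simp add: d_def)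
  moreover have "d * norm x \<le> z x" if x: "norm x \<ge> 1" for x
  proof -
    define v where "v = sgn x"
    have v: "norm v = 1" using x by (simp add: v_def norm_sgn) auto
    have xv: "x - v = (1 - 1 / norm x) *\<^sub>R x"
      using x by (simp add: v_def sgn_div_norm scaleR_left_diff_distrib inverse_eq_divide)
    have "norm (x - v) = \<bar>1 - 1 / norm x\<bar> * norm x" unfolding xv by (rule norm_scaleR)
    also have "\<bar>1 - 1 / norm x\<bar> = 1 - 1 / norm x"
      using x by (intro abs_of_nonneg) (cases "x = 0", auto simp: divide_le_eq_1)
    also have "(1 - 1 / norm x) * norm x = norm x - 1"
      using x by (cases "x = 0") (auto simp: left_diff_distrib)
    finally have "norm (x - v) = norm x - 1" .
    then have "norm (u x) \<le> norm (u v) + (norm x - 1)"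
      using norm_u_diff_le[of x v] norm_triangle_sub[of "u x" "u v"] by simp
    also have "norm (u v) \<le> norm (u x0)" using x0 v by simp
    finally have "d \<le> norm x - norm (u x)" by (simp add: d_def)
    then show ?thesis unfolding z_eq
      by (intro mult_mono) (use \<open>d > 0\<close> in auto)
  qed
  ultimately show ?thesis by blast
qed

lemma z_proper: "\<exists>r. \<forall>x. z x \<le> t \<longrightarrow> x \<in> cball 0 r"
proof -
  obtain d where d: "d > 0" "\<And>x. norm x \<ge> 1 \<Longrightarrow> d * norm x \<le> z x" using z_linear_growth by blast
  have "norm x \<le> max 1 (t / d)" if "z x \<le> t" for x
  proof (cases "norm x \<ge> 1")
    case True
    then have "d * norm x \<le> t" using d that by force
    then have "norm x \<le> t / d" using d(1) by (simp add: pos_le_divide_eq mult.commute)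
    then show ?thesis by simp
  qed simp
  then show ?thesis by (intro exI[of _ "max 1 (t / d)"]) auto
qed

lemma continuous_z: "continuous_on UNIV z"
  by (rule smooth_map_continuous_on[OF smooth_z])

lemma compact_sublevel: "compact {x. z x \<le> t}"
proof -
  obtain r where "\<forall>x. z x \<le> t \<longrightarrow> x \<in> cball 0 r" using z_proper by blast
  then have "bounded {x. z x \<le> t}" by (intro bounded_subset[OF bounded_cball[of 0 r]]) auto
  moreover have "closed {x. z x \<le> t}"
    using continuous_z by (intro closed_Collect_le continuous_on_const) auto
  ultimately show ?thesis by (simp add: compact_eq_bounded_closed)
qed

section \<open>Weighted integrals over sublevel sets of \<open>z\<close>\<close>

definition sub_int :: "real \<Rightarrow> (real^'m \<Rightarrow> real) \<Rightarrow> real" where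
  "sub_int t f = (\<integral>x. indicator {x. z x \<le> t} x * (rho x * f x) \<partial>lborel)"

lemma continuous_rho: "continuous_on X rho"
  by (rule smooth_map_continuous_on[OF smooth_rho])

lemma sub_int_integrable:
  assumes "continuous_on {x. z x \<le> t} f"
  shows "integrable lborel (\<lambda>x. indicator {x. z x \<le> t} x * (rho x * f x))"
  using borel_integrable_compact[OF compact_sublevel continuous_on_mult[OF continuous_rho assms]] by simp

lemma sub_int_mono:
  assumes "continuous_on {x. z x \<le> t} f" "continuous_on {x. z x \<le> t} g"
    "\<And>x. z x \<le> t \<Longrightarrow> f x \<le> g x"
  shows "sub_int t f \<le> sub_int t g"
  unfolding sub_int_def
  by (intro integral_mono sub_int_integrable assms)
    (use rho_pos assms(3) in \<open>auto simp: indicator_def less_imp_le intro!: mult_left_mono\<close>)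

lemma sub_int_mono_level:
  assumes "s \<le> t" "continuous_on UNIV f" "\<And>x. f x \<ge> 0"
  shows "sub_int s f \<le> sub_int t f"
  unfolding sub_int_def
  by (intro integral_mono sub_int_integrable continuous_on_subset[OF assms(2)])
    (use assms rho_pos in \<open>auto simp: indicator_def less_imp_le\<close>)

lemma sub_int_nonneg: "(\<And>x. f x \<ge> 0) \<Longrightarrow> sub_int t f \<ge> 0"
  unfolding sub_int_def using rho_pos by (intro Bochner_Integration.integral_nonneg) (auto simp: less_imp_le)

lemma sub_int_cmult: "sub_int t (\<lambda>x. c * f x) = c * sub_int t f"
  unfolding sub_int_def by (simp add: mult.left_commute[of _ c])

lemma sub_int_add:
  assumes "continuous_on {x. z x \<le> t} f" "continuous_on {x. z x \<le> t} g"
  shows "sub_int t (\<lambda>x. f x + g x) = sub_int t f + sub_int t g"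
  unfolding sub_int_def
  using Bochner_Integration.integral_add[OF sub_int_integrable[OF assms(1)] sub_int_integrable[OF assms(2)]]
  by (simp add: algebra_simps)

text \<open>The integrand is the divergence of \<open>\<zeta> (z) flux f\<close>, a field of compact
  support since \<open>z\<close> is proper. As \<open>z\<close> is nonnegative, the profile is
  required only on the half-line.\<close>

lemma integral_L_cutoff:
  assumes f: "smooth_map f" and \<zeta>: "\<And>s. s \<ge> 0 \<Longrightarrow> (\<zeta> has_real_derivative \<zeta>' s) (at s)"
    and c\<zeta>': "continuous_on {0..} \<zeta>'" and supp: "\<And>s. s \<ge> t \<Longrightarrow> \<zeta> s = 0"
  shows "integrable lborel (\<lambda>x. rho x * (\<zeta> (z x) * L f x + \<zeta>' (z x) * grad_inner z f x))" (is ?I)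
    and "(\<integral>x. rho x * (\<zeta> (z x) * L f x + \<zeta>' (z x) * grad_inner z f x) \<partial>lborel) = 0" (is ?E)
proof -
  let ?F = "\<lambda>i x. \<zeta> (z x) * flux f i x"
  have dz: "z differentiable (at x)" for x by (rule smooth_map_differentiable[OF smooth_z])
  have dfl: "flux f i differentiable (at x)" for i x
    by (rule smooth_map_differentiable[OF smooth_flux[OF f]])
  note comp = pderiv_at_compose_real[OF dz \<zeta>[OF z_nonneg]]
  have dF: "?F i differentiable (at x)" for i x
    by (rule differentiable_mult[OF comp(2) dfl])
  have pF: "pderiv_at i (?F i) = (\<lambda>x. \<zeta> (z x) * pderiv_at i (flux f i) x + (\<zeta>' (z x) * pderiv_at i z x) * flux f i x)" for i
    by (rule ext) (simp add: pderiv_at_mult[OF comp(2) dfl] comp(1))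
  have c\<zeta>z: "continuous_on UNIV (\<lambda>x. \<zeta> (z x))"
    by (intro continuous_at_imp_continuous_on ballI differentiable_imp_continuous_within comp(2))
  have c\<zeta>'z: "continuous_on UNIV (\<lambda>x. \<zeta>' (z x))"
    by (rule continuous_on_compose2[OF c\<zeta>' continuous_z]) (auto simp: z_nonneg)
  have cF: "continuous_on UNIV (pderiv_at i (?F i))" for i
    unfolding pF
    by (intro continuous_on_add continuous_on_mult c\<zeta>z c\<zeta>'z smooth_map_continuous_on
        smooth_map_pderiv_at smooth_flux f smooth_z)
  obtain r where r: "\<And>x. z x \<le> t \<Longrightarrow> x \<in> cball 0 r" using z_proper by blast
  have sF: "?F i x = 0" if "x \<notin> cball 0 r" for i x
  proof -
    have "z x \<ge> t" using r[of x] that by linarith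
    then show ?thesis by (simp add: supp)
  qed
  note int0 = integral_pderiv_at_eq_0[OF dF cF sF]
  have e: "(\<Sum>i\<in>UNIV. pderiv_at i (?F i) x) = rho x * (\<zeta> (z x) * L f x + \<zeta>' (z x) * grad_inner z f x)" for x
  proof -
    have "(\<Sum>i\<in>UNIV. pderiv_at i (?F i) x) = \<zeta> (z x) * (\<Sum>i\<in>UNIV. pderiv_at i (flux f i) x)
        + \<zeta>' (z x) * (\<Sum>i\<in>UNIV. pderiv_at i z x * flux f i x)"
      unfolding pF by (simp add: sum.distrib sum_distrib_left mult.assoc)
    then show ?thesis
      by (simp add: divergence_flux[OF f] sum_pderiv_z_flux algebra_simps)
  qed
  have "integrable lborel (\<lambda>x. \<Sum>i\<in>UNIV. pderiv_at i (?F i) x)"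
    by (intro Bochner_Integration.integrable_sum int0(1))
  then show ?I by (simp only: e)
  have "(\<integral>x. (\<Sum>i\<in>UNIV. pderiv_at i (?F i) x) \<partial>lborel) = 0"
    using int0 by (subst Bochner_Integration.integral_sum) auto
  then show ?E by (simp only: e)
qed

text \<open>The weighted volume is finite because \<open>L z = 2 m - z\<close> is negative far out.\<close>

lemma volume_bounded: "\<exists>C. \<forall>t. sub_int t (\<lambda>_. 1) \<le> C"
proof -
  define m where "m = real CARD('m)"
  have m: "m > 0" by (simp add: m_def)
  let ?V = "\<lambda>t. sub_int t (\<lambda>_. 1)"
  have V: "?V s \<le> ?V (4 * m) + 4 * ?V (2 * m)" if s: "s \<ge> 4 * m" for s
  proof -
    \<comment> \<open>With the support reaching to \<open>2 s\<close>, the cutoff is at least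
      \<open>(t / 2)\<^sup>2\<close> on \<open>z \<le> s\<close>. Where also \<open>z > 4 m\<close>,
      \<open>L z\<close> is below \<open>- 2 m\<close>; this is weighed against
      \<open>z \<le> 2 m\<close>, outside which \<open>L z\<close> is negative. The factor
      \<open>t\<^sup>2\<close> is common to both sides, so the bound does not depend on
      \<open>s\<close>.\<close>
    define t where "t = 2 * s"
    have t: "t > 0" "s = t / 2" using s m by (auto simp: t_def)
    define \<zeta> where "\<zeta> r = (max 0 (t - r))\<^sup>2" for r
    define \<zeta>' where "\<zeta>' r = - 2 * max 0 (t - r)" for r
    have d: "(\<zeta> has_real_derivative \<zeta>' r) (at r)" for r
    proof -
      have "((\<lambda>r. t - r) has_real_derivative - 1) (at r)" by (auto intro!: derivative_eq_intros)
      from DERIV_chain2[OF has_real_derivative_pos_part_square this]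
      show ?thesis by (simp add: \<zeta>_def[abs_def] \<zeta>'_def)
    qed
    have c: "continuous_on {0..} \<zeta>'" unfolding \<zeta>'_def by (intro continuous_intros)
    have s0: "\<zeta> r = 0" if "r \<ge> t" for r using that by (simp add: \<zeta>_def)
    note I = integral_L_cutoff[OF smooth_z d c s0]
    let ?R = "\<lambda>x. 2 * m * t\<^sup>2 * (indicator {x. z x \<le> 2 * m} x * (rho x * 1))
      - m * t\<^sup>2 / 2 * (indicator {x. z x \<le> s} x * (rho x * 1) - indicator {x. z x \<le> 4 * m} x * (rho x * 1))"
    have ii: "integrable lborel (\<lambda>x. indicator {x. z x \<le> r} x * (rho x * 1))" for r
      by (rule sub_int_integrable) simp
    have "(\<integral>x. rho x * (\<zeta> (z x) * L z x + \<zeta>' (z x) * grad_inner z z x) \<partial>lborel)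
        \<le> (\<integral>x. ?R x \<partial>lborel)"
    proof (rule integral_mono[OF I(1)])
      show "integrable lborel ?R" by (intro Bochner_Integration.integrable_diff integrable_mult_right ii)
      fix x
      have g: "\<zeta>' (z x) * grad_inner z z x \<le> 0"
        unfolding grad_z \<zeta>'_def using z_nonneg[of x] q_nonneg[of x]
        by (intro mult_nonpos_nonneg) auto
      have "\<zeta> (z x) * L z x \<le> 2 * m * t\<^sup>2 * indicator {x. z x \<le> 2 * m} x
        - m * t\<^sup>2 / 2 * (indicator {x. z x \<le> s} x - indicator {x. z x \<le> 4 * m} x)"
        (is "_ \<le> ?r")
      proof -
        have Lz: "L z x = 2 * m - z x" by (simp add: L_z m_def)
        consider "z x \<le> 2 * m" | "2 * m < z x" "z x \<le> 4 * m \<or> s < z x" | "4 * m < z x" "z x \<le> s" by linarith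
        then show ?thesis
        proof cases
          case 1
          have "\<zeta> (z x) \<le> t\<^sup>2" unfolding \<zeta>_def using z_nonneg[of x] t by (intro power_mono) auto
          then have "\<zeta> (z x) * (2 * m - z x) \<le> t\<^sup>2 * (2 * m)"
            using z_nonneg[of x] m 1 by (intro mult_mono) auto
          moreover have "z x \<le> 4 * m" "z x \<le> s" using 1 m s by auto
          ultimately show ?thesis using 1 by (simp add: Lz mult_ac)
        next
          case 2
          then have "\<zeta> (z x) * (2 * m - z x) \<le> 0" by (intro mult_nonneg_nonpos) (auto simp: \<zeta>_def)
          then show ?thesis using 2 s m by (auto simp: Lz indicator_def)
        next
          case 3
          have "(t / 2)\<^sup>2 \<le> \<zeta> (z x)" unfolding \<zeta>_def using 3 t by (intro power_mono) auto
          then have "(t / 2)\<^sup>2 * (2 * m) \<le> \<zeta> (z x) * (z x - 2 * m)"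
            using 3 m by (intro mult_mono) (auto simp: \<zeta>_def)
          then show ?thesis using 3 m by (simp add: Lz power2_eq_square algebra_simps)
        qed
      qed
      then have "\<zeta> (z x) * L z x + \<zeta>' (z x) * grad_inner z z x \<le> ?r" using g by linarith
      then have "rho x * (\<zeta> (z x) * L z x + \<zeta>' (z x) * grad_inner z z x) \<le> rho x * ?r"
        using rho_pos[of x] by (intro mult_left_mono) auto
      then show "rho x * (\<zeta> (z x) * L z x + \<zeta>' (z x) * grad_inner z z x) \<le> ?R x"
        by (simp add: algebra_simps)
    qed
    also have "(\<integral>x. ?R x \<partial>lborel) = 2 * m * t\<^sup>2 * ?V (2 * m) - m * t\<^sup>2 / 2 * (?V s - ?V (4 * m))"
      unfolding sub_int_def using ii by simp
    also have "\<dots> = (m * t\<^sup>2 / 2) * (?V (4 * m) + 4 * ?V (2 * m) - ?V s)"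
      by (simp add: algebra_simps)
    finally have "0 \<le> (m * t\<^sup>2 / 2) * (?V (4 * m) + 4 * ?V (2 * m) - ?V s)"
      by (simp only: I(2))
    moreover have "m * t\<^sup>2 / 2 > 0" using m t by simp
    ultimately show ?thesis by (simp add: zero_le_mult_iff)
  qed
  have "?V t \<le> ?V (4 * m) + 4 * ?V (2 * m)" for t
  proof (cases "t \<ge> 4 * m")
    case False
    then have "?V t \<le> ?V (4 * m)" by (intro sub_int_mono_level) auto
    then show ?thesis using sub_int_nonneg[of "\<lambda>_. 1" "2 * m"] by simp
  qed (rule V)
  then show ?thesis by blast
qed

end

section \<open>The cutoff profile\<close>

text \<open>\<open>T\<close> marks the passage from polynomial to exponential decay. The assumption
  \<open>large\<close> makes the exponential contribution to the squared logarithmic derivative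
  small on \<open>s \<le> T / 2\<close>, even after multiplication by \<open>s\<close>; it holds for
  all large \<open>T\<close>.\<close>

locale cutoff_profile =
  fixes m T :: real
  assumes m: "m \<ge> 1" and T: "T \<ge> 0"
    and large: "16 * (T / 2) * (1 / (7 * sqrt m))\<^sup>2 * exp (- (1 / (7 * sqrt m)) * T) \<le> 1/4"
begin

definition a :: real where "a = 1 / (7 * sqrt m)"
text \<open>The choice gives \<open>1 / K = a / 10\<close>, so the polynomial factor of the profile
  adds at most a tenth of \<open>a\<close> to the logarithmic rate.\<close>

definition K :: real where "K = 70 * sqrt m"
definition E :: "real \<Rightarrow> real" where "E s = exp (a * (s - T))"
text \<open>Up to \<open>T\<close> the profile is comparable to \<open>1 / (K + s)\<close>, beyond
  \<open>T\<close> it decays at rate \<open>a\<close>. The polynomial factor ensures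
  \<open>eta s * s \<le> 1\<close>, which turns the far error into plain weighted volume.
  \<open>sig\<close> is minus the logarithmic derivative of \<open>eta\<close>.\<close>

definition eta :: "real \<Rightarrow> real" where "eta s = inverse ((K + s) * (1 + E s))"
definition sig :: "real \<Rightarrow> real" where "sig s = 1 / (K + s) + a * (E s / (1 + E s))"

lemma sqrt_m: "sqrt m \<ge> 1" "sqrt m * sqrt m = m"
  using m by auto

lemma a_pos: "a > 0" and K_ge: "K \<ge> 70" and a_sq: "a\<^sup>2 = 1 / (49 * m)" and K_inv: "1 / K = a / 10"
  using sqrt_m by (auto simp: a_def K_def power2_eq_square)

lemma E_pos: "E s > 0" by (simp add: E_def)

lemma eta_pos: "s \<ge> 0 \<Longrightarrow> eta s > 0"
  using E_pos[of s] K_ge by (simp add: eta_def)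

lemma DERIV_eta: assumes "s \<ge> 0" shows "(eta has_real_derivative - (eta s * sig s)) (at s)"
proof -
  have n: "K + s \<noteq> 0" "1 + E s \<noteq> 0" using assms K_ge E_pos[of s] by auto
  have dE: "(E has_real_derivative a * E s) (at s)"
    unfolding E_def[abs_def] by (auto intro!: derivative_eq_intros)
  have dP: "((\<lambda>s. (K + s) * (1 + E s)) has_real_derivative (1 + E s) + (K + s) * (a * E s)) (at s)"
    by (auto intro!: derivative_eq_intros dE)
  have "((\<lambda>s. inverse ((K + s) * (1 + E s))) has_real_derivative
      - ((inverse ((K + s) * (1 + E s)) * ((1 + E s) + (K + s) * (a * E s))) * inverse ((K + s) * (1 + E s)))) (at s)"
    by (rule DERIV_inverse'[OF dP]) (use n in simp)
  moreover have "inverse ((K + s) * (1 + E s)) * ((1 + E s) + (K + s) * (a * E s)) = sig s"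
    using n by (simp add: sig_def field_simps)
  ultimately show ?thesis by (simp add: eta_def[abs_def] mult.commute)
qed

lemma sig_nonneg: "s \<ge> 0 \<Longrightarrow> sig s \<ge> 0"
  using E_pos[of s] K_ge a_pos by (simp add: sig_def)

lemma continuous_eta_sig: "continuous_on {0..} (\<lambda>s. - (eta s * sig s))" "continuous_on {0..} eta"
proof -
  have n: "K + s \<noteq> 0" "1 + E s \<noteq> 0" if "s \<in> {0..}" for s using that K_ge E_pos[of s] by auto
  have cE: "continuous_on X E" for X unfolding E_def[abs_def] by (intro continuous_intros)
  show "continuous_on {0..} eta" unfolding eta_def[abs_def]
    by (intro continuous_intros cE) (use n in auto)
  then show "continuous_on {0..} (\<lambda>s. - (eta s * sig s))" unfolding sig_def[abs_def]
    by (intro continuous_intros cE) (use n in auto)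
qed

lemma eta_antimono: assumes "0 \<le> s" "s \<le> t" shows "eta t \<le> eta s"
proof (rule DERIV_nonpos_imp_nonincreasing[OF \<open>s \<le> t\<close>])
  fix r assume "s \<le> r" "r \<le> t"
  then have "r \<ge> 0" using assms by simp
  then show "\<exists>y. DERIV eta r :> y \<and> y \<le> 0"
    using DERIV_eta[of r] eta_pos[of r] sig_nonneg[of r] by (intro exI[of _ "- (eta r * sig r)"]) simp
qed

lemma eta_le: assumes "s \<ge> 0" shows "eta s * s \<le> 1" "eta s \<le> exp (- a * (s - T))"
proof -
  have 1: "K + s \<ge> 1" "1 + E s \<ge> 1" "K + s \<ge> s" using assms K_ge E_pos[of s] by auto
  have "s * 1 \<le> (K + s) * (1 + E s)" using 1 assms by (intro mult_mono) auto
  then have "inverse ((K + s) * (1 + E s)) * s \<le> inverse ((K + s) * (1 + E s)) * ((K + s) * (1 + E s))"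
    using 1 by (intro mult_left_mono) auto
  also have "\<dots> = 1" using 1 by (intro left_inverse) auto
  finally show "eta s * s \<le> 1" by (simp add: eta_def)
  have "1 * E s \<le> (K + s) * (1 + E s)" using 1 E_pos[of s] by (intro mult_mono) auto
  then have "eta s \<le> inverse (E s)" unfolding eta_def using E_pos[of s] by (intro le_imp_inverse_le) auto
  then show "eta s \<le> exp (- a * (s - T))" by (simp add: E_def exp_minus)
qed

lemma eta_ge: assumes "0 \<le> s" "s \<le> T" shows "eta s \<ge> 1 / (2 * (K + s))"
proof -
  have "E s \<le> 1" using assms a_pos by (simp add: E_def mult_nonneg_nonpos)
  moreover have "K + s > 0" using assms K_ge by simp
  ultimately have "(K + s) * (1 + E s) \<le> (K + s) * 2" by (intro mult_left_mono) auto
  then have "inverse ((K + s) * 2) \<le> eta s" unfolding eta_def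
    using \<open>K + s > 0\<close> E_pos[of s] by (intro le_imp_inverse_le) auto
  then show ?thesis by (simp add: inverse_eq_divide mult.commute)
qed

text \<open>The rate is at most \<open>11 a / 10\<close>, and \<open>8 * 121 / 4900 < 1 / 5\<close>.
  Half of \<open>q\<^sup>2 / (2 m)\<close> offers the coefficient \<open>1 / (4 m)\<close>; the
  margin of \<open>1 / (20 m)\<close> is spent on the mixed term in \<open>absorb\<close>.\<close>

lemma sig_le: assumes "s \<ge> 0" shows "8 * (sig s)\<^sup>2 \<le> 1 / (5 * m)"
proof -
  have "1 / (K + s) \<le> 1 / K" using assms K_ge by (intro divide_left_mono) auto
  moreover have "E s / (1 + E s) \<le> 1" using E_pos[of s] by simp
  then have "a * (E s / (1 + E s)) \<le> a * 1" using a_pos by (intro mult_left_mono) auto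
  ultimately have "sig s \<le> 11 / 10 * a" unfolding sig_def K_inv by linarith
  then have "(sig s)\<^sup>2 \<le> (11 / 10 * a)\<^sup>2" using sig_nonneg[OF assms] by (intro power_mono) auto
  also have "\<dots> = 121 / 4900 / m" unfolding power_mult_distrib a_sq by (simp add: power2_eq_square)
  finally have "8 * (sig s)\<^sup>2 \<le> 8 * (121 / 4900 / m)" by simp
  also have "\<dots> \<le> 1 / (5 * m)" using m by (simp add: field_simps)
  finally show ?thesis .
qed

text \<open>The two parts of \<open>sig\<close> are estimated separately:
  \<open>(K + s)\<^sup>2 \<ge> 4 K s\<close> controls the polynomial one and \<open>large\<close>
  the exponential one, with total \<open>16 / 280 + 1 / 4\<close>.\<close>

lemma sig_le_small: assumes "0 \<le> s" "s \<le> T / 2" shows "8 * s * (sig s)\<^sup>2 \<le> 1/2"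
proof -
  define e where "e = E s / (1 + E s)"
  have Ks: "K + s > 0" using assms K_ge by simp
  have e: "0 \<le> e" "e \<le> exp (- a * (T / 2))"
  proof -
    show "0 \<le> e" using E_pos[of s] by (simp add: e_def)
    have "e \<le> E s" using E_pos[of s] by (simp add: e_def field_simps)
    also have "E s \<le> exp (- a * (T / 2))" unfolding E_def
    proof -
      have "a * (s - T) \<le> a * (- (T / 2))" using assms a_pos by (intro mult_left_mono) auto
      then show "exp (a * (s - T)) \<le> exp (- a * (T / 2))" by simp
    qed
    finally show "e \<le> exp (- a * (T / 2))" .
  qed
  have "e\<^sup>2 \<le> (exp (- a * (T / 2)))\<^sup>2" using e by (intro power_mono) auto
  also have "\<dots> = exp (- a * T)" by (simp add: power2_eq_square flip: exp_add)
  finally have e2: "e\<^sup>2 \<le> exp (- a * T)" .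
  have "(sig s)\<^sup>2 \<le> 2 * (1 / (K + s))\<^sup>2 + 2 * (a * e)\<^sup>2"
  proof -
    have "(x + y)\<^sup>2 \<le> 2 * x\<^sup>2 + 2 * y\<^sup>2" for x y :: real
      using sum_squares_ge_zero[of "x - y" 0] by (simp add: power2_eq_square algebra_simps)
    then show ?thesis unfolding sig_def e_def[symmetric] .
  qed
  then have "8 * s * (sig s)\<^sup>2 \<le> 8 * s * (2 * (1 / (K + s))\<^sup>2 + 2 * (a * e)\<^sup>2)"
    using assms by (intro mult_left_mono) auto
  also have "\<dots> = 16 * (s / (K + s)\<^sup>2) + 16 * s * a\<^sup>2 * e\<^sup>2"
    by (simp add: power_mult_distrib power_divide algebra_simps)
  also have "s / (K + s)\<^sup>2 \<le> 1 / 280"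
  proof -
    have "70 * (4 * s) \<le> K * (4 * s)" using K_ge assms by (intro mult_right_mono) auto
    also have "\<dots> \<le> (K + s)\<^sup>2" using sum_squares_ge_zero[of "K - s" 0] by (simp add: power2_eq_square algebra_simps)
    finally show ?thesis using Ks by (simp add: field_simps)
  qed
  also have "16 * s * a\<^sup>2 * e\<^sup>2 \<le> 16 * (T / 2) * a\<^sup>2 * exp (- a * T)"
    using assms e2 by (intro mult_mono) auto
  also have "\<dots> \<le> 1 / 4" using large unfolding a_def .
  finally show ?thesis by simp
qed

text \<open>Half of the Bochner gain pays for the cutoff error. The part with
  \<open>q\<^sup>2\<close> is covered by \<open>sig_le\<close>. The mixed part \<open>s q\<close> is
  absorbed by \<open>q\<close> up to \<open>T / 2\<close>; further out Young's inequality leaves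
  \<open>s\<^sup>2\<close>, and \<open>(eta s * s)\<^sup>2 \<le> 1\<close>.\<close>

lemma absorb:
  assumes s: "s \<ge> 0" and q: "q \<ge> 0"
  shows "8 * (eta s * sig s)\<^sup>2 * q * (s + q)
    \<le> (eta s)\<^sup>2 / 2 * (q + q\<^sup>2 / (2 * m)) + (if s \<le> T / 2 then 0 else 1)"
proof -
  have e: "0 < eta s" using eta_pos s by blast
  have q2: "8 * (sig s)\<^sup>2 * q\<^sup>2 \<le> 1 / (5 * m) * q\<^sup>2"
    using sig_le[OF s] by (intro mult_right_mono) auto
  have *: "8 * (sig s)\<^sup>2 * q * (s + q) \<le> 1/2 * (q + q\<^sup>2 / (2 * m)) + (if s \<le> T / 2 then 0 else s\<^sup>2)"
  proof (cases "s \<le> T / 2")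
    case True
    have "8 * s * (sig s)\<^sup>2 * q \<le> 1/2 * q" using sig_le_small[OF s True] q by (intro mult_right_mono) auto
    moreover have "1 / (5 * m) * q\<^sup>2 \<le> 1/2 * (q\<^sup>2 / (2 * m))" using m by (simp add: field_simps)
    ultimately show ?thesis using q2 True by (simp add: power2_eq_square algebra_simps)
  next
    case False
    have "8 * (sig s)\<^sup>2 * (q * s) \<le> 1 / (5 * m) * (q * s)"
      using sig_le[OF s] s q by (intro mult_right_mono) auto
    also have "\<dots> \<le> 1 / (5 * m) * (q\<^sup>2 / 4 + s\<^sup>2)"
      using m sum_squares_ge_zero[of "q / 2 - s" 0]
      by (intro mult_left_mono) (auto simp: power2_eq_square algebra_simps)
    also have "\<dots> \<le> 1 / (20 * m) * q\<^sup>2 + s\<^sup>2"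
    proof -
      have "1 / (5 * m) * s\<^sup>2 \<le> 1 * s\<^sup>2" using m by (intro mult_right_mono) auto
      then show ?thesis by (simp add: distrib_left)
    qed
    finally have "8 * (sig s)\<^sup>2 * (q * s) \<le> 1 / (20 * m) * q\<^sup>2 + s\<^sup>2" .
    moreover have "1 / (20 * m) * q\<^sup>2 + 1 / (5 * m) * q\<^sup>2 = 1/2 * (q\<^sup>2 / (2 * m))"
      using m by (simp add: field_simps)
    ultimately show ?thesis using q2 False q by (simp add: power2_eq_square algebra_simps)
  qed
  have "8 * (eta s * sig s)\<^sup>2 * q * (s + q) = (eta s)\<^sup>2 * (8 * (sig s)\<^sup>2 * q * (s + q))"
    by (simp add: power_mult_distrib)
  also have "\<dots> \<le> (eta s)\<^sup>2 * (1/2 * (q + q\<^sup>2 / (2 * m)) + (if s \<le> T / 2 then 0 else s\<^sup>2))"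
    using * by (intro mult_left_mono) auto
  also have "\<dots> \<le> (eta s)\<^sup>2 / 2 * (q + q\<^sup>2 / (2 * m)) + (if s \<le> T / 2 then 0 else 1)"
  proof -
    have "(eta s * s)\<^sup>2 \<le> 1" using eta_le(1)[OF s] e s by (simp add: power_le_one)
    then show ?thesis by (simp add: distrib_left power_mult_distrib)
  qed
  finally show ?thesis .
qed

end

lemma eventually_cutoff_profile:
  assumes "m \<ge> 1" shows "eventually (cutoff_profile m) at_top"
proof -
  define a where "a = 1 / (7 * sqrt m)"
  have a: "a > 0" using assms by (simp add: a_def)
  have "filterlim (\<lambda>T. a * T) at_top at_top"
    using a by (intro filterlim_tendsto_pos_mult_at_top[OF tendsto_const]) (auto simp: filterlim_ident)
  from tendsto_mult[OF tendsto_const filterlim_compose[OF tendsto_power_div_exp_0 this], of "8 * a" 1]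
  have "((\<lambda>T. 16 * (T / 2) * a\<^sup>2 * exp (- a * T)) \<longlongrightarrow> 0) at_top"
    by (simp add: exp_minus field_simps power2_eq_square)
  then have "eventually (\<lambda>T. 16 * (T / 2) * a\<^sup>2 * exp (- a * T) < 1/4) at_top"
    by (rule order_tendstoD) simp
  then show ?thesis using eventually_ge_at_top[of 0]
    by eventually_elim (use assms in \<open>auto simp: cutoff_profile_def a_def less_imp_le\<close>)
qed

section \<open>Vanishing of the mean curvature\<close>

context shrinker_graph_origin
begin

abbreviation volume :: "real \<Rightarrow> real" where "volume t \<equiv> sub_int t (\<lambda>_. 1)"

abbreviation Q :: "real^'m \<Rightarrow> real" where "Q x \<equiv> q x + (q x)\<^sup>2 / (2 * real CARD('m))"

lemma continuous_q: "continuous_on X q"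
  by (rule smooth_map_continuous_on[OF smooth_q])

lemma Q_nonneg: "Q x \<ge> 0"
  using q_nonneg[of x] by simp

text \<open>The cutoff is the squared positive part of \<open>eta (z) - c\<close>; subtracting
  \<open>c = eta t\<close> gives it compact support without changing the derivative of the profile
  inside. The right-hand side lists the costs: truncation at level \<open>t\<close>, and the
  weighted volume beyond \<open>T / 2\<close>.\<close>

lemma cutoff_estimate:
  assumes "cutoff_profile (real CARD('m)) T" and s: "0 \<le> s" "s \<le> T" "T \<le> t"
  defines "c \<equiv> cutoff_profile.eta (real CARD('m)) T t"
    and "K \<equiv> cutoff_profile.K (real CARD('m))"
  shows "sub_int s q / (16 * (K + s)\<^sup>2) \<le> 3 * c\<^sup>2 * sub_int t Q + (volume t - volume (T / 2))"
proof -
  interpret P: cutoff_profile "real CARD('m)" T by fact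
  have t: "t \<ge> 0" using s by simp
  have c: "c = P.eta t" "c > 0" and K: "K = P.K"
    using P.eta_pos[OF t] by (simp_all add: c_def K_def)
  define \<zeta> where "\<zeta> r = (max 0 (P.eta r - c))\<^sup>2" for r
  define \<zeta>' where "\<zeta>' r = 2 * max 0 (P.eta r - c) * (- (P.eta r * P.sig r))" for r
  have d: "(\<zeta> has_real_derivative \<zeta>' r) (at r)" if "r \<ge> 0" for r
  proof -
    have "((\<lambda>r. P.eta r - c) has_real_derivative - (P.eta r * P.sig r)) (at r)"
      using DERIV_diff[OF P.DERIV_eta[OF that] DERIV_const] by simp
    from DERIV_chain2[OF has_real_derivative_pos_part_square this]
    show ?thesis by (simp add: \<zeta>_def[abs_def] \<zeta>'_def)
  qed
  have c\<zeta>': "continuous_on {0..} \<zeta>'" unfolding \<zeta>'_def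
    by (intro continuous_on_mult continuous_on_max continuous_on_diff continuous_on_const P.continuous_eta_sig)
  have s0: "\<zeta> r = 0" if "r \<ge> t" for r
    using P.eta_antimono[OF t that] by (simp add: \<zeta>_def c)
  note I = integral_L_cutoff[OF smooth_q d c\<zeta>' s0]
  have ceta: "continuous_on X (\<lambda>x. P.eta (z x))" for X
    by (rule continuous_on_compose2[OF P.continuous_eta_sig(2) continuous_on_subset[OF continuous_z]])
      (auto simp: z_nonneg)
  have cQ: "continuous_on X Q" for X by (intro continuous_intros continuous_q) simp
  have c1: "continuous_on X (\<lambda>x. (P.eta (z x))\<^sup>2 * Q x)" for X
    by (intro continuous_on_mult continuous_on_power ceta cQ)
  let ?R = "\<lambda>x. (1/4) * (indicator {x. z x \<le> t} x * (rho x * ((P.eta (z x))\<^sup>2 * Q x)))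
      - 3 * c\<^sup>2 * (indicator {x. z x \<le> t} x * (rho x * Q x))
      - (indicator {x. z x \<le> t} x * (rho x * 1) - indicator {x. z x \<le> T / 2} x * (rho x * 1))"
  note ii = sub_int_integrable[OF c1] sub_int_integrable[OF cQ] sub_int_integrable[OF continuous_on_const[of _ 1]]
  have "(\<integral>x. ?R x \<partial>lborel) \<le> (\<integral>x. rho x * (\<zeta> (z x) * L q x + \<zeta>' (z x) * grad_inner z q x) \<partial>lborel)"
  proof (rule integral_mono[OF _ I(1)])
    show "integrable lborel ?R"
      by (intro Bochner_Integration.integrable_diff integrable_mult_right ii)
    fix x
    show "?R x \<le> rho x * (\<zeta> (z x) * L q x + \<zeta>' (z x) * grad_inner z q x)"
    proof (cases "z x \<le> t")
      case False
      then have "P.eta (z x) \<le> c" unfolding c using P.eta_antimono[OF t, of "z x"] by simp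
      then show ?thesis using False s by (simp add: \<zeta>_def \<zeta>'_def max_def)
    next
      case True
      define e where "e = P.eta (z x)"
      define e' where "e' = - (e * P.sig (z x))"
      have ec: "e \<ge> c" unfolding c e_def using P.eta_antimono[OF z_nonneg True] .
      have \<zeta>e: "\<zeta> (z x) = (e - c)\<^sup>2" "\<zeta>' (z x) = 2 * (e - c) * e'"
        using ec by (simp_all add: \<zeta>_def \<zeta>'_def e_def e'_def max_def)
      have B: "(e - c)\<^sup>2 * Q x - 8 * e'\<^sup>2 * q x * (z x + q x) \<le> \<zeta> (z x) * L q x + \<zeta>' (z x) * grad_inner z q x"
      proof (cases "e = c")
        case True
        then show ?thesis unfolding \<zeta>e using q_nonneg[of x] z_nonneg[of x] by simp
      next
        case False
        \<comment> \<open>With this choice \<open>2 \<tau> (e - c)\<^sup>2\<close> is the derivative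
          of the cutoff, so the Bochner inequality times \<open>(e - c)\<^sup>2\<close> bounds the
          integrand exactly. At \<open>e = c\<close> the cutoff and its derivative both vanish and
          the bound is a sign statement.\<close>
        define \<tau> where "\<tau> = e' / (e - c)"
        have \<tau>: "(e - c) * \<tau> = e'" using False by (simp add: \<tau>_def)
        have "(e - c)\<^sup>2 * (Q x - 2 * \<tau>\<^sup>2 * q x * grad_inner z z x)
            \<le> (e - c)\<^sup>2 * (L q x + 2 * \<tau> * grad_inner z q x)"
          by (intro mult_left_mono L_q_ge) simp
        also have "(e - c)\<^sup>2 * (L q x + 2 * \<tau> * grad_inner z q x)
            = \<zeta> (z x) * L q x + \<zeta>' (z x) * grad_inner z q x"
          unfolding \<zeta>e \<tau>[symmetric] by (simp add: power2_eq_square algebra_simps)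
        also have "(e - c)\<^sup>2 * (Q x - 2 * \<tau>\<^sup>2 * q x * grad_inner z z x)
            = (e - c)\<^sup>2 * Q x - 8 * e'\<^sup>2 * q x * (z x + q x)"
          unfolding \<tau>[symmetric] grad_z by (simp add: power_mult_distrib right_diff_distrib)
        finally show ?thesis .
      qed
      define Y where "Y = Q x"
      have "8 * e'\<^sup>2 * q x * (z x + q x) \<le> e\<^sup>2 / 2 * Y + (if z x \<le> T / 2 then 0 else 1)"
        unfolding e'_def e_def power2_minus Y_def by (rule P.absorb[OF z_nonneg q_nonneg])
      \<comment> \<open>Truncation keeps three quarters of \<open>e\<^sup>2\<close> at the price of
        \<open>3 c\<^sup>2\<close>. One half is used up by \<open>absorb\<close>, which leaves the
        final quarter.\<close>
      moreover have "(3/4 * e\<^sup>2 - 3 * c\<^sup>2) * Y \<le> (e - c)\<^sup>2 * Y"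
      proof (rule mult_right_mono)
        have "0 \<le> (e / 2 - 2 * c)\<^sup>2" by simp
        then show "3/4 * e\<^sup>2 - 3 * c\<^sup>2 \<le> (e - c)\<^sup>2" by (simp add: power2_eq_square algebra_simps)
      qed (simp only: Y_def Q_nonneg)
      then have "3/4 * (e\<^sup>2 * Y) - 3 * c\<^sup>2 * Y \<le> (e - c)\<^sup>2 * Y" by (simp add: left_diff_distrib)
      ultimately have "1/4 * (e\<^sup>2 * Y) - 3 * c\<^sup>2 * Y - (if z x \<le> T / 2 then 0 else 1)
          \<le> \<zeta> (z x) * L q x + \<zeta>' (z x) * grad_inner z q x"
        using B[folded Y_def] by linarith
      then have "1/4 * (e\<^sup>2 * Q x) - 3 * c\<^sup>2 * Q x - (if z x \<le> T / 2 then 0 else 1)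
          \<le> \<zeta> (z x) * L q x + \<zeta>' (z x) * grad_inner z q x" unfolding Y_def .
      then have "rho x * (1/4 * (e\<^sup>2 * Q x) - 3 * c\<^sup>2 * Q x - (if z x \<le> T / 2 then 0 else 1))
          \<le> rho x * (\<zeta> (z x) * L q x + \<zeta>' (z x) * grad_inner z q x)"
        using rho_pos[of x] by (intro mult_left_mono) auto
      moreover have "?R x = rho x * (1/4 * (e\<^sup>2 * Q x) - 3 * c\<^sup>2 * Q x - (if z x \<le> T / 2 then 0 else 1))"
        using True by (simp add: e_def right_diff_distrib)
      ultimately show ?thesis by simp
    qed
  qed
  also have "(\<integral>x. ?R x \<partial>lborel) = (1/4) * sub_int t (\<lambda>x. (P.eta (z x))\<^sup>2 * Q x)
      - 3 * c\<^sup>2 * sub_int t Q - (volume t - volume (T / 2))"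
  proof -
    have "(\<integral>x. (1/4) * f x - k * g x - (h x - h' x) \<partial>lborel)
        = (1/4) * (\<integral>x. f x \<partial>lborel) - k * (\<integral>x. g x \<partial>lborel) - ((\<integral>x. h x \<partial>lborel) - (\<integral>x. h' x \<partial>lborel))"
      if "integrable lborel f" "integrable lborel g" "integrable lborel h" "integrable lborel h'"
      for f g h h' :: "real^'m \<Rightarrow> real" and k
      using that by simp
    from this[OF ii(1,2,3,3)] show ?thesis unfolding sub_int_def .
  qed
  finally have "(1/4) * sub_int t (\<lambda>x. (P.eta (z x))\<^sup>2 * Q x)
      - 3 * c\<^sup>2 * sub_int t Q - (volume t - volume (T / 2)) \<le> 0"
    by (simp only: I(2))
  then have main: "(1/4) * sub_int t (\<lambda>x. (P.eta (z x))\<^sup>2 * Q x)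
      \<le> 3 * c\<^sup>2 * sub_int t Q + (volume t - volume (T / 2))" by linarith
  \<comment> \<open>On \<open>z \<le> s \<le> T\<close> the squared profile is at least
    \<open>1 / (4 (K + s)\<^sup>2)\<close>; together with the quarter this is the factor 16.\<close>
  have "sub_int s q / (16 * (K + s)\<^sup>2) = (1/4) * sub_int s (\<lambda>x. 1 / (4 * (K + s)\<^sup>2) * q x)"
    unfolding sub_int_cmult by simp
  also have "\<dots> \<le> (1/4) * sub_int s (\<lambda>x. (P.eta (z x))\<^sup>2 * Q x)"
  proof (intro mult_left_mono sub_int_mono continuous_on_mult continuous_on_const continuous_q
      continuous_on_power ceta cQ)
    fix x assume x: "z x \<le> s"
    have "1 / (2 * (K + s)) \<le> 1 / (2 * (K + z x))"
      using x P.K_ge z_nonneg[of x] s unfolding K by (intro divide_left_mono) auto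
    also have "\<dots> \<le> P.eta (z x)" unfolding K using P.eta_ge[OF z_nonneg, of x] x s by simp
    finally have "(1 / (2 * (K + s)))\<^sup>2 \<le> (P.eta (z x))\<^sup>2"
      using P.K_ge s unfolding K by (intro power_mono) auto
    moreover have "(1 / (2 * (K + s)))\<^sup>2 = 1 / (4 * (K + s)\<^sup>2)"
      unfolding power_divide power_mult_distrib by simp
    ultimately show "1 / (4 * (K + s)\<^sup>2) * q x \<le> (P.eta (z x))\<^sup>2 * Q x"
      using q_nonneg[of x] by (intro mult_mono) auto
  qed simp
  also have "\<dots> \<le> (1/4) * sub_int t (\<lambda>x. (P.eta (z x))\<^sup>2 * Q x)"
    using s Q_nonneg by (intro mult_left_mono sub_int_mono_level c1) auto
  finally show ?thesis using main by linarith
qed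

text \<open>For fixed \<open>T\<close> the level \<open>t\<close> runs through the values supplied
  by \<open>growth\<close>; the truncation cost is of order \<open>exp ((\<beta> - 2 a) t)\<close>
  up to a term that also decays, and \<open>\<beta> < 2 a\<close>. Afterwards \<open>T\<close> tends
  to infinity and the tail of the finite weighted volume disappears. What is left is a vanishing
  weighted integral of the continuous function \<open>q\<close>.\<close>

lemma q_vanishes:
  assumes growth: "\<And>N. \<exists>t\<ge>N. sub_int t (\<lambda>x. (q x)\<^sup>2) \<le> 16 * exp (t / (4 * sqrt (real CARD('m))))"
  shows "q x = 0"
proof -
  define m where "m = real CARD('m)"
  have m1: "m \<ge> 1" using zero_less_card_finite[where 'a='m] by (simp add: m_def Suc_le_eq flip: of_nat_Suc)
  obtain C where C: "\<And>t. volume t \<le> C" using volume_bounded by blast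
  then have bdd: "bdd_above (range volume)" by (intro bdd_aboveI[of _ C]) auto
  define Vs where "Vs = (SUP t. volume t)"
  have Vs: "volume t \<le> Vs" for t unfolding Vs_def by (rule cSUP_upper[OF UNIV_I bdd])
  define a where "a = 1 / (7 * sqrt m)"
  define \<beta> where "\<beta> = 1 / (4 * sqrt m)"
  have \<beta>: "\<beta> < 2 * a" "0 < a" using m1 by (auto simp: a_def \<beta>_def field_simps)
  have ev: "eventually (cutoff_profile m) at_top" by (rule eventually_cutoff_profile[OF m1])
  have step: "sub_int s q / (16 * (cutoff_profile.K m + s)\<^sup>2) \<le> Vs - volume (T / 2)"
    if "cutoff_profile m T" and s: "0 \<le> s" "s \<le> T" for s T
  proof (rule field_le_epsilon)
    fix \<epsilon> :: real assume "\<epsilon> > 0"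
    interpret P: cutoff_profile m T by fact
    have Pa: "P.a = a" by (simp add: P.a_def a_def)
    let ?g = "\<lambda>t. 3 * exp (2 * a * T) * (C * exp (- 2 * a * t) + 32 * exp ((\<beta> - 2 * a) * t))"
    have exp0: "((\<lambda>t. exp (k * t)) \<longlongrightarrow> 0) at_top" if "k < 0" for k :: real
      using that by (intro filterlim_compose[OF exp_at_bot] filterlim_tendsto_neg_mult_at_bot[OF tendsto_const])
        (auto simp: filterlim_ident)
    have "(?g \<longlongrightarrow> 3 * exp (2 * a * T) * (C * 0 + 32 * 0)) at_top"
      using \<beta> by (intro tendsto_mult tendsto_add tendsto_const exp0) auto
    then have "eventually (\<lambda>t. ?g t < \<epsilon>) at_top"
      using \<open>\<epsilon> > 0\<close> by (intro order_tendstoD) auto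
    then have "eventually (\<lambda>t. ?g t < \<epsilon> \<and> t \<ge> T) at_top"
      using eventually_ge_at_top[of T] by eventually_elim simp
    then obtain N where N: "\<And>t. t \<ge> N \<Longrightarrow> ?g t < \<epsilon> \<and> t \<ge> T"
      unfolding eventually_at_top_linorder by blast
    obtain t where t: "t \<ge> N" and gt: "sub_int t (\<lambda>x. (q x)\<^sup>2) \<le> 16 * exp (\<beta> * t)"
      using growth[of N] by (auto simp: \<beta>_def m_def)
    define c where "c = P.eta t"
    have tT: "T \<le> t" "t \<ge> 0" using N[OF t] s by auto
    have est: "sub_int s q / (16 * (P.K + s)\<^sup>2) \<le> 3 * c\<^sup>2 * sub_int t Q + (volume t - volume (T / 2))"
      unfolding c_def m_def
      by (rule cutoff_estimate) (use \<open>cutoff_profile m T\<close> s tT in \<open>simp_all add: m_def\<close>)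
    \<comment> \<open>The hypothesis controls only \<open>q\<^sup>2\<close>, so the linear part of
      \<open>Q\<close> is bounded by \<open>1 + q\<^sup>2\<close> and the constant is charged to the
      volume.\<close>
    have "sub_int t Q \<le> sub_int t (\<lambda>x. 1 + 2 * (q x)\<^sup>2)"
    proof (intro sub_int_mono)
      show "continuous_on {x. z x \<le> t} Q" "continuous_on {x. z x \<le> t} (\<lambda>x. 1 + 2 * (q x)\<^sup>2)"
        by (intro continuous_intros continuous_q; simp)+
      fix x
      have "(q x)\<^sup>2 / (2 * m) \<le> (q x)\<^sup>2 / 1" using m1 by (intro divide_left_mono) auto
      moreover have "q x \<le> 1 + (q x)\<^sup>2"
        using sum_squares_ge_zero[of "q x - 1" 0] q_nonneg[of x] by (simp add: power2_eq_square algebra_simps)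
      ultimately show "Q x \<le> 1 + 2 * (q x)\<^sup>2" by (simp add: m_def)
    qed
    also have "\<dots> = volume t + 2 * sub_int t (\<lambda>x. (q x)\<^sup>2)"
      unfolding sub_int_cmult[symmetric] by (intro sub_int_add continuous_intros continuous_q)
    also have "\<dots> \<le> C + 32 * exp (\<beta> * t)" using C[of t] gt by linarith
    finally have Qt: "sub_int t Q \<le> C + 32 * exp (\<beta> * t)" .
    have "c\<^sup>2 \<le> (exp (- a * (t - T)))\<^sup>2"
      using P.eta_le(2)[OF tT(2)] P.eta_pos[OF tT(2)] unfolding c_def Pa by (intro power_mono) auto
    also have "\<dots> = exp (2 * a * T) * exp (- 2 * a * t)"
      by (simp add: power2_eq_square algebra_simps flip: exp_add)
    finally have "c\<^sup>2 * sub_int t Q \<le> exp (2 * a * T) * exp (- 2 * a * t) * (C + 32 * exp (\<beta> * t))"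
      using Qt sub_int_nonneg[of Q t] Q_nonneg by (intro mult_mono) auto
    also have "\<dots> = exp (2 * a * T) * (C * exp (- 2 * a * t) + 32 * exp ((\<beta> - 2 * a) * t))"
      by (simp add: algebra_simps flip: exp_add)
    finally have "3 * c\<^sup>2 * sub_int t Q \<le> ?g t" by simp
    then show "sub_int s q / (16 * (cutoff_profile.K m + s)\<^sup>2) \<le> Vs - volume (T / 2) + \<epsilon>"
      using est Vs[of t] N[OF t] by linarith
  qed
  have zero: "sub_int s q = 0" if s: "s \<ge> 0" for s
  proof -
    have "sub_int s q / (16 * (cutoff_profile.K m + s)\<^sup>2) \<le> 0"
    proof (rule field_le_epsilon)
      fix \<epsilon> :: real assume "\<epsilon> > 0"
      then have "Vs - \<epsilon> < Vs" by simp
      then obtain t where t: "Vs - \<epsilon> < volume t"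
        unfolding Vs_def using less_cSUP_iff[OF _ bdd] by auto
      have "eventually (\<lambda>T. cutoff_profile m T \<and> T \<ge> max s (2 * t)) at_top"
        using ev eventually_ge_at_top[of "max s (2 * t)"] by eventually_elim simp
      then obtain T where T: "cutoff_profile m T" "T \<ge> s" "T / 2 \<ge> t"
        by (auto simp: eventually_at_top_linorder)
      have "volume t \<le> volume (T / 2)" using T by (intro sub_int_mono_level) auto
      then show "sub_int s q / (16 * (cutoff_profile.K m + s)\<^sup>2) \<le> 0 + \<epsilon>"
        using step[OF T(1) s T(2)] t by linarith
    qed
    moreover obtain T where "cutoff_profile m T"
      using ev by (auto simp: eventually_at_top_linorder)
    then have "cutoff_profile.K m + s > 0" using cutoff_profile.K_ge[of m T] s by simp
    ultimately have "sub_int s q \<le> 0" by (simp add: divide_le_0_iff)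
    then show ?thesis using sub_int_nonneg[of q s] q_nonneg by simp
  qed
  show "q x = 0"
  proof (rule ccontr)
    assume "q x \<noteq> 0"
    define s where "s = z x + 1"
    \<comment> \<open>The vanishing integral makes this open set null, whereas a nonempty open set
      has positive measure.\<close>
    define U where "U = {v. z v < s} \<inter> {v. 0 < q v}"
    have "x \<in> U" using \<open>q x \<noteq> 0\<close> q_nonneg[of x] by (simp add: U_def s_def)
    moreover have "open U" unfolding U_def
      by (intro open_Int open_Collect_less continuous_z continuous_q continuous_on_const)
    moreover have "negligible U"
    proof -
      have "AE v in lborel. indicator {v. z v \<le> s} v * (rho v * q v) = 0"
        using zero[of s] z_nonneg[of x] unfolding sub_int_def
        by (intro iffD1[OF integral_nonneg_eq_0_iff_AE[OF sub_int_integrable[OF continuous_q]]])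
          (auto simp: s_def q_nonneg rho_pos less_imp_le)
      then have "AE v in lborel. v \<notin> U"
      proof eventually_elim
        case (elim v)
        then show ?case using rho_pos[of v] by (auto simp: U_def indicator_def)
      qed
      then have "U \<in> null_sets lborel" using \<open>open U\<close> by (subst AE_iff_null_sets) auto
      then show ?thesis by (simp add: negligible_iff_null_sets null_sets_completionI)
    qed
    ultimately show False using open_not_negligible by blast
  qed
qed

text \<open>Euler's relation \<open>u v = du v v\<close> makes \<open>u (s x) / s\<close> constant
  in \<open>s > 0\<close>. Its limit as \<open>s\<close> tends to 0 is the derivative at the origin,
  because \<open>u\<close> is differentiable there and \<open>u 0 = 0\<close>.\<close>

lemma u_linear_of_w_eq_0:
  assumes w0: "\<And>x. w x = 0"
  shows "u x = du 0 x"
proof -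
  have d: "((\<lambda>s. u (s *\<^sub>R x)) has_derivative (\<lambda>h. h *\<^sub>R du (s *\<^sub>R x) x)) (at s)" for s
  proof -
    have "((\<lambda>s. s *\<^sub>R x) has_derivative (\<lambda>h. h *\<^sub>R x)) (at s)"
      by (auto intro!: derivative_eq_intros)
    from has_derivative_compose[OF this has_derivative_u]
    show ?thesis by (simp add: linear_cmul[OF linear_du])
  qed
  have eu: "u v = du v v" for v
    using w0[of v] by (simp add: w_def du_def)
  have "\<exists>c. \<forall>s\<in>{0<..}. inverse s *\<^sub>R u (s *\<^sub>R x) = c"
  proof (rule has_derivative_zero_constant)
    fix s :: real assume s: "s \<in> {0<..}"
    have "((\<lambda>s. inverse s *\<^sub>R u (s *\<^sub>R x)) has_derivative
        (\<lambda>h. inverse s *\<^sub>R (h *\<^sub>R du (s *\<^sub>R x) x) + (- (inverse s * h * inverse s)) *\<^sub>R u (s *\<^sub>R x))) (at s)"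
      by (rule has_derivative_scaleR[OF has_derivative_inverse' d]) (use s in simp)
    moreover have "inverse s *\<^sub>R (h *\<^sub>R du (s *\<^sub>R x) x) + (- (inverse s * h * inverse s)) *\<^sub>R u (s *\<^sub>R x) = 0" for h
      using s by (simp add: eu[of "s *\<^sub>R x"] linear_cmul[OF linear_du])
    ultimately show "((\<lambda>s. inverse s *\<^sub>R u (s *\<^sub>R x)) has_derivative (\<lambda>h. 0)) (at s within {0<..})"
      by (simp add: has_derivative_at_withinI)
  qed simp
  then obtain c where "\<And>s. s > 0 \<Longrightarrow> inverse s *\<^sub>R u (s *\<^sub>R x) = c" by auto
  from this this[of 1] have const: "inverse s *\<^sub>R u (s *\<^sub>R x) = u x" if "s > 0" for s
    using that by simp
  have "((\<lambda>h. norm (u (h *\<^sub>R x) - h *\<^sub>R du 0 x) / norm h) \<longlongrightarrow> 0) (at 0)"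
    using d[of 0] by (simp add: has_derivative_at u_0)
  then have "((\<lambda>h. norm (u (h *\<^sub>R x) - h *\<^sub>R du 0 x) / norm h) \<longlongrightarrow> 0) (at_right 0)"
    by (rule tendsto_within_subset) simp
  moreover have "norm (u (h *\<^sub>R x) - h *\<^sub>R du 0 x) / norm h = norm (u x - du 0 x)" if "h > 0" for h
  proof -
    have "u (h *\<^sub>R x) = h *\<^sub>R u x" using const[OF that] that by (metis less_irrefl right_inverse scaleR_one scaleR_scaleR)
    then have "u (h *\<^sub>R x) - h *\<^sub>R du 0 x = h *\<^sub>R (u x - du 0 x)" by (simp add: scaleR_right_diff_distrib)
    then show ?thesis using that by simp
  qed
  then have "eventually (\<lambda>h. norm (u (h *\<^sub>R x) - h *\<^sub>R du 0 x) / norm h = norm (u x - du 0 x)) (at_right 0)"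
    by (intro eventually_at_rightI[of 0 1]) auto
  ultimately have "((\<lambda>h::real. norm (u x - du 0 x)) \<longlongrightarrow> 0) (at_right 0)"
    by (rule Lim_transform_eventually)
  then have "norm (u x - du 0 x) = 0" by (simp add: tendsto_const_iff)
  then show ?thesis by simp
qed

lemma subspace_range_if_q_eq_0:
  assumes "\<And>x. q x = 0" shows "subspace (range (graph_map u))"
proof -
  have "graph_map u = (\<lambda>x. (x, du 0 x))"
    unfolding graph_map_def using u_linear_of_w_eq_0 w_eq_0 assms by blast
  moreover have "linear (\<lambda>x. (x, du 0 x))"
    by (rule linearI) (simp_all add: linear_add[OF linear_du] linear_cmul[OF linear_du])
  ultimately show ?thesis
    by (metis linear_subspace_image subspace_UNIV)
qed

section \<open>Translation into the mean curvature integral\<close>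

lemma zfun_graph: "zfun (graph_map u) x = z x"
  by (simp add: zfun_def graph_map_def pinner_def z_def)

text \<open>By the shrinker equation \<open>H\<close> is half the normal vector represented by
  \<open>y\<close>, so \<open>pinner H H = - q / 4\<close>; the absolute value in
  \<open>pnorm\<close> removes the sign.\<close>

lemma pnorm_mean_curvature: "pnorm (mean_curvature (graph_map u) x) ^ 4 = (q x)\<^sup>2 / 16"
proof -
  have "mean_curvature (graph_map u) x = (1/2) *\<^sub>R normal_vector x (y x)"
    by (simp add: mean_curvature_graph shrinker y_def linear_cmul[OF linear_Sinv]
        linear_cmul[OF linear_normal_vector])
  then have "pinner (mean_curvature (graph_map u) x) (mean_curvature (graph_map u) x) = - (q x / 4)"
    using pinner_normal_vector[of x "y x"] by (simp add: pinner_def q_eq algebra_simps)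
  then have "pnorm (mean_curvature (graph_map u) x) = sqrt (q x / 4)"
    using q_nonneg[of x] by (simp add: pnorm_def)
  moreover have "sqrt (q x / 4) ^ 4 = ((sqrt (q x / 4))\<^sup>2)\<^sup>2" by (simp flip: power_mult)
  ultimately show ?thesis using q_nonneg[of x] by (simp add: power_divide)
qed

lemma mean_curvature_integral:
  "(LINT x:sublevel (graph_map u) R|volume_measure (graph_map u).
      pnorm (mean_curvature (graph_map u) x) ^ 4 * exp (- zfun (graph_map u) x / 4))
    = sub_int (R\<^sup>2) (\<lambda>x. (q x)\<^sup>2) / 16"
proof -
  let ?f = "\<lambda>x. indicator {x. z x \<le> R\<^sup>2} x * ((q x)\<^sup>2 / 16 * exp (- z x / 4))"
  have vol: "volume_measure (graph_map u) = density lborel (\<lambda>x. ennreal (sqrt (det (G x))))"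
  proof -
    have "(\<chi> i j. induced_metric (graph_map u) x (axis i 1) (axis j 1)) = G x" for x
      by (simp add: induced_metric_axis vec_eq_iff)
    then show ?thesis by (simp add: volume_measure_def)
  qed
  have cG: "continuous_on UNIV (\<lambda>x. sqrt (det (G x)))"
    by (intro smooth_map_continuous_on smooth_map_sqrt smooth_map_det smooth_G det_G_pos)
  have "continuous_on UNIV (\<lambda>x. (q x)\<^sup>2 / 16 * exp (- z x / 4))"
    by (intro continuous_intros continuous_q continuous_z) auto
  then have mq: "(\<lambda>x. (q x)\<^sup>2 / 16 * exp (- z x / 4)) \<in> borel_measurable borel"
    by (rule borel_measurable_continuous_onI)
  have ms: "{x. z x \<le> R\<^sup>2} \<in> sets borel" using compact_sublevel by (rule borel_compact)
  have mf: "?f \<in> borel_measurable lborel"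
    unfolding measurable_lborel2
    by (rule borel_measurable_times[OF borel_measurable_indicator[OF ms] mq])
  have "(LINT x:sublevel (graph_map u) R|volume_measure (graph_map u).
      pnorm (mean_curvature (graph_map u) x) ^ 4 * exp (- zfun (graph_map u) x / 4))
      = (\<integral>x. ?f x \<partial>density lborel (\<lambda>x. ennreal (sqrt (det (G x)))))"
    unfolding set_lebesgue_integral_def vol sublevel_def
    by (simp only: zfun_graph pnorm_mean_curvature real_scaleR_def)
  also have "\<dots> = (\<integral>x. sqrt (det (G x)) *\<^sub>R ?f x \<partial>lborel)"
    by (rule integral_density[OF mf])
      (use cG det_G_pos in \<open>auto intro!: borel_measurable_continuous_onI simp: less_imp_le\<close>)
  also have "(\<lambda>x. sqrt (det (G x)) *\<^sub>R ?f x) = (\<lambda>x. indicator {x. z x \<le> R\<^sup>2} x * (rho x * (q x)\<^sup>2) / 16)"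
    by (simp add: fun_eq_iff rho_def mult_ac)
  finally show ?thesis by (simp add: sub_int_def)
qed

end

text \<open>A quotient above \<open>c\<close> is informative only when the logarithm is positive.
  For \<open>I \<le> 1\<close> the claim holds because the right-hand side is at least 1, whatever
  value the quotient has.\<close>

lemma ereal_quotient_gt_imp:
  fixes I c R :: real
  assumes gt: "ereal (R\<^sup>2) / ereal (ln I) > ereal c" and "c > 0" "R > 0" "I \<ge> 0"
  shows "I \<le> exp (R\<^sup>2 / c)"
proof (cases "I \<le> 1")
  case True
  also have "1 \<le> exp (R\<^sup>2 / c)" using assms by simp
  finally show ?thesis .
next
  case False
  then have l: "ln I > 0" by simp
  then have "c < R\<^sup>2 / ln I" using gt by simp
  then have "ln I < R\<^sup>2 / c" using l \<open>c > 0\<close> by (simp add: field_simps)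
  then have "exp (ln I) < exp (R\<^sup>2 / c)" by simp
  then show ?thesis using False by simp
qed

theorem theorem1p1:
  fixes u :: "real^'m \<Rightarrow> real^'n"
    and X :: "real^'m \<Rightarrow> (real^'m) \<times> (real^'n)"
  assumes graph: "smooth_map u" "X = graph_map u"
    and spacelike: "spacelike X"
    and shrinker: "self_shrinker X"
    and origin: "0 \<in> range X"
    and nonlinear: "\<not> subspace (range X)"
  shows "Limsup at_top
      (\<lambda>R::real. ereal (R\<^sup>2) /
         ereal (ln (LINT x:sublevel X R|volume_measure X.
                      pnorm (mean_curvature X x) ^ 4 * exp (- zfun X x / 4))))
    \<le> ereal (4 * sqrt (real CARD('m)))"
proof (rule ccontr)
  interpret spacelike_graph u
    by unfold_locales (use graph spacelike in auto)
  interpret shrinker_graph u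
    by unfold_locales (use shrinker graph(2) self_shrinker_graph_iff in auto)
  interpret shrinker_graph_origin u
    by unfold_locales (use origin graph(2) in \<open>auto simp: graph_map_def zero_prod_def\<close>)
  define m where "m = real CARD('m)"
  define I where "I R = sub_int (R\<^sup>2) (\<lambda>x. (q x)\<^sup>2) / 16" for R
  have m: "m > 0" by (simp add: m_def)
  assume "\<not> ?thesis"
  then have L: "\<not> Limsup at_top (\<lambda>R. ereal (R\<^sup>2) / ereal (ln (I R))) \<le> ereal (4 * sqrt m)"
    unfolding graph(2) mean_curvature_integral I_def m_def .
  \<comment> \<open>If the bound failed at all levels \<open>t \<ge> B\<close>, the quotient would
    be at most \<open>4 sqrt m\<close> for every large \<open>R\<close>, against the assumption on
    the limsup. Here \<open>t = R\<^sup>2\<close>, which is at least \<open>R\<close> once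
    \<open>R \<ge> 1\<close>, and 16 is the denominator in \<open>I\<close>.\<close>
  have "\<exists>t\<ge>B. sub_int t (\<lambda>x. (q x)\<^sup>2) \<le> 16 * exp (t / (4 * sqrt m))" for B
  proof (rule ccontr)
    assume no: "\<not> ?thesis"
    have "eventually (\<lambda>R. ereal (R\<^sup>2) / ereal (ln (I R)) \<le> ereal (4 * sqrt m)) at_top"
      using eventually_ge_at_top[of "max 1 B"]
    proof eventually_elim
      case (elim R)
      have "B \<le> R" "1 \<le> R" using elim by auto
      then have R: "R\<^sup>2 \<ge> B" using power_increasing[of 1 2 R] by simp
      show ?case
      proof (rule ccontr)
        assume "\<not> ?case"
        then have "I R \<le> exp (R\<^sup>2 / (4 * sqrt m))"
          using m \<open>1 \<le> R\<close> sub_int_nonneg[of "\<lambda>x. (q x)\<^sup>2"]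
          by (intro ereal_quotient_gt_imp) (auto simp: I_def not_le)
        then show False using no R by (auto simp: I_def)
      qed
    qed
    then have "Limsup at_top (\<lambda>R. ereal (R\<^sup>2) / ereal (ln (I R))) \<le> ereal (4 * sqrt m)"
      by (rule Limsup_bounded)
    then show False using L by contradiction
  qed
  then have "q x = 0" for x
    by (intro q_vanishes) (simp add: m_def)
  then show False using subspace_range_if_q_eq_0 nonlinear graph(2) by blast
qed

end
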